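(* Let $(R,\mathfrak m)$ be a complete Noetherian local ring of dimension $n$, let $I\subset R$ be an ideal, and let $M$ be a finitely generated $R$-module with $\operatorname{grade}(I,M)=c$. Write $D(\cdot)=\operatorname{Hom}_R(\cdot,E_R(R/\mathfrak m))$. Then the following holds: (a) There is an isomorphism $$\operatorname{Hom}_R(H^c_I(M),H^c_I(M))\cong\operatorname{Hom}_R(D(H^c_I(M)),D(H^c_I(M))).$$ (b) The natural homomorphism $$\operatorname{Hom}_R(M,M)\to\operatorname{Hom}_R(H^c_I(M),H^c_I(M))$$ is an isomorphism if and only if the natural homomorphism $$\operatorname{Hom}_R(M,M)\to\operatorname{Hom}_R(D(H^c_I(M)),D(H^c_I(M)))$$ is an isomorphism.
   Context: $H^i_I(M)$ denotes the $i$-th local cohomology module of $M$ with respect to $I$. For finitely generated $M$, $\operatorname{grade}(I,M)=\inf\{i\in\mathbb Z: H^i_I(M)\neq 0\}$; writing $H^c_I(M)$ presupposes that $c$ is finite. $E_R(R/\mathfrak m)$ is the injective hull of the residue field, so $D$ is the Matlis dual functor. Complete means $\mathfrak m$-adically complete; then finitely generated $R$-modules are also $I$-adically complete. The first natural homomorphism in (b) is induced by functoriality of local cohomology, $f\mapsto H^c_I(f)$. The second one is its composite with the natural injective homomorphism $\operatorname{Hom}_R(X,X)\to\operatorname{Hom}_R(D(X),D(X))$ for $X=H^c_I(M)$, which is obtained by applying $\operatorname{Hom}_R(X,\cdot)$ to the canonical injection $X\to D(D(X))$ and using adjunction, i.e. $g\mapsto D(g)$. *)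

theory Defs
  imports "HOL-Algebra.Module" "HOL-Algebra.QuotRing" "HOL-Algebra.Ideal_Product"
    "HOL-Algebra.Ring_Divisibility" "HOL-Library.Extended_Nat"
begin

section \<open>Complete Noetherian local rings\<close>

definition local_ring :: "('r, 'x) ring_scheme \<Rightarrow> 'r set \<Rightarrow> bool" where
  "local_ring R \<mm> \<longleftrightarrow> cring R \<and> maximalideal \<mm> R \<and> (\<forall>\<nn>. maximalideal \<nn> R \<longrightarrow> \<nn> = \<mm>)"

definition krull_dim :: "('r, 'x) ring_scheme \<Rightarrow> enat" where
  "krull_dim R =
     (SUP n \<in> {n. \<exists>P :: nat \<Rightarrow> 'r set.
                    (\<forall>i\<le>n. primeideal (P i) R) \<and> (\<forall>i<n. P i \<subset> P (Suc i))}. enat n)"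

abbreviation ideal_power :: "('r, 'x) ring_scheme \<Rightarrow> 'r set \<Rightarrow> nat \<Rightarrow> 'r set" where
  "ideal_power R I k \<equiv> I [^]\<^bsub>ideals_set R\<^esub> k"

text \<open>The canonical map from \<open>R\<close> to the inverse limit of the \<open>R / I\<^sup>k\<close> is bijective.
  A sequence \<open>s\<close> of cosets is compatible with the projections \<open>R / I\<^sup>k\<^sup>+\<^sup>1 \<rightarrow> R / I\<^sup>k\<close> iff it is
  decreasing, since the projection sends a coset to the only coset that contains it.\<close>

definition adically_complete :: "('r, 'x) ring_scheme \<Rightarrow> 'r set \<Rightarrow> bool" where
  "adically_complete R I \<longleftrightarrow>
     bij_betw (\<lambda>r k. ideal_power R I k +>\<^bsub>R\<^esub> r) (carrier R)
       {s. (\<forall>k. s k \<in> carrier (R Quot (ideal_power R I k))) \<and> (\<forall>k. s (Suc k) \<subseteq> s k)}"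


section \<open>Modules\<close>

text \<open>Homomorphisms are extensional functions, so that equality of functions is equality of
  homomorphisms.\<close>

definition module_hom ::
    "('r, 'x) ring_scheme \<Rightarrow> ('r, 'a) module \<Rightarrow> ('r, 'b) module \<Rightarrow> ('a \<Rightarrow> 'b) set" where
  "module_hom R M N =
     {f \<in> carrier M \<rightarrow>\<^sub>E carrier N.
        (\<forall>x\<in>carrier M. \<forall>y\<in>carrier M. f (x \<oplus>\<^bsub>M\<^esub> y) = f x \<oplus>\<^bsub>N\<^esub> f y) \<and>
        (\<forall>a\<in>carrier R. \<forall>x\<in>carrier M. f (a \<odot>\<^bsub>M\<^esub> x) = a \<odot>\<^bsub>N\<^esub> f x)}"

definition module_iso ::
    "('r, 'x) ring_scheme \<Rightarrow> ('r, 'a) module \<Rightarrow> ('r, 'b) module \<Rightarrow> ('a \<Rightarrow> 'b) set" where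
  "module_iso R M N = {f \<in> module_hom R M N. bij_betw f (carrier M) (carrier N)}"

text \<open>The record type of modules also has the fields \<^const>\<open>monoid.mult\<close> and \<^const>\<open>one\<close>, on which
  the locale \<^locale>\<open>module\<close> imposes nothing; they are left unspecified below.\<close>

definition Hom :: "('r, 'x) ring_scheme \<Rightarrow> ('r, 'a) module \<Rightarrow> ('r, 'b) module \<Rightarrow> ('r, 'a \<Rightarrow> 'b) module"
  where
  "Hom R M N =
     \<lparr>carrier = module_hom R M N,
      monoid.mult = undefined, one = undefined,
      zero = (\<lambda>x\<in>carrier M. \<zero>\<^bsub>N\<^esub>),
      add = (\<lambda>f g. \<lambda>x\<in>carrier M. f x \<oplus>\<^bsub>N\<^esub> g x),
      smult = (\<lambda>a f. \<lambda>x\<in>carrier M. a \<odot>\<^bsub>N\<^esub> f x)\<rparr>"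

definition quotient_module :: "('r, 'a) module \<Rightarrow> 'a set \<Rightarrow> ('r, 'a set) module" where
  "quotient_module M N =
     \<lparr>carrier = a_rcosets\<^bsub>M\<^esub> N,
      monoid.mult = undefined, one = undefined,
      zero = N,
      add = set_add M,
      smult = (\<lambda>a C. \<Union>x\<in>C. N +>\<^bsub>M\<^esub> (a \<odot>\<^bsub>M\<^esub> x))\<rparr>"

definition self_module :: "('r, 'x) ring_scheme \<Rightarrow> ('r, 'r) module" where
  "self_module R =
     \<lparr>carrier = carrier R, monoid.mult = (\<otimes>\<^bsub>R\<^esub>), one = \<one>\<^bsub>R\<^esub>, zero = \<zero>\<^bsub>R\<^esub>, add = add R, smult = (\<otimes>\<^bsub>R\<^esub>)\<rparr>"

definition finitely_generated :: "('r, 'x) ring_scheme \<Rightarrow> ('r, 'a) module \<Rightarrow> bool" where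
  "finitely_generated R M \<longleftrightarrow>
     (\<exists>S \<subseteq> carrier M. finite S \<and> \<Inter>{N. submodule N R M \<and> S \<subseteq> N} = carrier M)"

text \<open>Injectivity is the lifting property along monomorphisms \<open>A \<rightarrow> B\<close>. Quantifiers of HOL do not
  range over types, so \<open>A\<close> and \<open>B\<close> are modules whose elements belong to the type of the
  elements of \<open>R\<close>. This loses nothing: the inclusions of ideals into \<open>R\<close> are among these
  monomorphisms, and by Baer's criterion they suffice.\<close>

definition injective_module :: "('r, 'x) ring_scheme \<Rightarrow> ('r, 'e) module \<Rightarrow> bool" where
  "injective_module R E \<longleftrightarrow> module R E \<and>
     (\<forall>(A :: ('r, 'r) module) (B :: ('r, 'r) module) i f.
        module R A \<longrightarrow> module R B \<longrightarrow> i \<in> module_hom R A B \<longrightarrow> inj_on i (carrier A) \<longrightarrow>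
        f \<in> module_hom R A E \<longrightarrow>
        (\<exists>g \<in> module_hom R B E. \<forall>x\<in>carrier A. g (i x) = f x))"

definition injective_hull :: "('r, 'x) ring_scheme \<Rightarrow> ('r, 'a) module \<Rightarrow> ('r, 'e) module \<Rightarrow> bool" where
  "injective_hull R N E \<longleftrightarrow> injective_module R E \<and>
     (\<exists>j \<in> module_hom R N E. inj_on j (carrier N) \<and>
        (\<forall>S. submodule S R E \<and> S \<noteq> {\<zero>\<^bsub>E\<^esub>} \<longrightarrow> S \<inter> j ` carrier N \<noteq> {\<zero>\<^bsub>E\<^esub>}))"

definition residue_module :: "('r, 'x) ring_scheme \<Rightarrow> 'r set \<Rightarrow> ('r, 'r set) module" where
  "residue_module R \<mm> = quotient_module (self_module R) \<mm>"

definition dual_map ::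
    "('r, 'x) ring_scheme \<Rightarrow> ('r, 'e) module \<Rightarrow> ('r, 'a) module \<Rightarrow> ('r, 'b) module \<Rightarrow>
     ('a \<Rightarrow> 'b) \<Rightarrow> ('b \<Rightarrow> 'e) \<Rightarrow> 'a \<Rightarrow> 'e" where
  "dual_map R E X Y g = (\<lambda>\<phi>\<in>carrier (Hom R Y E). compose (carrier X) \<phi> g)"


section \<open>Local cohomology\<close>

text \<open>Local cohomology is the right derived functor of the \<open>I\<close>-torsion functor. It is computed
  from an injective resolution \<open>0 \<rightarrow> M \<rightarrow> J\<^sup>0 \<rightarrow> J\<^sup>1 \<rightarrow> \<dots>\<close>, which is a parameter
  of the notions below. All terms of the resolution have their elements in one type.\<close>

record ('r, 'm, 'j) resolution =
  obj :: "nat \<Rightarrow> ('r, 'j) module"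
  diff :: "nat \<Rightarrow> 'j \<Rightarrow> 'j"
  aug :: "'m \<Rightarrow> 'j"

definition injective_resolution ::
    "('r, 'x) ring_scheme \<Rightarrow> ('r, 'm) module \<Rightarrow> ('r, 'm, 'j) resolution \<Rightarrow> bool" where
  "injective_resolution R M J \<longleftrightarrow>
     (\<forall>i. injective_module R (obj J i)) \<and>
     (\<forall>i. diff J i \<in> module_hom R (obj J i) (obj J (Suc i))) \<and>
     aug J \<in> module_hom R M (obj J 0) \<and>
     inj_on (aug J) (carrier M) \<and>
     aug J ` carrier M = a_kernel (obj J 0) (obj J 1) (diff J 0) \<and>
     (\<forall>i. diff J i ` carrier (obj J i) =
            a_kernel (obj J (Suc i)) (obj J (Suc (Suc i))) (diff J (Suc i)))"

definition torsion :: "('r, 'x) ring_scheme \<Rightarrow> 'r set \<Rightarrow> ('r, 'a) module \<Rightarrow> ('r, 'a) module" where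
  "torsion R I M =
     M\<lparr>carrier := {x \<in> carrier M. \<exists>k. \<forall>a\<in>ideal_power R I k. a \<odot>\<^bsub>M\<^esub> x = \<zero>\<^bsub>M\<^esub>}\<rparr>"

definition cocycles ::
    "('r, 'x) ring_scheme \<Rightarrow> 'r set \<Rightarrow> ('r, 'm, 'j) resolution \<Rightarrow> nat \<Rightarrow> ('r, 'j) module" where
  "cocycles R I J i =
     (obj J i)\<lparr>carrier :=
        a_kernel (torsion R I (obj J i)) (torsion R I (obj J (Suc i))) (diff J i)\<rparr>"

definition coboundaries ::
    "('r, 'x) ring_scheme \<Rightarrow> 'r set \<Rightarrow> ('r, 'm, 'j) resolution \<Rightarrow> nat \<Rightarrow> 'j set" where
  "coboundaries R I J i =
     (case i of 0 \<Rightarrow> {\<zero>\<^bsub>obj J 0\<^esub>} | Suc k \<Rightarrow> diff J k ` carrier (torsion R I (obj J k)))"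

definition local_cohomology ::
    "('r, 'x) ring_scheme \<Rightarrow> 'r set \<Rightarrow> ('r, 'm, 'j) resolution \<Rightarrow> nat \<Rightarrow> ('r, 'j set) module" where
  "local_cohomology R I J i = quotient_module (cocycles R I J i) (coboundaries R I J i)"

text \<open>The infimum of the empty set is \<open>\<infinity>\<close>. Negative degrees contribute nothing.\<close>

definition grade ::
    "('r, 'x) ring_scheme \<Rightarrow> 'r set \<Rightarrow> ('r, 'm, 'j) resolution \<Rightarrow> enat" where
  "grade R I J =
     Inf {enat i | i. carrier (local_cohomology R I J i) \<noteq> {\<zero>\<^bsub>local_cohomology R I J i\<^esub>}}"

definition chain_lift ::
    "('r, 'x) ring_scheme \<Rightarrow> ('r, 'm) module \<Rightarrow> ('r, 'm, 'j) resolution \<Rightarrow> ('r, 'n, 'k) resolution \<Rightarrow>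
     ('m \<Rightarrow> 'n) \<Rightarrow> (nat \<Rightarrow> 'j \<Rightarrow> 'k) \<Rightarrow> bool" where
  "chain_lift R M J K f \<phi> \<longleftrightarrow>
     (\<forall>i. \<phi> i \<in> module_hom R (obj J i) (obj K i)) \<and>
     (\<forall>i. \<forall>x\<in>carrier (obj J i). \<phi> (Suc i) (diff J i x) = diff K i (\<phi> i x)) \<and>
     (\<forall>x\<in>carrier M. \<phi> 0 (aug J x) = aug K (f x))"

text \<open>The induced homomorphism from the local cohomology of \<open>M\<close>, computed from \<open>J\<close>, to that of the
  target of \<open>f\<close>, computed from \<open>K\<close>. Lifts of \<open>f\<close> exist and are unique up to homotopy, so the
  choice made here does not affect the result.\<close>

definition local_cohomology_map ::
    "('r, 'x) ring_scheme \<Rightarrow> 'r set \<Rightarrow> ('r, 'm) module \<Rightarrow>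
     ('r, 'm, 'j) resolution \<Rightarrow> ('r, 'n, 'k) resolution \<Rightarrow> nat \<Rightarrow> ('m \<Rightarrow> 'n) \<Rightarrow> 'j set \<Rightarrow> 'k set" where
  "local_cohomology_map R I M J K i f =
     (let \<phi> = (SOME \<phi>. chain_lift R M J K f \<phi>) in
      (\<lambda>C\<in>carrier (local_cohomology R I J i).
        \<Union>x\<in>C. coboundaries R I K i +>\<^bsub>cocycles R I K i\<^esub> \<phi> i x))"

end

theory Submission
  imports Defs
begin

text \<open>Write \<open>H\<close> for the local cohomology module in degree \<open>c\<close> and \<open>D\<close> for Matlis duality. The isomorphism
  in (a) is the natural map \<open>g \<mapsto> D g\<close>, so (b) follows from (a). Since \<open>E\<close> is a cogenerator, this map
  is injective. For surjectivity, take \<open>\<Phi> : D H \<rightarrow> D H\<close> and \<open>x \<in> H\<close>, say with \<open>I\<^sup>k x = 0\<close>. The functional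
  \<open>\<psi> \<mapsto> (\<Phi> \<psi>) x\<close> kills \<open>I\<^sup>k D H\<close>, so by injectivity of \<open>E\<close> it factors through the dual of
  \<open>H\<^sub>k = {y \<in> H. I\<^sup>k y = 0}\<close>. Because \<open>c\<close> is the grade, \<open>H\<^sub>k\<close> is a quotient of \<open>Ext\<^sup>c(R / I\<^sup>k, M)\<close>, hence
  finitely generated, hence Matlis reflexive over the complete ring \<open>R\<close>. So the functional is the
  evaluation at some \<open>y \<in> H\<^sub>k\<close>, and \<open>x \<mapsto> y\<close> is the required preimage of \<open>\<Phi>\<close>.\<close>

section \<open>Homomorphisms and Baer's criterion\<close>

text \<open>Reflexivity may fail for \<open>H\<close>, which need be neither finitely generated nor
  Artinian; the substitute is that \<open>H\<close> is the union of the finitely generated pieces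
  \<open>H\<^sub>k\<close>. Their finite generation rests on one fact: below degree \<open>c\<close>
  the torsion complex of an injective resolution is exact, hence splits into injective modules, so
  the coboundaries in degree \<open>c\<close> are injective. A class killed by
  \<open>I\<^sup>k\<close> then has a representative killed by \<open>I\<^sup>k\<close>, which is a
  cocycle for \<open>Ext\<^sup>c(R / I\<^sup>k, M)\<close>. This requires that torsion parts of
  injective modules be injective, a property of Noetherian rings. The definition of injectivity
  tests only modules over the element type of \<open>R\<close>, whereas Hom modules, cohomology and
  free modules have other types. Baer's criterion mentions ideals only, so it is the form of
  injectivity used throughout. Reflexivity is proved by successive approximation along the
  filtration \<open>\<mm>\<^sup>k N\<close>: each correction takes place in the one-dimensional
  socle of \<open>E\<close>, and completeness supplies the limit.\<close>

text \<open>Homomorphisms on a submodule \<open>S\<close> of \<open>M\<close>; their values outside \<open>S\<close> are irrelevant.\<close>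

definition lin ::
    "('r, 'x) ring_scheme \<Rightarrow> 'a set \<Rightarrow> ('r, 'a, 'c) module_scheme \<Rightarrow> ('r, 'b, 'd) module_scheme \<Rightarrow> ('a \<Rightarrow> 'b) \<Rightarrow> bool"
  where
  "lin R S M N f \<longleftrightarrow> (\<forall>x\<in>S. f x \<in> carrier N) \<and>
    (\<forall>x\<in>S. \<forall>y\<in>S. f (x \<oplus>\<^bsub>M\<^esub> y) = f x \<oplus>\<^bsub>N\<^esub> f y) \<and>
    (\<forall>a\<in>carrier R. \<forall>x\<in>S. f (a \<odot>\<^bsub>M\<^esub> x) = a \<odot>\<^bsub>N\<^esub> f x)"

definition baer :: "('r, 'x) ring_scheme \<Rightarrow> ('r, 'e, 'd) module_scheme \<Rightarrow> bool" where
  "baer R E \<longleftrightarrow> (\<forall>I h. ideal I R \<longrightarrow> lin R I (self_module R) E h \<longrightarrow>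
     (\<exists>e\<in>carrier E. \<forall>a\<in>I. h a = a \<odot>\<^bsub>E\<^esub> e))"

lemma linI:
  assumes "\<And>x. x \<in> S \<Longrightarrow> f x \<in> carrier N"
    "\<And>x y. x \<in> S \<Longrightarrow> y \<in> S \<Longrightarrow> f (x \<oplus>\<^bsub>M\<^esub> y) = f x \<oplus>\<^bsub>N\<^esub> f y"
    "\<And>a x. a \<in> carrier R \<Longrightarrow> x \<in> S \<Longrightarrow> f (a \<odot>\<^bsub>M\<^esub> x) = a \<odot>\<^bsub>N\<^esub> f x"
  shows "lin R S M N f"
  using assms by (auto simp: lin_def)

lemma linD:
  assumes "lin R S M N f"
  shows lin_closed: "x \<in> S \<Longrightarrow> f x \<in> carrier N"
    and lin_add: "x \<in> S \<Longrightarrow> y \<in> S \<Longrightarrow> f (x \<oplus>\<^bsub>M\<^esub> y) = f x \<oplus>\<^bsub>N\<^esub> f y"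
    and lin_smult: "a \<in> carrier R \<Longrightarrow> x \<in> S \<Longrightarrow> f (a \<odot>\<^bsub>M\<^esub> x) = a \<odot>\<^bsub>N\<^esub> f x"
  using assms by (auto simp: lin_def)

lemma lin_mono: "lin R S M N f \<Longrightarrow> T \<subseteq> S \<Longrightarrow> lin R T M N f"
  by (simp add: lin_def subset_iff)

lemma lin_compose:
  "lin R S M N f \<Longrightarrow> lin R T N L g \<Longrightarrow> (\<And>x. x \<in> S \<Longrightarrow> f x \<in> T) \<Longrightarrow> lin R S M L (\<lambda>x. g (f x))"
  by (auto simp: lin_def)

lemma module_hom_iff:
  "f \<in> module_hom R M N \<longleftrightarrow> lin R (carrier M) M N f \<and> f \<in> extensional (carrier M)"
  by (auto simp: module_hom_def lin_def PiE_def)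

section \<open>Submodules, differences and factorization of linear maps\<close>

lemma submodule_subset: "submodule S R M \<Longrightarrow> S \<subseteq> carrier M"
  unfolding submodule_def subgroup_def by auto
lemma submodule_zero: "submodule S R M \<Longrightarrow> \<zero>\<^bsub>M\<^esub> \<in> S"
  unfolding submodule_def subgroup_def by auto
lemma submodule_add: "submodule S R M \<Longrightarrow> x \<in> S \<Longrightarrow> y \<in> S \<Longrightarrow> x \<oplus>\<^bsub>M\<^esub> y \<in> S"
  unfolding submodule_def subgroup_def by auto
lemma submodule_smult: "submodule S R M \<Longrightarrow> a \<in> carrier R \<Longrightarrow> y \<in> S \<Longrightarrow> a \<odot>\<^bsub>M\<^esub> y \<in> S"
  by (rule submodule.smult_closed)
lemmas submoduleD = submodule_subset submodule_zero submodule_add submodule_smult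

context module begin

lemma submoduleI':
  assumes "H \<subseteq> carrier M" "\<zero>\<^bsub>M\<^esub> \<in> H" "\<And>a b. a \<in> H \<Longrightarrow> b \<in> H \<Longrightarrow> a \<oplus>\<^bsub>M\<^esub> b \<in> H"
    "\<And>a x. a \<in> carrier R \<Longrightarrow> x \<in> H \<Longrightarrow> a \<odot>\<^bsub>M\<^esub> x \<in> H"
  shows "submodule H R M"
proof (rule submoduleI)
  fix a assume "a \<in> H"
  then have "\<ominus>\<^bsub>M\<^esub> a = (\<ominus> \<one>) \<odot>\<^bsub>M\<^esub> a" using assms(1) smult_l_minus[of \<one> a] by auto
  then show "\<ominus>\<^bsub>M\<^esub> a \<in> H" using assms(4) \<open>a \<in> H\<close> by simp
qed (use assms in auto)

text \<open>Differences are written as \<open>x \<oplus> (\<ominus> r) \<odot> y\<close> throughout,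
  since \<open>lin\<close> and the closure rules of submodules speak of addition and scaling but not
  of negation.\<close>

lemma add_neg_smult:
  assumes "x \<in> carrier M" "y \<in> carrier M" "r \<in> carrier R"
  shows "x \<oplus>\<^bsub>M\<^esub> (\<ominus> r) \<odot>\<^bsub>M\<^esub> y = \<zero>\<^bsub>M\<^esub> \<longleftrightarrow> x = r \<odot>\<^bsub>M\<^esub> y"
  using assms M.minus_equality[of x "\<ominus>\<^bsub>M\<^esub> (r \<odot>\<^bsub>M\<^esub> y)"] by (auto simp: smult_l_minus M.r_neg)

lemma add_neg_one:
  assumes "x \<in> carrier M" "y \<in> carrier M"
  shows "x \<oplus>\<^bsub>M\<^esub> (\<ominus> \<one>) \<odot>\<^bsub>M\<^esub> y = \<zero>\<^bsub>M\<^esub> \<longleftrightarrow> x = y"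
  using add_neg_smult[of x y \<one>] assms by simp

lemma split_diff:
  assumes "x \<in> carrier M" "y \<in> carrier M" "r \<in> carrier R"
  shows "(x \<oplus>\<^bsub>M\<^esub> (\<ominus> r) \<odot>\<^bsub>M\<^esub> y) \<oplus>\<^bsub>M\<^esub> r \<odot>\<^bsub>M\<^esub> y = x"
  using assms by (simp add: M.a_assoc smult_l_distr[symmetric] R.l_neg)

lemma split_diff_one:
  assumes "x \<in> carrier M" "y \<in> carrier M"
  shows "(x \<oplus>\<^bsub>M\<^esub> (\<ominus> \<one>) \<odot>\<^bsub>M\<^esub> y) \<oplus>\<^bsub>M\<^esub> y = x"
  using split_diff[of x y \<one>] assms by simp

lemma lin_zero:
  assumes "module R N" "lin R S M N f" "submodule S R M"
  shows "f \<zero>\<^bsub>M\<^esub> = \<zero>\<^bsub>N\<^esub>"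
proof -
  interpret N: module R N by fact
  have "f (\<zero>\<^bsub>R\<^esub> \<odot>\<^bsub>M\<^esub> \<zero>\<^bsub>M\<^esub>) = \<zero>\<^bsub>R\<^esub> \<odot>\<^bsub>N\<^esub> f \<zero>\<^bsub>M\<^esub>"
    by (rule lin_smult[OF assms(2)]) (use submodule_zero[OF assms(3)] in auto)
  then show ?thesis using lin_closed[OF assms(2) submodule_zero[OF assms(3)]] by simp
qed

lemma lin_cong:
  assumes "submodule S R M" "lin R S M N f" "\<And>x. x \<in> S \<Longrightarrow> g x = f x"
  shows "lin R S M N g"
  using assms(2,3) submoduleD[OF assms(1)] by (simp add: lin_def)

lemma lin_diff:
  assumes "module R N" "lin R S M N f" "submodule S R M" "x \<in> S" "y \<in> S" "r \<in> carrier R"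
  shows "f (x \<oplus>\<^bsub>M\<^esub> (\<ominus> r) \<odot>\<^bsub>M\<^esub> y) = f x \<oplus>\<^bsub>N\<^esub> (\<ominus> r) \<odot>\<^bsub>N\<^esub> f y"
  using assms lin_add[OF assms(2)] lin_smult[OF assms(2)] submodule_smult[OF assms(3)] by simp

lemma submodule_diff:
  assumes "submodule S R M" "x \<in> S" "y \<in> S" "r \<in> carrier R"
  shows "x \<oplus>\<^bsub>M\<^esub> (\<ominus> r) \<odot>\<^bsub>M\<^esub> y \<in> S"
  using assms by (simp add: submodule_add submodule_smult)

lemma lin_image_submodule:
  assumes "module R N" "lin R S M N f" "submodule S R M"
  shows "submodule (f ` S) R N"
proof -
  interpret N: module R N by fact
  show ?thesis
  proof (rule N.submoduleI')
    show "f ` S \<subseteq> carrier N" using lin_closed[OF assms(2)] by auto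
    show "\<zero>\<^bsub>N\<^esub> \<in> f ` S" using lin_zero[OF assms] submodule_zero[OF assms(3)] by (metis imageI)
    show "a \<oplus>\<^bsub>N\<^esub> b \<in> f ` S" if "a \<in> f ` S" "b \<in> f ` S" for a b
      using that lin_add[OF assms(2)] submodule_add[OF assms(3)] by (metis (no_types, lifting) imageE imageI)
    show "a \<odot>\<^bsub>N\<^esub> b \<in> f ` S" if "a \<in> carrier R" "b \<in> f ` S" for a b
      using that lin_smult[OF assms(2)] submodule_smult[OF assms(3)] by (metis (no_types, lifting) imageE imageI)
  qed
qed

lemma lin_vimage_submodule:
  assumes "module R N" "lin R S M N f" "submodule S R M" "submodule T R N"
  shows "submodule {x \<in> S. f x \<in> T} R M"
proof (rule submoduleI')
  show "\<zero>\<^bsub>M\<^esub> \<in> {x \<in> S. f x \<in> T}"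
    using lin_zero[OF assms(1-3)] submodule_zero[OF assms(3)] submodule_zero[OF assms(4)] by simp
qed (use assms lin_add[OF assms(2)] lin_smult[OF assms(2)] submoduleD[OF assms(3)] submoduleD[OF assms(4)]
  in auto)

lemma Int_submodule:
  assumes "submodule S R M" "submodule T R M"
  shows "submodule (S \<inter> T) R M"
  by (rule submoduleI') (use submoduleD[OF assms(1)] submoduleD[OF assms(2)] in auto)

lemma zero_submodule: "submodule {\<zero>\<^bsub>M\<^esub>} R M"
  by (rule submoduleI') auto

lemma lin_kernel_submodule:
  assumes "module R N" "lin R S M N f" "submodule S R M"
  shows "submodule {x \<in> S. f x = \<zero>\<^bsub>N\<^esub>} R M"
  using lin_vimage_submodule[OF assms module.zero_submodule[OF assms(1)]] by simp

text \<open>The homomorphism theorem for \<open>p\<close> on \<open>S\<close>: since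
  \<open>f\<close> kills the kernel, it is constant on the fibres of \<open>p\<close>, so any choice
  of preimages defines the same linear map on the image.\<close>

lemma lin_factor:
  assumes L: "module R L" and E: "module R E" and S: "submodule S R M"
    and p: "lin R S M L p" and f: "lin R S M E f"
    and ker: "\<And>x. x \<in> S \<Longrightarrow> p x = \<zero>\<^bsub>L\<^esub> \<Longrightarrow> f x = \<zero>\<^bsub>E\<^esub>"
  shows "\<exists>g. lin R (p ` S) L E g \<and> (\<forall>x\<in>S. g (p x) = f x)"
proof -
  interpret L: module R L by fact
  interpret E: module R E by fact
  define g where "g y = f (inv_into S p y)" for y
  have eq: "f x = f x'" if "x \<in> S" "x' \<in> S" "p x = p x'" for x x'
  proof -
    have "p (x \<oplus>\<^bsub>M\<^esub> (\<ominus> \<one>) \<odot>\<^bsub>M\<^esub> x') = \<zero>\<^bsub>L\<^esub>"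
      using lin_diff[OF L p S that(1,2), of \<one>] L.add_neg_one lin_closed[OF p] that by simp
    then have "f (x \<oplus>\<^bsub>M\<^esub> (\<ominus> \<one>) \<odot>\<^bsub>M\<^esub> x') = \<zero>\<^bsub>E\<^esub>"
      using ker submodule_diff[OF S that(1,2), of \<one>] by simp
    then show ?thesis
      using lin_diff[OF E f S that(1,2), of \<one>] E.add_neg_one lin_closed[OF f] that by simp
  qed
  have gp: "g (p x) = f x" if "x \<in> S" for x
    unfolding g_def using that by (intro eq) (auto simp: inv_into_into f_inv_into_f)
  have "lin R (p ` S) L E g"
  proof (rule linI)
    fix u assume "u \<in> p ` S"
    then show "g u \<in> carrier E" using gp lin_closed[OF f] by auto
  next
    fix u v assume "u \<in> p ` S" "v \<in> p ` S"
    then obtain x y where "x \<in> S" "y \<in> S" "u = p x" "v = p y" by auto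
    then show "g (u \<oplus>\<^bsub>L\<^esub> v) = g u \<oplus>\<^bsub>E\<^esub> g v"
      using gp[of "x \<oplus>\<^bsub>M\<^esub> y"] submodule_add[OF S] by (simp add: gp lin_add[OF p] lin_add[OF f])
  next
    fix a u assume a: "a \<in> carrier R" and "u \<in> p ` S"
    then obtain x where "x \<in> S" "u = p x" by auto
    then show "g (a \<odot>\<^bsub>L\<^esub> u) = a \<odot>\<^bsub>E\<^esub> g u"
      using a gp[of "a \<odot>\<^bsub>M\<^esub> x"] submodule_smult[OF S a] by (simp add: gp lin_smult[OF p] lin_smult[OF f])
  qed
  then show ?thesis using gp by blast
qed

end

section \<open>Ideals as submodules of the regular module\<close>

context cring begin

lemma idealI':
  assumes "A \<subseteq> carrier R" "\<zero> \<in> A" "\<And>a b. a \<in> A \<Longrightarrow> b \<in> A \<Longrightarrow> a \<oplus> b \<in> A"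
    "\<And>a b. a \<in> carrier R \<Longrightarrow> b \<in> A \<Longrightarrow> a \<otimes> b \<in> A"
  shows "ideal A R"
proof (rule idealI)
  show "ring R" by (rule ring_axioms)
  show "subgroup A (add_monoid R)"
  proof (rule add.subgroupI)
    show "\<ominus> a \<in> A" if "a \<in> A" for a
      using assms(4)[of "\<ominus> \<one>" a] assms(1) that by (auto simp: l_minus)
  qed (use assms in auto)
  show "a \<otimes> b \<in> A" if "b \<in> A" "a \<in> carrier R" for a b using assms that by blast
  show "b \<otimes> a \<in> A" if "b \<in> A" "a \<in> carrier R" for a b
    using assms(4)[of a b] assms(1) that m_comm[of a b] by auto
qed

lemma idealD:
  assumes "ideal A R"
  shows ideal_subset: "A \<subseteq> carrier R" and ideal_zero: "\<zero> \<in> A"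
    and ideal_add: "\<And>a b. a \<in> A \<Longrightarrow> b \<in> A \<Longrightarrow> a \<oplus> b \<in> A"
    and ideal_mult: "\<And>a b. a \<in> carrier R \<Longrightarrow> b \<in> A \<Longrightarrow> a \<otimes> b \<in> A"
    and ideal_mult_right: "\<And>a b. a \<in> carrier R \<Longrightarrow> b \<in> A \<Longrightarrow> b \<otimes> a \<in> A"
proof -
  interpret ideal A R by fact
  show "A \<subseteq> carrier R" "\<zero> \<in> A" "\<And>a b. a \<in> A \<Longrightarrow> b \<in> A \<Longrightarrow> a \<oplus> b \<in> A"
    "\<And>a b. a \<in> carrier R \<Longrightarrow> b \<in> A \<Longrightarrow> a \<otimes> b \<in> A"
    "\<And>a b. a \<in> carrier R \<Longrightarrow> b \<in> A \<Longrightarrow> b \<otimes> a \<in> A"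
    using a_subset I_l_closed I_r_closed by auto
qed

lemma self_module: "module R (self_module R)"
proof (rule moduleI)
  show "cring R" by (rule cring_axioms)
  show "abelian_group (self_module R)"
    by (rule abelian_groupI)
      (auto simp: self_module_def a_ac intro!: bexI[of _ "\<ominus> x" for x] l_neg)
qed (auto simp: self_module_def l_distr r_distr m_assoc)

lemma submodule_self_iff: "submodule A R (self_module R) \<longleftrightarrow> ideal A R"
proof
  assume A: "submodule A R (self_module R)"
  show "ideal A R"
    by (rule idealI') (use submoduleD[OF A] in \<open>auto simp: self_module_def\<close>)
next
  assume A: "ideal A R"
  show "submodule A R (self_module R)"
    by (rule module.submoduleI'[OF self_module]) (use idealD[OF A] in \<open>auto simp: self_module_def\<close>)
qed

end

section \<open>Extending homomorphisms by Baer's criterion\<close>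

definition prod_module ::
    "('r, 'a, 'c) module_scheme \<Rightarrow> ('r, 'b, 'd) module_scheme \<Rightarrow> ('r, 'a \<times> 'b) module" where
  "prod_module M N = \<lparr>carrier = carrier M \<times> carrier N, monoid.mult = undefined, one = undefined,
     zero = (\<zero>\<^bsub>M\<^esub>, \<zero>\<^bsub>N\<^esub>), add = (\<lambda>p q. (fst p \<oplus>\<^bsub>M\<^esub> fst q, snd p \<oplus>\<^bsub>N\<^esub> snd q)),
     smult = (\<lambda>a p. (a \<odot>\<^bsub>M\<^esub> fst p, a \<odot>\<^bsub>N\<^esub> snd p))\<rparr>"

context module begin

lemma lin_orbit:
  assumes "x \<in> carrier M"
  shows "lin R (carrier R) (self_module R) M (\<lambda>r. r \<odot>\<^bsub>M\<^esub> x)"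
  by (rule linI) (use assms in \<open>auto simp: self_module_def smult_l_distr smult_assoc1\<close>)

lemma prod_module:
  assumes "module R N"
  shows "module R (prod_module M N)"
proof -
  interpret N: module R N by fact
  show ?thesis
  proof (rule moduleI)
    show "abelian_group (prod_module M N)"
    proof (rule abelian_groupI)
      fix p assume "p \<in> carrier (prod_module M N)"
      then show "\<exists>q\<in>carrier (prod_module M N). q \<oplus>\<^bsub>prod_module M N\<^esub> p = \<zero>\<^bsub>prod_module M N\<^esub>"
        by (intro bexI[of _ "(\<ominus>\<^bsub>M\<^esub> fst p, \<ominus>\<^bsub>N\<^esub> snd p)"]) (auto simp: prod_module_def M.l_neg N.l_neg)
    qed (auto simp: prod_module_def M.a_ac N.a_ac)
  qed (auto simp: prod_module_def R.cring_axioms smult_l_distr smult_r_distr smult_assoc1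
      N.smult_l_distr N.smult_r_distr N.smult_assoc1)
qed

lemma chain_Union_submodule:
  assumes "C \<noteq> {}" "subset.chain {S. submodule S R M} C"
  shows "submodule (\<Union>C) R M"
proof (rule submoduleI')
  have sub: "submodule S R M" if "S \<in> C" for S using assms(2) that by (auto simp: subset_chain_def)
  show "\<Union>C \<subseteq> carrier M" using submodule_subset[OF sub] by blast
  show "\<zero>\<^bsub>M\<^esub> \<in> \<Union>C" using assms(1) submodule_zero[OF sub] by blast
  show "a \<odot>\<^bsub>M\<^esub> x \<in> \<Union>C" if "a \<in> carrier R" "x \<in> \<Union>C" for a x
    using that submodule_smult[OF sub] by blast
  fix x y assume "x \<in> \<Union>C" "y \<in> \<Union>C"
  then obtain S where "S \<in> C" "x \<in> S" "y \<in> S" using assms(2) unfolding subset_chain_def by blast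
  then show "x \<oplus>\<^bsub>M\<^esub> y \<in> \<Union>C" using submodule_add[OF sub] by blast
qed

lemma submodule_plus_principal:
  assumes S: "submodule S R M" and x: "x \<in> carrier M"
  shows "submodule {s \<oplus>\<^bsub>M\<^esub> r \<odot>\<^bsub>M\<^esub> x | s r. s \<in> S \<and> r \<in> carrier R} R M" (is "submodule ?X R M")
    and "S \<subseteq> {s \<oplus>\<^bsub>M\<^esub> r \<odot>\<^bsub>M\<^esub> x | s r. s \<in> S \<and> r \<in> carrier R}"
    and "x \<in> {s \<oplus>\<^bsub>M\<^esub> r \<odot>\<^bsub>M\<^esub> x | s r. s \<in> S \<and> r \<in> carrier R}"
proof -
  have Sc: "s \<in> carrier M" if "s \<in> S" for s using that submodule_subset[OF S] by blast
  show "S \<subseteq> ?X"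
  proof
    fix s assume s: "s \<in> S"
    then have "s = s \<oplus>\<^bsub>M\<^esub> \<zero> \<odot>\<^bsub>M\<^esub> x" using Sc x by simp
    then show "s \<in> ?X" using s by blast
  qed
  show "x \<in> ?X"
    using submodule_zero[OF S] x by (intro CollectI exI[of _ "\<zero>\<^bsub>M\<^esub>"] exI[of _ \<one>]) simp
  show "submodule ?X R M"
  proof (rule submoduleI')
    show "?X \<subseteq> carrier M" using Sc x by auto
    show "\<zero>\<^bsub>M\<^esub> \<in> ?X" using submodule_zero[OF S] \<open>S \<subseteq> ?X\<close> by blast
    fix u assume "u \<in> ?X"
    then obtain s r where u: "u = s \<oplus>\<^bsub>M\<^esub> r \<odot>\<^bsub>M\<^esub> x" "s \<in> S" "r \<in> carrier R" by blast
    show "a \<odot>\<^bsub>M\<^esub> u \<in> ?X" if a: "a \<in> carrier R" for a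
    proof -
      have "a \<odot>\<^bsub>M\<^esub> u = a \<odot>\<^bsub>M\<^esub> s \<oplus>\<^bsub>M\<^esub> (a \<otimes> r) \<odot>\<^bsub>M\<^esub> x"
        using a u Sc x by (simp add: smult_r_distr smult_assoc1)
      then show ?thesis using submodule_smult[OF S a u(2)] a u(3) by blast
    qed
    fix v assume "v \<in> ?X"
    then obtain t q where v: "v = t \<oplus>\<^bsub>M\<^esub> q \<odot>\<^bsub>M\<^esub> x" "t \<in> S" "q \<in> carrier R" by blast
    have "u \<oplus>\<^bsub>M\<^esub> v = (s \<oplus>\<^bsub>M\<^esub> t) \<oplus>\<^bsub>M\<^esub> (r \<oplus> q) \<odot>\<^bsub>M\<^esub> x"
      using u v Sc x by (simp add: smult_l_distr M.a_ac)
    then show "u \<oplus>\<^bsub>M\<^esub> v \<in> ?X" using submodule_add[OF S u(2) v(2)] u(3) v(3) by blast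
  qed
qed

text \<open>Zorn's lemma yields a maximal graph among the graphs of the partial homomorphisms that
  extend \<open>f\<close>.\<close>

lemma baer_extend:
  assumes E: "module R E" and B: "baer R E" and S: "submodule S R M" and f: "lin R S M E f"
  shows "\<exists>g. lin R (carrier M) M E g \<and> (\<forall>x\<in>S. g x = f x)"
proof -
  interpret E: module R E by fact
  interpret S: module R "self_module R" by (rule R.self_module)
  let ?P = "prod_module M E" and ?gr = "(\<lambda>x. (x, f x)) ` S"
  interpret P: module R ?P by (rule prod_module[OF E])
  have l1: "lin R (carrier ?P) ?P M fst" and l2: "lin R (carrier ?P) ?P E snd"
    by (auto simp: lin_def prod_module_def)
  \<comment> \<open>A submodule of the product is the graph of a partial map as soon as nothing but
    zero lies over zero. The last clause records this.\<close>
  define \<G> where "\<G> = {G. submodule G R ?P \<and> ?gr \<subseteq> G \<and> (\<forall>p\<in>G. fst p = \<zero>\<^bsub>M\<^esub> \<longrightarrow> snd p = \<zero>\<^bsub>E\<^esub>)}"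
  have "lin R S M ?P (\<lambda>x. (x, f x))"
    using lin_closed[OF f] submodule_subset[OF S]
    by (intro linI) (auto simp: prod_module_def lin_add[OF f] lin_smult[OF f])
  from lin_image_submodule[OF P.module_axioms this S] have "?gr \<in> \<G>"
    using lin_zero[OF E f S] by (auto simp: \<G>_def)
  then have "\<exists>G\<in>\<G>. \<forall>X\<in>\<G>. G \<subseteq> X \<longrightarrow> X = G"
  proof (intro subset_Zorn_nonempty)
    fix C assume C: "C \<noteq> {}" "subset.chain \<G> C"
    have "subset.chain {S. submodule S R ?P} C" using C(2) by (auto simp: subset_chain_def \<G>_def)
    then have "submodule (\<Union>C) R ?P" by (rule P.chain_Union_submodule[OF C(1)])
    then show "\<Union>C \<in> \<G>" using C by (fastforce simp: subset_chain_def \<G>_def)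
  qed auto
  then obtain G where "G \<in> \<G>" and "\<forall>X\<in>\<G>. G \<subseteq> X \<longrightarrow> X = G" by (elim bexE)
  note max = this(2)[rule_format]
  have G: "submodule G R ?P" "?gr \<subseteq> G" "\<And>p. p \<in> G \<Longrightarrow> fst p = \<zero>\<^bsub>M\<^esub> \<Longrightarrow> snd p = \<zero>\<^bsub>E\<^esub>"
    using \<open>G \<in> \<G>\<close> by (auto simp: \<G>_def)
  note Gc = submodule_subset[OF G(1)]
  have D: "submodule (fst ` G) R M"
    by (rule P.lin_image_submodule[OF module_axioms lin_mono[OF l1 Gc] G(1)])
  obtain g where g: "lin R (fst ` G) M E g" and gp: "\<forall>p\<in>G. g (fst p) = snd p"
  proof -
    have "\<exists>g. lin R (fst ` G) M E g \<and> (\<forall>p\<in>G. g (fst p) = snd p)"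
      by (rule P.lin_factor[OF module_axioms E G(1) lin_mono[OF l1 Gc] lin_mono[OF l2 Gc] G(3)])
    then show thesis using that by (elim exE conjE)
  qed
  have "x \<in> fst ` G" if x: "x \<in> carrier M" for x
  proof -
    have o: "lin R (carrier R) (self_module R) M (\<lambda>r. r \<odot>\<^bsub>M\<^esub> x)" by (rule lin_orbit[OF x])
    \<comment> \<open>The scalars that move \<open>x\<close> into the domain of \<open>g\<close>.
      Baer's criterion turns \<open>r \<mapsto> g (r x)\<close> into multiplication by some
      \<open>e\<close>, the value to be assigned to \<open>x\<close>.\<close>
    let ?I = "{r \<in> carrier R. r \<odot>\<^bsub>M\<^esub> x \<in> fst ` G}"
    have "submodule (carrier R) R (self_module R)"
      using S.carrier_is_submodule by (simp add: self_module_def)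
    then have "submodule ?I R (self_module R)" by (rule S.lin_vimage_submodule[OF module_axioms o _ D])
    then have I: "ideal ?I R" by (simp add: R.submodule_self_iff)
    have "lin R ?I (self_module R) M (\<lambda>r. r \<odot>\<^bsub>M\<^esub> x)" by (rule lin_mono[OF o]) auto
    then have "lin R ?I (self_module R) E (\<lambda>r. g (r \<odot>\<^bsub>M\<^esub> x))"
      using g by (rule lin_compose) simp
    then obtain e where e: "e \<in> carrier E" and he: "\<And>r. r \<in> ?I \<Longrightarrow> g (r \<odot>\<^bsub>M\<^esub> x) = r \<odot>\<^bsub>E\<^esub> e"
      using B[unfolded baer_def, rule_format, OF I] by blast
    have "(x, e) \<in> carrier ?P" using x e by (simp add: prod_module_def)
    note X = P.submodule_plus_principal[OF G(1) this]
    let ?X = "{p \<oplus>\<^bsub>?P\<^esub> r \<odot>\<^bsub>?P\<^esub> (x, e) | p r. p \<in> G \<and> r \<in> carrier R}"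
    have "snd q = \<zero>\<^bsub>E\<^esub>" if q: "q \<in> ?X" "fst q = \<zero>\<^bsub>M\<^esub>" for q
    proof -
      obtain p r where p: "q = p \<oplus>\<^bsub>?P\<^esub> r \<odot>\<^bsub>?P\<^esub> (x, e)" "p \<in> G" and r: "r \<in> carrier R"
        using q(1) by blast
      have pc: "fst p \<in> carrier M" "snd p \<in> carrier E" using p(2) Gc by (auto simp: prod_module_def)
      \<comment> \<open>The negative of \<open>p\<close> lies in the graph over \<open>r x\<close>;
        hence \<open>r \<in> ?I\<close>, and there \<open>g\<close> agrees with multiplication by
        \<open>e\<close>.\<close>
      let ?n = "(\<ominus> \<one>) \<odot>\<^bsub>?P\<^esub> p"
      have n: "?n \<in> G" by (rule submodule_smult[OF G(1) _ p(2)]) simp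
      have "fst p \<oplus>\<^bsub>M\<^esub> r \<odot>\<^bsub>M\<^esub> x = \<zero>\<^bsub>M\<^esub>" using q(2) p(1) by (simp add: prod_module_def)
      then have "\<ominus>\<^bsub>M\<^esub> fst p = r \<odot>\<^bsub>M\<^esub> x"
        using M.minus_equality[of "r \<odot>\<^bsub>M\<^esub> x" "fst p"] pc r x by (simp add: M.a_comm)
      then have rx: "r \<odot>\<^bsub>M\<^esub> x = fst ?n" using pc by (simp add: prod_module_def smult_l_minus)
      then have "r \<in> ?I" using r n by auto
      then have "r \<odot>\<^bsub>E\<^esub> e = snd ?n" using he[of r] gp n rx by simp
      then show ?thesis
        using p(1) pc by (simp add: prod_module_def E.smult_l_minus E.r_neg)
    qed
    then have "?X \<in> \<G>" using X(1,2) G(2) by (auto simp: \<G>_def)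
    then have "(x, e) \<in> G" using max X(2,3) by blast
    then show ?thesis by force
  qed
  then have "carrier M \<subseteq> fst ` G" by blast
  moreover have "g x = f x" if "x \<in> S" for x
  proof -
    have "(x, f x) \<in> G" using G(2) that by blast
    then show ?thesis using gp by force
  qed
  ultimately show ?thesis using lin_mono[OF g] by (intro exI conjI ballI)
qed

text \<open>Factoring through the image of \<open>p\<close> and then extending to \<open>L\<close>
  gives the lifting property for modules over arbitrary element types, and for maps \<open>p\<close>
  that need not be injective as long as \<open>f\<close> kills their kernel.\<close>

lemma baer_lift:
  assumes "module R L" "module R E" "baer R E" "submodule S R M" "lin R S M L p" "lin R S M E f"
    "\<And>x. x \<in> S \<Longrightarrow> p x = \<zero>\<^bsub>L\<^esub> \<Longrightarrow> f x = \<zero>\<^bsub>E\<^esub>"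
  shows "\<exists>g. lin R (carrier L) L E g \<and> (\<forall>x\<in>S. g (p x) = f x)"
proof -
  obtain g where "lin R (p ` S) L E g" "\<forall>x\<in>S. g (p x) = f x"
    using lin_factor[OF assms(1,2,4-7)] by blast
  moreover then obtain g' where "lin R (carrier L) L E g'" "\<forall>y\<in>p ` S. g' y = g y"
    using module.baer_extend[OF assms(1,2,3) lin_image_submodule[OF assms(1,5,4)]] by blast
  ultimately show ?thesis by auto
qed

end

section \<open>Torsion over Noetherian rings\<close>

text \<open>A chain of ideals in a Noetherian ring contains its own union, so Zorn's lemma applies
  to every nonempty family of ideals, without any closure condition on the family.\<close>

lemma noetherian_maximal:
  assumes "noetherian_ring R" "F \<noteq> {}" "\<And>A. A \<in> F \<Longrightarrow> ideal A R"
  shows "\<exists>A\<in>F. \<forall>B\<in>F. A \<subseteq> B \<longrightarrow> B = A"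
proof -
  interpret noetherian_ring R by fact
  show ?thesis
  proof (rule subset_Zorn_nonempty)
    fix C assume C: "C \<noteq> {}" "subset.chain F C"
    then have "subset.chain {I. ideal I R} C" using assms(3) by (auto simp: subset_chain_def)
    then have "\<Union>C \<in> C" by (rule ideal_chain_is_trivial[OF C(1)])
    then show "\<Union>C \<in> F" using C(2) by (auto simp: subset_chain_def)
  qed (use assms in simp)
qed

section \<open>Colon ideals and powers of ideals\<close>

context cring begin

lemma ideal_cancel:
  assumes "ideal A R" "a \<oplus> b \<in> A" "a \<in> A" "b \<in> carrier R"
  shows "b \<in> A"
proof -
  have a: "a \<in> carrier R" using assms ideal_subset by blast
  have "(\<ominus> \<one>) \<otimes> a \<oplus> (a \<oplus> b) \<in> A" using assms ideal_mult[of A] ideal_add[of A] by simp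
  moreover have "(\<ominus> \<one>) \<otimes> a \<oplus> (a \<oplus> b) = b" using a assms(4) by (simp add: l_minus r_neg1)
  ultimately show ?thesis by simp
qed

lemma colon_ideal:
  assumes "ideal A R" "r \<in> carrier R"
  shows "ideal {x \<in> carrier R. x \<otimes> r \<in> A} R"
  using idealD[OF assms(1)] assms(2)
  by (intro idealI') (auto simp: l_distr m_assoc)

lemma ideal_plus_principal:
  assumes "ideal A R" "r \<in> carrier R"
  shows "ideal {a \<oplus> s \<otimes> r | a s. a \<in> A \<and> s \<in> carrier R} R" (is "ideal ?B R")
    and "A \<subseteq> {a \<oplus> s \<otimes> r | a s. a \<in> A \<and> s \<in> carrier R}"
    and "r \<in> {a \<oplus> s \<otimes> r | a s. a \<in> A \<and> s \<in> carrier R}"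
proof -
  have S: "submodule A R (self_module R)" using assms(1) by (simp add: submodule_self_iff)
  note P = module.submodule_plus_principal[OF self_module S, of r]
  have eq: "?B = {a \<oplus>\<^bsub>self_module R\<^esub> s \<odot>\<^bsub>self_module R\<^esub> r | a s. a \<in> A \<and> s \<in> carrier R}"
    and r: "r \<in> carrier (self_module R)"
    using assms(2) by (simp_all add: self_module_def)
  show "ideal ?B R" using P(1)[OF r] unfolding eq submodule_self_iff .
  show "A \<subseteq> ?B" "r \<in> ?B" unfolding eq by (rule P(2)[OF r] P(3)[OF r])+
qed

lemma ideal_power_0: "ideal_power R I 0 = carrier R"
  by (simp add: nat_pow_def ideals_set_def)

lemma ideal_power_Suc: "ideal_power R I (Suc k) = ideal_prod R (ideal_power R I k) I"
  by (simp add: nat_pow_def ideals_set_def)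

lemma ideal_power_ideal:
  assumes "ideal I R"
  shows "ideal (ideal_power R I k) R"
proof (induction k)
  case 0
  show ?case unfolding ideal_power_0 by (rule oneideal)
next
  case (Suc k)
  then show ?case unfolding ideal_power_Suc by (rule ideal_prod_is_ideal[OF _ assms])
qed

lemma ideal_power_mult:
  assumes "a \<in> ideal_power R I k" "b \<in> I"
  shows "a \<otimes> b \<in> ideal_power R I (Suc k)"
  unfolding ideal_power_Suc using assms by (rule ideal_prod.prod)

lemma ideal_power_Suc_subset:
  assumes "ideal A R" "\<And>a b. a \<in> ideal_power R I k \<Longrightarrow> b \<in> I \<Longrightarrow> a \<otimes> b \<in> A"
  shows "ideal_power R I (Suc k) \<subseteq> A"
proof
  fix x assume "x \<in> ideal_power R I (Suc k)"
  then have "x \<in> ideal_prod R (ideal_power R I k) I" by (simp only: ideal_power_Suc)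
  then show "x \<in> A"
    by (induction rule: ideal_prod.induct) (use assms(2) ideal_add[OF assms(1)] in auto)
qed

lemma ideal_power_antimono:
  assumes "ideal I R" "k \<le> l"
  shows "ideal_power R I l \<subseteq> ideal_power R I k"
proof (rule lift_Suc_antimono_le[OF _ assms(2)])
  fix n
  show "ideal_power R I (Suc n) \<subseteq> ideal_power R I n"
  proof (rule ideal_power_Suc_subset[OF ideal_power_ideal[OF assms(1)]])
    fix a b assume "a \<in> ideal_power R I n" "b \<in> I"
    then show "a \<otimes> b \<in> ideal_power R I n"
      using ideal_mult_right[OF ideal_power_ideal[OF assms(1), of n]] ideal_subset[OF assms(1)]
      by blast
  qed
qed

text \<open>The hypothesis says that every nonzero cyclic submodule of \<open>R / A\<close> contains a nonzero
  element annihilated by \<open>I\<close>. If \<open>(A : r)\<close> is maximal among the colon ideals of elements that no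
  power of \<open>I\<close> carries into \<open>A\<close>, then multiplying \<open>r\<close> by an element of \<open>I\<close> enlarges the colon ideal.\<close>

lemma ideal_power_subset_if_essential:
  assumes noeth: "noetherian_ring R" and A: "ideal A R" and I: "ideal I R"
    and ess: "\<And>r. r \<in> carrier R \<Longrightarrow> r \<notin> A \<Longrightarrow>
      \<exists>u\<in>carrier R. u \<otimes> r \<notin> A \<and> (\<forall>i\<in>I. i \<otimes> (u \<otimes> r) \<in> A)"
  shows "\<exists>s. ideal_power R I s \<subseteq> A"
proof (rule ccontr)
  assume contra: "\<not> ?thesis"
  \<comment> \<open>No power of \<open>I\<close> carries a bad \<open>r\<close> into
    \<open>A\<close>. If the claim fails, then \<open>\<one>\<close> is bad.\<close>
  define bad where "bad r \<longleftrightarrow> r \<in> carrier R \<and> (\<forall>s. \<exists>a\<in>ideal_power R I s. a \<otimes> r \<notin> A)" for r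
  define col where "col r = {x \<in> carrier R. x \<otimes> r \<in> A}" for r
  have Pc: "a \<in> carrier R" if "a \<in> ideal_power R I s" for a s
    using that ideal_subset[OF ideal_power_ideal[OF I]] by blast
  have "bad \<one>" using contra Pc by (fastforce simp: bad_def)
  then have "\<exists>X\<in>col ` {r. bad r}. \<forall>B\<in>col ` {r. bad r}. X \<subseteq> B \<longrightarrow> B = X"
    using colon_ideal[OF A]
    by (intro noetherian_maximal[OF noeth]) (auto simp: col_def bad_def)
  then obtain X where X: "X \<in> col ` {r. bad r}"
    and "\<forall>B\<in>col ` {r. bad r}. X \<subseteq> B \<longrightarrow> B = X" by (elim bexE)
  note max = this(2)[rule_format]
  from X obtain r where r: "bad r" "X = col r" by blast
  have rc: "r \<in> carrier R" using r(1) by (simp add: bad_def)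
  have "r \<notin> A" using r(1) ideal_mult[OF A] Pc unfolding bad_def by blast
  then obtain u where u: "u \<in> carrier R" "u \<otimes> r \<notin> A" "\<And>i. i \<in> I \<Longrightarrow> i \<otimes> (u \<otimes> r) \<in> A"
    using ess[OF rc \<open>r \<notin> A\<close>] by blast
  have good: "\<exists>s. \<forall>a\<in>ideal_power R I s. a \<otimes> (i \<otimes> r) \<in> A" if i: "i \<in> I" for i
  proof -
    have ic: "i \<in> carrier R" using i ideal_subset[OF I] by blast
    have "x \<otimes> (i \<otimes> r) = i \<otimes> (x \<otimes> r)" if "x \<in> carrier R" for x
      using that ic rc by (simp add: m_lcomm)
    then have "col r \<subseteq> col (i \<otimes> r)" using ideal_mult[OF A ic] by (auto simp: col_def)
    \<comment> \<open>The multiple of \<open>r\<close> supplied by the hypothesis witnesses that the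
      inclusion of colon ideals is strict.\<close>
    moreover have "u \<in> col (i \<otimes> r)" "u \<notin> col r"
      using u i ic rc by (auto simp: col_def m_lcomm)
    ultimately have "\<not> bad (i \<otimes> r)" using max r(2) by blast
    then show ?thesis using ic rc by (auto simp: bad_def)
  qed
  \<comment> \<open>Finitely many generators of \<open>I\<close> admit a common exponent
    \<open>S\<close>; the colon ideal of \<open>a \<otimes> r\<close> then extends the conclusion
    from the generators to \<open>I\<close>.\<close>
  obtain G where G: "G \<subseteq> carrier R" "finite G" "I = Idl G"
    using noetherian_ring.finetely_gen[OF noeth I] by blast
  have GI: "G \<subseteq> I" using genideal_self[OF G(1)] G(3) by simp
  then obtain s where s: "\<And>i. i \<in> G \<Longrightarrow> \<forall>a\<in>ideal_power R I (s i). a \<otimes> (i \<otimes> r) \<in> A"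
    using good by (metis subsetD)
  define S where "S = Max (insert 0 (s ` G))"
  have S: "a \<otimes> (i \<otimes> r) \<in> A" if "i \<in> G" "a \<in> ideal_power R I S" for i a
  proof -
    have "s i \<le> S" using that(1) G(2) by (simp add: S_def)
    then show ?thesis using s[OF that(1)] that(2) ideal_power_antimono[OF I] by blast
  qed
  have "a \<otimes> (i \<otimes> r) \<in> A" if a: "a \<in> ideal_power R I S" and i: "i \<in> I" for a i
  proof -
    have "ideal {x \<in> carrier R. x \<otimes> (a \<otimes> r) \<in> A} R"
      using Pc[OF a] rc by (intro colon_ideal[OF A]) simp
    moreover have "G \<subseteq> {x \<in> carrier R. x \<otimes> (a \<otimes> r) \<in> A}"
      using S[OF _ a] G(1) Pc[OF a] rc by (auto simp: m_lcomm[of _ a r])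
    ultimately have "I \<subseteq> {x \<in> carrier R. x \<otimes> (a \<otimes> r) \<in> A}"
      unfolding G(3) by (rule genideal_minimal)
    then show ?thesis using i Pc[OF a] rc by (auto simp: m_lcomm[of _ a r])
  qed
  then have "ideal_power R I (Suc S) \<subseteq> {x \<in> carrier R. x \<otimes> r \<in> A}"
    using Pc ideal_subset[OF I] rc
    by (intro ideal_power_Suc_subset colon_ideal[OF A rc]) (auto simp: m_assoc subset_iff)
  then show False using r(1) unfolding bad_def by blast
qed

end

section \<open>Local rings\<close>

lemma local_ring_unit_mod:
  fixes R (structure)
  assumes "local_ring R \<mm>" "r \<in> carrier R" "r \<notin> \<mm>"
  shows "\<exists>i\<in>\<mm>. \<exists>s\<in>carrier R. \<one>\<^bsub>R\<^esub> = i \<oplus>\<^bsub>R\<^esub> s \<otimes>\<^bsub>R\<^esub> r"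
proof -
  interpret cring R using assms by (simp add: local_ring_def)
  interpret maximalideal \<mm> R using assms by (simp add: local_ring_def)
  let ?B = "{a \<oplus> s \<otimes> r | a s. a \<in> \<mm> \<and> s \<in> carrier R}"
  note B = ideal_plus_principal[OF is_ideal assms(2)]
  have "?B = carrier R" using I_maximal[OF B(1,2)] ideal_subset[OF B(1)] B(3) assms(3) by blast
  then have "\<one> \<in> ?B" by simp
  then show ?thesis by blast
qed

text \<open>A maximal element among the proper ideals above \<open>A\<close> is a maximal ideal, and
  locality leaves only \<open>\<mm>\<close>.\<close>

lemma local_ring_proper_ideal:
  assumes "local_ring R \<mm>" "noetherian_ring R" "ideal A R" "A \<noteq> carrier R"
  shows "A \<subseteq> \<mm>"
proof -
  interpret cring R using assms by (simp add: local_ring_def)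
  have "\<exists>N\<in>{B. ideal B R \<and> A \<subseteq> B \<and> B \<noteq> carrier R}.
      \<forall>B\<in>{B. ideal B R \<and> A \<subseteq> B \<and> B \<noteq> carrier R}. N \<subseteq> B \<longrightarrow> B = N"
    by (intro noetherian_maximal[OF assms(2)]) (use assms in auto)
  then obtain N where N: "N \<in> {B. ideal B R \<and> A \<subseteq> B \<and> B \<noteq> carrier R}"
    and "\<forall>B\<in>{B. ideal B R \<and> A \<subseteq> B \<and> B \<noteq> carrier R}. N \<subseteq> B \<longrightarrow> B = N"
    by (elim bexE)
  note max = this(2)[rule_format]
  have "maximalideal N R"
  proof (rule maximalidealI)
    show "ideal N R" "carrier R \<noteq> N" using N by auto
    fix B assume "ideal B R" "N \<subseteq> B" "B \<subseteq> carrier R"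
    then show "B = N \<or> B = carrier R" using max[of B] N by blast
  qed
  then show ?thesis using assms(1) N by (auto simp: local_ring_def)
qed

lemma local_ring_one_notin: "local_ring R \<mm> \<Longrightarrow> \<one>\<^bsub>R\<^esub> \<notin> \<mm>"
  unfolding local_ring_def using ideal.one_imp_carrier maximalideal.I_notcarr maximalideal.axioms(1)
  by blast

section \<open>Quotient modules\<close>

lemma quotient_module:
  fixes M :: "('r, 'm) module"
  assumes M: "module R M" and N: "submodule N R M"
  shows quotient_module_carrier: "carrier (quotient_module M N) = (\<lambda>x. N +>\<^bsub>M\<^esub> x) ` carrier M"
    and quotient_module_lin: "lin R (carrier M) M (quotient_module M N) (\<lambda>x. N +>\<^bsub>M\<^esub> x)"
    and quotient_module_zero: "x \<in> carrier M \<Longrightarrow> N +>\<^bsub>M\<^esub> x = \<zero>\<^bsub>quotient_module M N\<^esub> \<longleftrightarrow> x \<in> N"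
    and quotient_module_module: "module R (quotient_module M N)"
proof -
  interpret M: module R M by fact
  let ?Q = "quotient_module M N" and ?c = "\<lambda>x. N +>\<^bsub>M\<^esub> x"
  have sg: "subgroup N (add_monoid M)" using N by (rule submodule.axioms(1))
  interpret S: abelian_subgroup N M
    by (rule abelian_subgroupI3) (use sg M.abelian_group_axioms in \<open>auto intro: additive_subgroupI\<close>)
  show car: "carrier ?Q = ?c ` carrier M"
    by (auto simp: quotient_module_def A_RCOSETS_def')
  show zero: "?c x = \<zero>\<^bsub>?Q\<^esub> \<longleftrightarrow> x \<in> N" if "x \<in> carrier M" for x
    using M.a_coset_join1[OF _ that sg] M.a_coset_join2[OF that sg]
    by (auto simp: quotient_module_def)
  have z0: "\<zero>\<^bsub>?Q\<^esub> = ?c \<zero>\<^bsub>M\<^esub>" using zero[of "\<zero>\<^bsub>M\<^esub>"] submodule_zero[OF N] by simp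
  have add: "?c x \<oplus>\<^bsub>?Q\<^esub> ?c y = ?c (x \<oplus>\<^bsub>M\<^esub> y)" if "x \<in> carrier M" "y \<in> carrier M" for x y
    using S.a_rcos_sum[OF that] by (simp add: quotient_module_def)
  have smult: "a \<odot>\<^bsub>?Q\<^esub> ?c x = ?c (a \<odot>\<^bsub>M\<^esub> x)" if a: "a \<in> carrier R" and x: "x \<in> carrier M" for a x
  proof -
    \<comment> \<open>The union that defines scalar multiplication of cosets runs over a constant
      family: moving \<open>x\<close> within its coset moves \<open>a x\<close> by an element of
      \<open>N\<close>.\<close>
    have eq: "?c (a \<odot>\<^bsub>M\<^esub> y) = ?c (a \<odot>\<^bsub>M\<^esub> x)" if y: "y \<in> ?c x" for y
    proof -
      obtain n where n: "n \<in> N" "y = n \<oplus>\<^bsub>M\<^esub> x" using y by (auto simp: a_r_coset_def')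
      have "n \<in> carrier M" using n submodule_subset[OF N] by blast
      then have "a \<odot>\<^bsub>M\<^esub> y = a \<odot>\<^bsub>M\<^esub> n \<oplus>\<^bsub>M\<^esub> a \<odot>\<^bsub>M\<^esub> x" using n a x by (simp add: M.smult_r_distr)
      then have "a \<odot>\<^bsub>M\<^esub> y \<in> ?c (a \<odot>\<^bsub>M\<^esub> x)"
        using submodule_smult[OF N a n(1)] by (auto simp: a_r_coset_def')
      then show ?thesis using M.a_repr_independence[OF _ _ sg] a x by simp
    qed
    have "x \<in> ?c x"
      using x submodule_zero[OF N] M.a_rcosI[OF submodule_zero[OF N] submodule_subset[OF N] x] by simp
    then have "(\<Union>y\<in>?c x. ?c (a \<odot>\<^bsub>M\<^esub> y)) = ?c (a \<odot>\<^bsub>M\<^esub> x)" 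

      by (rule UN_constant_eq) (use eq in blast)
    then show ?thesis by (simp add: quotient_module_def)
  qed
  show "lin R (carrier M) M ?Q ?c"
    by (rule linI) (use car add smult in auto)
  show "module R ?Q"
  proof (rule moduleI)
    show "cring R" by (rule M.cring_axioms)
    show "abelian_group ?Q"
      by (rule comm_group_abelian_groupI)
        (use S.a_factorgroup_is_comm_group in \<open>auto simp: quotient_module_def A_FactGroup_def'
          comm_group_def comm_monoid_def comm_monoid_axioms_def group_def group_axioms_def
          Group.monoid_def Units_def\<close>)
  qed (auto simp: car add smult M.smult_l_distr M.smult_r_distr M.smult_assoc1)
qed

section \<open>Torsion parts of modules and their injectivity\<close>

definition torsion_set :: "('r, 'x) ring_scheme \<Rightarrow> 'r set \<Rightarrow> ('r, 'a, 'c) module_scheme \<Rightarrow> 'a set" where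
  "torsion_set R I M = {x \<in> carrier M. \<exists>k. \<forall>a\<in>ideal_power R I k. a \<odot>\<^bsub>M\<^esub> x = \<zero>\<^bsub>M\<^esub>}"

lemma torsion_eq: "torsion R I M = M\<lparr>carrier := torsion_set R I M\<rparr>"
  by (simp add: torsion_def torsion_set_def)

text \<open>The submodule \<open>(0 : A)\<close> of \<open>M\<close>, in other words
  \<open>Hom(R / A, M)\<close> for an ideal \<open>A\<close>. The set \<open>A\<close> is arbitrary,
  so that a finite set of generators may be inserted as well as an ideal.\<close>

definition annihilated :: "('r, 'a, 'c) module_scheme \<Rightarrow> 'r set \<Rightarrow> 'a set" where
  "annihilated M A = {x \<in> carrier M. \<forall>a\<in>A. a \<odot>\<^bsub>M\<^esub> x = \<zero>\<^bsub>M\<^esub>}"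

lemma (in module) annihilated_submodule:
  assumes "A \<subseteq> carrier R"
  shows "submodule (annihilated M A) R M"
proof (rule submoduleI')
  show "r \<odot>\<^bsub>M\<^esub> x \<in> annihilated M A" if r: "r \<in> carrier R" and x: "x \<in> annihilated M A" for r x
  proof -
    have "a \<odot>\<^bsub>M\<^esub> (r \<odot>\<^bsub>M\<^esub> x) = r \<odot>\<^bsub>M\<^esub> (a \<odot>\<^bsub>M\<^esub> x)" if "a \<in> A" for a
      using that assms r x R.m_comm[of a r] smult_assoc1[of a r x] smult_assoc1[of r a x]
      by (auto simp: annihilated_def)
    then show ?thesis using r x by (auto simp: annihilated_def)
  qed
qed (use assms in \<open>auto simp: annihilated_def smult_r_distr\<close>)

text \<open>The torsion part is the increasing union of the submodules annihilated by the powers of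
  \<open>I\<close>, and a union of a chain of submodules is a submodule.\<close>

lemma (in module) torsion_set_submodule:
  assumes I: "ideal I R"
  shows "submodule (torsion_set R I M) R M"
proof -
  let ?A = "\<lambda>k. annihilated M (ideal_power R I k)"
  have sub: "submodule (?A k) R M" for k
    by (rule annihilated_submodule[OF R.ideal_subset[OF R.ideal_power_ideal[OF I]]])
  have mono: "?A k \<subseteq> ?A l" if "k \<le> l" for k l
    using R.ideal_power_antimono[OF I that] by (auto simp: annihilated_def)
  have "subset.chain {S. submodule S R M} (range ?A)"
    unfolding subset_chain_def using sub mono nat_le_linear by blast
  then have "submodule (\<Union>(range ?A)) R M" by (intro chain_Union_submodule) auto
  moreover have "\<Union>(range ?A) = torsion_set R I M" by (auto simp: torsion_set_def annihilated_def)
  ultimately show ?thesis by simp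
qed

text \<open>If a functional \<open>a \<mapsto> a y\<close> on \<open>\<aa>\<close> has torsion values, then \<open>I\<^sup>s y\<close> contains no nonzero torsion
  element for large \<open>s\<close>; this replaces the Artin--Rees lemma. Hence the functional vanishes on
  \<open>\<aa> \<inter> I\<^sup>s\<close> and extends to a functional on \<open>R / I\<^sup>s\<close>.\<close>

lemma (in module) torsion_set_baer:
  assumes noeth: "noetherian_ring R" and I: "ideal I R" and B: "baer R M"
  shows "baer R (M\<lparr>carrier := torsion_set R I M\<rparr>)"
  unfolding baer_def
proof (intro allI impI)
  let ?G = "torsion_set R I M"
  fix \<aa> h assume \<aa>: "ideal \<aa> R" and h: "lin R \<aa> (self_module R) (M\<lparr>carrier := ?G\<rparr>) h"
  note G = submoduleD[OF torsion_set_submodule[OF I]]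
  have Pc: "a \<in> carrier R" if "a \<in> ideal_power R I s" for a s
    using that R.ideal_subset[OF R.ideal_power_ideal[OF I]] by blast
  have hG: "h a \<in> ?G" if "a \<in> \<aa>" for a using lin_closed[OF h that] by simp
  have hM: "lin R \<aa> (self_module R) M h" using h G(1) by (auto simp: lin_def)
  then obtain y where y: "y \<in> carrier M" and hy: "\<And>a. a \<in> \<aa> \<Longrightarrow> h a = a \<odot>\<^bsub>M\<^esub> y"
    using B[unfolded baer_def, rule_format, OF \<aa>] by blast
  \<comment> \<open>Ideals \<open>A\<close> for which \<open>A y\<close> meets the torsion part only
    in zero. For a maximal \<open>A\<close>, enlarging the ideal produces a nonzero torsion element,
    which feeds the essentiality hypothesis for \<open>R / A\<close>.\<close>
  define F where "F = {A. ideal A R \<and> (\<forall>r\<in>A. r \<odot>\<^bsub>M\<^esub> y \<in> ?G \<longrightarrow> r \<odot>\<^bsub>M\<^esub> y = \<zero>\<^bsub>M\<^esub>)}"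
  have "{\<zero>\<^bsub>R\<^esub>} \<in> F" using y by (simp add: F_def R.zeroideal)
  then have "\<exists>A\<in>F. \<forall>B\<in>F. A \<subseteq> B \<longrightarrow> B = A"
    by (intro noetherian_maximal[OF noeth]) (auto simp: F_def)
  then obtain A where AF: "A \<in> F" and "\<forall>B\<in>F. A \<subseteq> B \<longrightarrow> B = A" by (elim bexE)
  note max = this(2)[rule_format]
  have A: "ideal A R" and A0: "\<And>r. r \<in> A \<Longrightarrow> r \<odot>\<^bsub>M\<^esub> y \<in> ?G \<Longrightarrow> r \<odot>\<^bsub>M\<^esub> y = \<zero>\<^bsub>M\<^esub>"
    using AF by (auto simp: F_def)
  note Ac = R.ideal_subset[OF A]
  have "\<exists>s. ideal_power R I s \<subseteq> A"
  proof (rule R.ideal_power_subset_if_essential[OF noeth A I])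
    fix r assume r: "r \<in> carrier R" "r \<notin> A"
    let ?B = "{a \<oplus> s \<otimes> r | a s. a \<in> A \<and> s \<in> carrier R}"
    note PB = R.ideal_plus_principal[OF A r(1)]
    have "?B \<notin> F" using max PB(2,3) r(2) by blast
    then obtain w where w: "w \<in> ?B" "w \<odot>\<^bsub>M\<^esub> y \<in> ?G" "w \<odot>\<^bsub>M\<^esub> y \<noteq> \<zero>\<^bsub>M\<^esub>"
      using PB(1) by (auto simp: F_def)
    then obtain c v where cv: "w = c \<oplus> v \<otimes> r" "c \<in> A" "v \<in> carrier R" by blast
    have cc: "c \<in> carrier R" using cv Ac by blast
    have wc: "w \<in> carrier R" using cv cc r by simp
    \<comment> \<open>The least exponent that kills \<open>w y\<close> is some \<open>Suc k\<close>,
      as \<open>w y\<close> is nonzero. Some \<open>b\<close> in the \<open>k\<close>-th power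
      therefore keeps \<open>b w y\<close> nonzero while all of \<open>I\<close> kills it.\<close>
    define kills where "kills k \<longleftrightarrow> (\<forall>a\<in>ideal_power R I k. a \<odot>\<^bsub>M\<^esub> (w \<odot>\<^bsub>M\<^esub> y) = \<zero>\<^bsub>M\<^esub>)" for k
    have "\<exists>k. kills k" using w(2) by (auto simp: torsion_set_def kills_def)
    moreover have "\<not> kills 0"
      using w(3) wc y by (auto simp: kills_def ideals_set_def intro!: bexI[of _ \<one>])
    ultimately have "(LEAST k. kills k) \<noteq> 0" by (metis LeastI_ex)
    then obtain k where "(LEAST k. kills k) = Suc k" using not0_implies_Suc by blast
    then have k: "\<not> kills k" "kills (Suc k)"
      using \<open>\<exists>k. kills k\<close> LeastI_ex[of kills] not_less_Least[of k kills] by auto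
    obtain b where b: "b \<in> ideal_power R I k" "b \<odot>\<^bsub>M\<^esub> (w \<odot>\<^bsub>M\<^esub> y) \<noteq> \<zero>\<^bsub>M\<^esub>"
      using k(1) by (auto simp: kills_def)
    have bc: "b \<in> carrier R" using Pc b by blast
    have ib: "(b \<otimes> i) \<odot>\<^bsub>M\<^esub> (w \<odot>\<^bsub>M\<^esub> y) = \<zero>\<^bsub>M\<^esub>" if "i \<in> I" for i
      using k(2) R.ideal_power_mult[OF b(1) that] by (simp add: kills_def del: nat_pow_Suc)
    have bw: "(b \<otimes> w) \<odot>\<^bsub>M\<^esub> y = b \<odot>\<^bsub>M\<^esub> (w \<odot>\<^bsub>M\<^esub> y)" using bc wc y by (simp add: smult_assoc1)
    have "b \<otimes> w \<notin> A" using A0[of "b \<otimes> w"] G(4)[OF bc w(2)] b(2) bw by auto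
    have bwe: "b \<otimes> w = b \<otimes> c \<oplus> (b \<otimes> v) \<otimes> r"
      using bc cc cv r by (simp add: R.r_distr R.m_assoc)
    show "\<exists>u\<in>carrier R. u \<otimes> r \<notin> A \<and> (\<forall>i\<in>I. i \<otimes> (u \<otimes> r) \<in> A)"
    proof (intro bexI[of _ "b \<otimes> v"] conjI ballI)
      show "b \<otimes> v \<in> carrier R" using bc cv by simp
      show "(b \<otimes> v) \<otimes> r \<notin> A"
        using \<open>b \<otimes> w \<notin> A\<close> R.ideal_add[OF A R.ideal_mult[OF A bc cv(2)]] unfolding bwe by blast
      fix i assume i: "i \<in> I"
      have ic: "i \<in> carrier R" using i R.ideal_subset[OF I] by blast
      have iw: "(i \<otimes> (b \<otimes> w)) \<odot>\<^bsub>M\<^esub> y = \<zero>\<^bsub>M\<^esub>"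
        using ib[OF i] ic bc wc y by (simp add: smult_assoc1 R.m_comm[of b i])
      \<comment> \<open>The element \<open>i b w\<close> annihilates \<open>y\<close>, so adjoining
        it to \<open>A\<close> creates no new multiples of \<open>y\<close>; by maximality it
        already lies in \<open>A\<close>.\<close>
      let ?C = "{a \<oplus> s \<otimes> (i \<otimes> (b \<otimes> w)) | a s. a \<in> A \<and> s \<in> carrier R}"
      have PC: "ideal ?C R" "A \<subseteq> ?C" "i \<otimes> (b \<otimes> w) \<in> ?C"
        using R.ideal_plus_principal[OF A, of "i \<otimes> (b \<otimes> w)"] ic bc wc by simp_all
      have "x \<odot>\<^bsub>M\<^esub> y = \<zero>\<^bsub>M\<^esub>" if xC: "x \<in> ?C" "x \<odot>\<^bsub>M\<^esub> y \<in> ?G" for x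
      proof -
        obtain d t where d: "x = d \<oplus> t \<otimes> (i \<otimes> (b \<otimes> w))" "d \<in> A" "t \<in> carrier R" using xC(1) by blast
        have "x \<odot>\<^bsub>M\<^esub> y = d \<odot>\<^bsub>M\<^esub> y"
          using d Ac ic bc wc y iw smult_assoc1[of t "i \<otimes> (b \<otimes> w)" y] by (auto simp: smult_l_distr)
        then show ?thesis using A0[OF d(2)] xC(2) by simp
      qed
      then have "?C \<in> F" using PC(1) by (simp add: F_def)
      then have "i \<otimes> (b \<otimes> w) \<in> A" using max PC(2,3) by blast
      then have "i \<otimes> (b \<otimes> c) \<oplus> i \<otimes> ((b \<otimes> v) \<otimes> r) \<in> A"
        unfolding bwe using ic bc cc cv(3) r by (simp add: R.r_distr)
      then show "i \<otimes> ((b \<otimes> v) \<otimes> r) \<in> A"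
        by (rule R.ideal_cancel[OF A])
          (use R.ideal_mult[OF A ic R.ideal_mult[OF A bc cv(2)]] ic bc cv(3) r in auto)
    qed
  qed
  then obtain s where s: "ideal_power R I s \<subseteq> A" by blast
  let ?P = "ideal_power R I s"
  let ?Q = "quotient_module (self_module R) ?P" and ?c = "\<lambda>r. ?P +>\<^bsub>self_module R\<^esub> r"
  interpret S: module R "self_module R" by (rule R.self_module)
  have sub: "submodule ?P R (self_module R)" "submodule \<aa> R (self_module R)"
    using R.submodule_self_iff R.ideal_power_ideal[OF I] \<aa> by blast+
  have Sc: "carrier (self_module R) = carrier R" by (simp add: self_module_def)
  note c = quotient_module_lin[OF S.module_axioms sub(1), unfolded Sc]
    and c0 = quotient_module_zero[OF S.module_axioms sub(1), unfolded Sc]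
    and Qm = quotient_module_module[OF S.module_axioms sub(1)]
  have ac: "a \<in> carrier R" if "a \<in> \<aa>" for a using that R.ideal_subset[OF \<aa>] by blast
  have "\<exists>g. lin R (carrier ?Q) ?Q M g \<and> (\<forall>a\<in>\<aa>. g (?c a) = h a)"
  proof (rule S.baer_lift[OF Qm module_axioms B sub(2) _ hM])
    show "lin R \<aa> (self_module R) ?Q ?c" by (rule lin_mono[OF c R.ideal_subset[OF \<aa>]])
    \<comment> \<open>An element of \<open>\<aa>\<close> that dies in \<open>R / I\<^sup>s\<close>
      lies in \<open>A\<close>, and on \<open>A\<close> the only torsion value of
      \<open>r \<mapsto> r y\<close> is zero.\<close>
    show "h a = \<zero>\<^bsub>M\<^esub>" if a: "a \<in> \<aa>" "?c a = \<zero>\<^bsub>?Q\<^esub>" for a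
    proof -
      have "a \<in> A" using c0[OF ac[OF a(1)]] a(2) s by blast
      then show ?thesis using A0[of a] hG[OF a(1)] hy[OF a(1)] by simp
    qed
  qed
  then obtain g where g: "lin R (carrier ?Q) ?Q M g" and gh: "\<forall>a\<in>\<aa>. g (?c a) = h a"
    by (elim exE conjE)
  \<comment> \<open>Unlike \<open>y\<close>, the image of \<open>\<one>\<close> under a map from
    \<open>R / I\<^sup>s\<close> is annihilated by \<open>I\<^sup>s\<close>, hence torsion.\<close>
  define z where "z = g (?c \<one>)"
  have c1: "?c \<one> \<in> carrier ?Q" by (rule lin_closed[OF c R.one_closed])
  have z: "z \<in> carrier M" unfolding z_def by (rule lin_closed[OF g c1])
  have az: "a \<odot>\<^bsub>M\<^esub> z = g (?c a)" if "a \<in> carrier R" for a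
    using lin_smult[OF g that c1] lin_smult[OF c that R.one_closed] that
    by (simp add: z_def self_module_def)
  have "a \<odot>\<^bsub>M\<^esub> z = \<zero>\<^bsub>M\<^esub>" if a: "a \<in> ?P" for a
    using az[OF Pc[OF a]] c0[OF Pc[OF a]] a
      module.lin_zero[OF Qm module_axioms g module.carrier_is_submodule[OF Qm]] by simp
  then have "z \<in> ?G" using z by (auto simp: torsion_set_def)
  moreover have "h a = a \<odot>\<^bsub>M\<^esub> z" if "a \<in> \<aa>" for a using az[OF ac[OF that]] gh that by simp
  ultimately show "\<exists>e\<in>carrier (M\<lparr>carrier := ?G\<rparr>). \<forall>a\<in>\<aa>. h a = a \<odot>\<^bsub>M\<lparr>carrier := ?G\<rparr>\<^esub> e" by auto
qed

section \<open>Finite generation and free modules\<close>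

definition lspan :: "('r, 'x) ring_scheme \<Rightarrow> ('r, 'a, 'c) module_scheme \<Rightarrow> 'a set \<Rightarrow> 'a set" where
  "lspan R M S = \<Inter>{N. submodule N R M \<and> S \<subseteq> N}"

text \<open>A property of a subset of a fixed module, so that images, kernels and submodules can be
  treated without turning each into a module of its own.\<close>

definition fin_gen :: "('r, 'x) ring_scheme \<Rightarrow> ('r, 'a, 'c) module_scheme \<Rightarrow> 'a set \<Rightarrow> bool" where
  "fin_gen R M W \<longleftrightarrow> (\<exists>S. finite S \<and> S \<subseteq> W \<and> W \<subseteq> lspan R M S)"

lemma lspan_superset: "S \<subseteq> lspan R M S"
  by (auto simp: lspan_def)

lemma lspan_least: "submodule N R M \<Longrightarrow> S \<subseteq> N \<Longrightarrow> lspan R M S \<subseteq> N"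
  by (auto simp: lspan_def)

context module begin

lemma lspan_submodule:
  assumes "S \<subseteq> carrier M"
  shows "submodule (lspan R M S) R M"
proof (rule submoduleI')
  show "lspan R M S \<subseteq> carrier M" using carrier_is_submodule assms by (rule lspan_least)
  show "\<zero>\<^bsub>M\<^esub> \<in> lspan R M S" by (auto simp: lspan_def submodule_zero)
  show "x \<oplus>\<^bsub>M\<^esub> y \<in> lspan R M S" if "x \<in> lspan R M S" "y \<in> lspan R M S" for x y
    using that by (auto simp: lspan_def submodule_add)
  show "a \<odot>\<^bsub>M\<^esub> x \<in> lspan R M S" if "a \<in> carrier R" "x \<in> lspan R M S" for a x
    using that by (auto simp: lspan_def submodule_smult)
qed

lemma fg_image:
  assumes N: "module R N" and W: "submodule W R M" and f: "lin R W M N f" and "fin_gen R M W"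
  shows "fin_gen R N (f ` W)"
proof -
  interpret N: module R N by fact
  obtain S where S: "finite S" "S \<subseteq> W" "W \<subseteq> lspan R M S" using assms(4) by (auto simp: fin_gen_def)
  have "f ` S \<subseteq> carrier N" using lin_closed[OF f] S(2) by auto
  then have "submodule {x \<in> W. f x \<in> lspan R N (f ` S)} R M"
    by (intro lin_vimage_submodule[OF N f W] N.lspan_submodule)
  moreover have "S \<subseteq> {x \<in> W. f x \<in> lspan R N (f ` S)}"
    using S(2) lspan_superset[of "f ` S" R N] by auto
  ultimately have "lspan R M S \<subseteq> {x \<in> W. f x \<in> lspan R N (f ` S)}" by (rule lspan_least)
  then show ?thesis using S unfolding fin_gen_def by (intro exI[of _ "f ` S"]) auto
qed

text \<open>An element of \<open>V\<close> differs from a combination of lifted generators of the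
  image by an element of the kernel. Hence those lifts together with generators of the kernel
  suffice.\<close>

lemma fg_extension:
  assumes N: "module R N" and V: "submodule V R M" and f: "lin R V M N f"
    and im: "fin_gen R N (f ` V)" and ker: "fin_gen R M {x \<in> V. f x = \<zero>\<^bsub>N\<^esub>}"
  shows "fin_gen R M V"
proof -
  interpret N: module R N by fact
  obtain T where T: "finite T" "T \<subseteq> f ` V" "f ` V \<subseteq> lspan R N T" using im by (auto simp: fin_gen_def)
  obtain S' where S': "finite S'" "S' \<subseteq> V" "f ` S' = T"
    using finite_subset_image[OF T(1,2)] by auto
  obtain S0 where S0: "finite S0" "S0 \<subseteq> {x \<in> V. f x = \<zero>\<^bsub>N\<^esub>}" "{x \<in> V. f x = \<zero>\<^bsub>N\<^esub>} \<subseteq> lspan R M S0"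
    using ker by (auto simp: fin_gen_def)
  let ?U = "lspan R M (S' \<union> S0)"
  have SV: "S' \<union> S0 \<subseteq> V" using S' S0 by auto
  have U: "submodule ?U R M" using SV submodule_subset[OF V] by (intro lspan_submodule) auto
  have UV: "?U \<subseteq> V" using V SV by (rule lspan_least)
  have "submodule (f ` ?U) R N" by (rule lin_image_submodule[OF N lin_mono[OF f UV] U])
  moreover have "T \<subseteq> f ` ?U" using S'(3) lspan_superset[of "S' \<union> S0" R M] by auto
  ultimately have fV: "f ` V \<subseteq> f ` ?U" using T(3) lspan_least by blast
  have "S0 \<subseteq> ?U" using lspan_superset[of "S' \<union> S0" R M] by auto
  then have kU: "{x \<in> V. f x = \<zero>\<^bsub>N\<^esub>} \<subseteq> ?U" using S0(3) lspan_least[OF U] by blast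
  have "V \<subseteq> ?U"
  proof
    fix x assume x: "x \<in> V"
    then obtain u where u: "u \<in> ?U" "f x = f u" using fV by blast
    have uV: "u \<in> V" using u UV by blast
    have c: "x \<in> carrier M" "u \<in> carrier M" using x uV submodule_subset[OF V] by auto
    have "f (x \<oplus>\<^bsub>M\<^esub> (\<ominus> \<one>) \<odot>\<^bsub>M\<^esub> u) = \<zero>\<^bsub>N\<^esub>"
      using lin_diff[OF N f V x uV, of \<one>] N.add_neg_one[of "f x" "f u"] lin_closed[OF f] x uV u(2)
      by simp
    then have "x \<oplus>\<^bsub>M\<^esub> (\<ominus> \<one>) \<odot>\<^bsub>M\<^esub> u \<in> ?U" using kU submodule_diff[OF V x uV, of \<one>] by auto
    then have "(x \<oplus>\<^bsub>M\<^esub> (\<ominus> \<one>) \<odot>\<^bsub>M\<^esub> u) \<oplus>\<^bsub>M\<^esub> u \<in> ?U" using u(1) by (rule submodule_add[OF U])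
    then show "x \<in> ?U" using split_diff_one[OF c] by simp
  qed
  then show ?thesis using S'(1) S0(1) SV unfolding fin_gen_def by (intro exI[of _ "S' \<union> S0"]) simp
qed

text \<open>Induction on the number of maps: the last map is split off by
  \<open>fg_extension\<close>, and the others are restricted to its kernel. The hypothesis covers
  all submodules inside the images because it has to survive this restriction.\<close>

lemma fg_jointly_injective:
  fixes q :: nat
  assumes N: "module R N" and "submodule W R M"
    and "\<And>i. i < q \<Longrightarrow> lin R W M N (p i)"
    and "\<And>i V. i < q \<Longrightarrow> submodule V R N \<Longrightarrow> V \<subseteq> p i ` W \<Longrightarrow> fin_gen R N V"
    and "\<And>x. x \<in> W \<Longrightarrow> (\<And>i. i < q \<Longrightarrow> p i x = \<zero>\<^bsub>N\<^esub>) \<Longrightarrow> x = \<zero>\<^bsub>M\<^esub>"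
  shows "fin_gen R M W"
  using assms(2-)
proof (induction q arbitrary: W)
  case 0
  then have "W \<subseteq> {\<zero>\<^bsub>M\<^esub>}" by auto
  moreover have "\<zero>\<^bsub>M\<^esub> \<in> lspan R M {}" by (auto simp: lspan_def submodule_zero)
  ultimately show ?case unfolding fin_gen_def by (intro exI[of _ "{}"]) auto
next
  case (Suc q)
  note W = Suc.prems(1) and p = Suc.prems(2)
  let ?K = "{x \<in> W. p q x = \<zero>\<^bsub>N\<^esub>}"
  have K: "submodule ?K R M" by (rule lin_kernel_submodule[OF N p[OF lessI] W])
  show ?case
  proof (rule fg_extension[OF N W p[OF lessI]])
    show "fin_gen R N (p q ` W)"
      by (rule Suc.prems(3)[OF lessI lin_image_submodule[OF N p[OF lessI] W]]) simp
    show "fin_gen R M ?K"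
    proof (rule Suc.IH[OF K])
      show "lin R ?K M N (p i)" if "i < q" for i
        using p[of i] that by (rule_tac lin_mono[of R W]) auto
      show "fin_gen R N V" if "i < q" "submodule V R N" "V \<subseteq> p i ` ?K" for i V
        using Suc.prems(3)[of i V] that by auto
      show "x = \<zero>\<^bsub>M\<^esub>" if x: "x \<in> ?K" "\<And>i. i < q \<Longrightarrow> p i x = \<zero>\<^bsub>N\<^esub>" for x
      proof (rule Suc.prems(4))
        show "x \<in> W" using x by simp
        show "p i x = \<zero>\<^bsub>N\<^esub>" if "i < Suc q" for i
          using x that by (cases "i = q") auto
      qed
    qed
  qed
qed

end

context cring begin

lemma ideal_fg:
  assumes "noetherian_ring R" "submodule A R (self_module R)"
  shows "fin_gen R (self_module R) A"
proof -
  have A: "ideal A R" using assms submodule_self_iff by blast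
  obtain G where G: "G \<subseteq> carrier R" "finite G" "A = Idl G"
    using noetherian_ring.finetely_gen[OF assms(1) A] by blast
  have GA: "G \<subseteq> A" using genideal_self[OF G(1)] G(3) by simp
  interpret S: module R "self_module R" by (rule self_module)
  have "ideal (lspan R (self_module R) G) R"
    using S.lspan_submodule[of G] G(1) submodule_self_iff by (simp add: self_module_def)
  then have "A \<subseteq> lspan R (self_module R) G"
    unfolding G(3) by (rule genideal_minimal) (rule lspan_superset)
  then show ?thesis using G(2) GA by (auto simp: fin_gen_def)
qed

end

section \<open>Free modules of finite rank\<close>

definition free_module :: "('r, 'x) ring_scheme \<Rightarrow> nat \<Rightarrow> ('r, nat \<Rightarrow> 'r) module" where
  "free_module R q = \<lparr>carrier = {..<q} \<rightarrow>\<^sub>E carrier R, monoid.mult = undefined, one = undefined,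
     zero = (\<lambda>i\<in>{..<q}. \<zero>\<^bsub>R\<^esub>), add = (\<lambda>u v. \<lambda>i\<in>{..<q}. u i \<oplus>\<^bsub>R\<^esub> v i),
     smult = (\<lambda>a u. \<lambda>i\<in>{..<q}. a \<otimes>\<^bsub>R\<^esub> u i)\<rparr>"

definition unit_vec :: "('r, 'x) ring_scheme \<Rightarrow> nat \<Rightarrow> nat \<Rightarrow> nat \<Rightarrow> 'r" where
  "unit_vec R q i = (\<lambda>j\<in>{..<q}. if j = i then \<one>\<^bsub>R\<^esub> else \<zero>\<^bsub>R\<^esub>)"

primrec lincomb :: "('r, 'a, 'c) module_scheme \<Rightarrow> (nat \<Rightarrow> 'a) \<Rightarrow> nat \<Rightarrow> (nat \<Rightarrow> 'r) \<Rightarrow> 'a" where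
  "lincomb M x 0 u = \<zero>\<^bsub>M\<^esub>"
| "lincomb M x (Suc n) u = lincomb M x n u \<oplus>\<^bsub>M\<^esub> u n \<odot>\<^bsub>M\<^esub> x n"

context cring begin

lemma free_module: "module R (free_module R q)"
proof (rule moduleI)
  show "cring R" by (rule cring_axioms)
  show "abelian_group (free_module R q)"
  proof (rule abelian_groupI)
    fix x assume x: "x \<in> carrier (free_module R q)"
    then show "\<exists>y\<in>carrier (free_module R q). y \<oplus>\<^bsub>free_module R q\<^esub> x = \<zero>\<^bsub>free_module R q\<^esub>"
      by (intro bexI[of _ "\<lambda>i\<in>{..<q}. \<ominus> x i"])
        (auto simp: free_module_def fun_eq_iff l_neg PiE_iff)
  next
    fix x assume x: "x \<in> carrier (free_module R q)"
    then show "\<zero>\<^bsub>free_module R q\<^esub> \<oplus>\<^bsub>free_module R q\<^esub> x = x"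
      by (auto simp: free_module_def fun_eq_iff PiE_iff extensional_def)
  qed (auto simp: free_module_def fun_eq_iff PiE_iff a_assoc intro: a_comm)
  fix x assume x: "x \<in> carrier (free_module R q)"
  then show "\<one> \<odot>\<^bsub>free_module R q\<^esub> x = x"
    by (auto simp: free_module_def fun_eq_iff PiE_iff extensional_def)
qed (auto simp: free_module_def fun_eq_iff PiE_iff l_distr r_distr m_assoc)

lemma unit_vec_closed: "unit_vec R q i \<in> carrier (free_module R q)"
  by (auto simp: unit_vec_def free_module_def)

lemma free_coord_closed: "u \<in> carrier (free_module R q) \<Longrightarrow> i < q \<Longrightarrow> u i \<in> carrier R"
  by (auto simp: free_module_def PiE_iff)

lemma free_coord_lin: "i < q \<Longrightarrow> lin R (carrier (free_module R q)) (free_module R q) (self_module R) (\<lambda>u. u i)"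
  by (rule linI) (auto simp: free_module_def self_module_def PiE_iff)

text \<open>Induction on a bound for the support of a vector: a multiple of one unit vector accounts
  for its last coordinate.\<close>

lemma free_module_spanned:
  assumes T: "submodule T R (free_module R q)" and e: "\<And>i. i < q \<Longrightarrow> unit_vec R q i \<in> T"
  shows "T = carrier (free_module R q)"
proof -
  interpret F: module R "free_module R q" by (rule free_module)
  have "u \<in> T" if "k \<le> q" "u \<in> carrier (free_module R q)" "\<And>j. k \<le> j \<Longrightarrow> j < q \<Longrightarrow> u j = \<zero>" for k u
    using that
  proof (induction k arbitrary: u)
    case 0
    then have "u = \<zero>\<^bsub>free_module R q\<^esub>"
      by (auto simp: free_module_def fun_eq_iff PiE_iff extensional_def)
    then show ?case using submodule_zero[OF T] by simp
  next
    case (Suc k)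
    have k: "k < q" using Suc.prems(1) by simp
    define v where "v = u(k := \<zero>)"
    have v: "v \<in> carrier (free_module R q)"
      using Suc.prems(2) k by (auto simp: v_def free_module_def PiE_iff extensional_def)
    have "v \<in> T"
      using Suc.prems(1,3) k by (intro Suc.IH[OF _ v]) (auto simp: v_def)
    moreover have "u k \<odot>\<^bsub>free_module R q\<^esub> unit_vec R q k \<in> T"
      by (intro submodule_smult[OF T] e free_coord_closed[OF Suc.prems(2)] k)
    ultimately have "v \<oplus>\<^bsub>free_module R q\<^esub> u k \<odot>\<^bsub>free_module R q\<^esub> unit_vec R q k \<in> T"
      by (rule submodule_add[OF T])
    moreover have "v \<oplus>\<^bsub>free_module R q\<^esub> u k \<odot>\<^bsub>free_module R q\<^esub> unit_vec R q k = u"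
      using Suc.prems(2) k
      by (auto simp: v_def free_module_def unit_vec_def fun_eq_iff PiE_iff extensional_def)
    ultimately show ?case by simp
  qed
  from this[of q] show ?thesis using submodule_subset[OF T] by auto
qed

text \<open>The coordinates are jointly injective, and the submodules inside their images are ideals
  of a Noetherian ring.\<close>

lemma submodule_free_fg:
  assumes "noetherian_ring R" "submodule W R (free_module R q)"
  shows "fin_gen R (free_module R q) W"
proof (rule module.fg_jointly_injective[OF free_module self_module assms(2), of q "\<lambda>i u. u i"])
  have W: "W \<subseteq> carrier (free_module R q)" by (rule submodule_subset[OF assms(2)])
  show "lin R W (free_module R q) (self_module R) (\<lambda>u. u i)" if "i < q" for i
    using free_coord_lin[OF that] W by (rule lin_mono)
  show "fin_gen R (self_module R) V" if "submodule V R (self_module R)" for V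
    using assms(1) that by (rule ideal_fg)
  fix x assume "x \<in> W" "\<And>i. i < q \<Longrightarrow> x i = \<zero>\<^bsub>self_module R\<^esub>"
  then show "x = \<zero>\<^bsub>free_module R q\<^esub>"
    using W by (auto simp: free_module_def self_module_def fun_eq_iff PiE_iff extensional_def)
qed

end

context module begin

lemma lincomb_closed:
  assumes "\<And>i. i < n \<Longrightarrow> x i \<in> carrier M" "\<And>i. i < n \<Longrightarrow> u i \<in> carrier R"
  shows "lincomb M x n u \<in> carrier M"
  using assms by (induction n) auto

lemma lincomb_lin:
  assumes x: "\<And>i. i < q \<Longrightarrow> x i \<in> carrier M"
  shows "lin R (carrier (free_module R q)) (free_module R q) M (lincomb M x q)"
proof (rule linI)
  let ?F = "free_module R q"
  note c = R.free_coord_closed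
  show "lincomb M x q u \<in> carrier M" if "u \<in> carrier ?F" for u
    using x c[OF that] by (rule lincomb_closed)
  show "lincomb M x q (u \<oplus>\<^bsub>?F\<^esub> v) = lincomb M x q u \<oplus>\<^bsub>M\<^esub> lincomb M x q v"
    if u: "u \<in> carrier ?F" and v: "v \<in> carrier ?F" for u v
  proof -
    have "lincomb M x n (u \<oplus>\<^bsub>?F\<^esub> v) = lincomb M x n u \<oplus>\<^bsub>M\<^esub> lincomb M x n v" if "n \<le> q" for n
      using that
    proof (induction n)
      case (Suc n)
      then have n: "n < q" by simp
      have "(u \<oplus>\<^bsub>?F\<^esub> v) n = u n \<oplus> v n" using n by (simp add: free_module_def)
      moreover have "lincomb M x n u \<in> carrier M" "lincomb M x n v \<in> carrier M"
        using n x c[OF u] c[OF v] by (auto intro!: lincomb_closed)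
      ultimately show ?case
        using Suc n x[OF n] c[OF u n] c[OF v n]
        by (simp add: smult_l_distr M.a_ac)
    qed simp
    then show ?thesis by simp
  qed
  show "lincomb M x q (a \<odot>\<^bsub>?F\<^esub> u) = a \<odot>\<^bsub>M\<^esub> lincomb M x q u"
    if a: "a \<in> carrier R" and u: "u \<in> carrier ?F" for a u
  proof -
    have "lincomb M x n (a \<odot>\<^bsub>?F\<^esub> u) = a \<odot>\<^bsub>M\<^esub> lincomb M x n u" if "n \<le> q" for n
      using that
    proof (induction n)
      case (Suc n)
      then have n: "n < q" by simp
      have "(a \<odot>\<^bsub>?F\<^esub> u) n = a \<otimes> u n" using n by (simp add: free_module_def)
      moreover have "lincomb M x n u \<in> carrier M"
        using n x c[OF u] by (auto intro!: lincomb_closed)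
      ultimately show ?case
        using Suc n x[OF n] c[OF u n] a by (simp add: smult_r_distr smult_assoc1)
    qed (use a in simp)
    then show ?thesis by simp
  qed
qed

lemma lincomb_unit_vec:
  assumes x: "\<And>i. i < q \<Longrightarrow> x i \<in> carrier M" and "i < q"
  shows "lincomb M x q (unit_vec R q i) = x i"
proof -
  have "lincomb M x n (unit_vec R q i) = (if i < n then x i else \<zero>\<^bsub>M\<^esub>)" if "n \<le> q" for n
    using that
  proof (induction n)
    case (Suc n)
    then have "unit_vec R q i n = (if n = i then \<one> else \<zero>)" by (simp add: unit_vec_def)
    then show ?case using Suc x[of n] x[OF assms(2)] by (auto simp: less_Suc_eq)
  qed simp
  then show ?thesis using assms(2) by simp
qed

lemma free_lin_unique:
  assumes f: "lin R (carrier (free_module R q)) (free_module R q) M f"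
    and g: "lin R (carrier (free_module R q)) (free_module R q) M g"
    and eq: "\<And>i. i < q \<Longrightarrow> f (unit_vec R q i) = g (unit_vec R q i)"
    and u: "u \<in> carrier (free_module R q)"
  shows "f u = g u"
proof -
  interpret F: module R "free_module R q" by (rule R.free_module)
  let ?T = "{u \<in> carrier (free_module R q). f u = g u}"
  have "submodule ?T R (free_module R q)"
  proof (rule F.submoduleI')
    show "\<zero>\<^bsub>free_module R q\<^esub> \<in> ?T"
      using F.lin_zero[OF module_axioms f F.carrier_is_submodule]
        F.lin_zero[OF module_axioms g F.carrier_is_submodule] by simp
  qed (auto simp: lin_add[OF f] lin_add[OF g] lin_smult[OF f] lin_smult[OF g])
  then have "?T = carrier (free_module R q)"
    by (rule R.free_module_spanned) (simp add: eq R.unit_vec_closed)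
  then show ?thesis using u by blast
qed

text \<open>Free covers provide the presentations for the degree shift of Ext and the coordinates in
  which limits are taken for reflexivity.\<close>

lemma free_cover:
  assumes W: "submodule W R M" and "fin_gen R M W"
  shows "\<exists>q \<pi>. lin R (carrier (free_module R q)) (free_module R q) M \<pi> \<and> \<pi> ` carrier (free_module R q) = W"
proof -
  obtain S where S: "finite S" "S \<subseteq> W" "W \<subseteq> lspan R M S" using assms(2) by (auto simp: fin_gen_def)
  obtain q and x :: "nat \<Rightarrow> _" where qx: "S = x ` {..<q}"
    using S(1) by (metis finite_imp_nat_seg_image_inj_on lessThan_def)
  have x: "x i \<in> carrier M" if "i < q" for i using that qx S(2) submodule_subset[OF W] by auto
  let ?F = "free_module R q"
  interpret F: module R ?F by (rule R.free_module)
  note l = lincomb_lin[OF x]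
  have "submodule (lincomb M x q ` carrier ?F) R M"
    by (rule F.lin_image_submodule[OF module_axioms l F.carrier_is_submodule])
  moreover have "S \<subseteq> lincomb M x q ` carrier ?F"
  proof
    fix s assume "s \<in> S"
    then obtain i where i: "i < q" "s = x i" using qx by auto
    have "lincomb M x q (unit_vec R q i) = s" using lincomb_unit_vec[of q x i] x i by simp
    then show "s \<in> lincomb M x q ` carrier ?F" using R.unit_vec_closed[of q i] by (metis imageI)
  qed
  ultimately have "lspan R M S \<subseteq> lincomb M x q ` carrier ?F" by (rule lspan_least)
  then have "W \<subseteq> lincomb M x q ` carrier ?F" using S(3) by (rule order_trans[rotated])
  moreover have "lincomb M x q ` carrier ?F \<subseteq> W"
  proof -
    have "submodule {u \<in> carrier ?F. lincomb M x q u \<in> W} R ?F"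
      by (rule F.lin_vimage_submodule[OF module_axioms l F.carrier_is_submodule W])
    then have "{u \<in> carrier ?F. lincomb M x q u \<in> W} = carrier ?F"
      by (rule R.free_module_spanned)
        (use lincomb_unit_vec[of q x] x R.unit_vec_closed[of q] qx S(2) in auto)
    then show ?thesis by blast
  qed
  ultimately have "lincomb M x q ` carrier ?F = W" by (simp add: subset_antisym)
  with l show ?thesis by (intro exI conjI)
qed

text \<open>Pulling \<open>V\<close> back along a free cover of \<open>W\<close> reduces the claim
  to submodules of a free module.\<close>

lemma submodule_fg:
  assumes noeth: "noetherian_ring R" and W: "submodule W R M" "fin_gen R M W"
    and V: "submodule V R M" "V \<subseteq> W"
  shows "fin_gen R M V"
proof -
  obtain q \<pi> where \<pi>: "lin R (carrier (free_module R q)) (free_module R q) M \<pi>"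
    and im: "\<pi> ` carrier (free_module R q) = W"
    using free_cover[OF W] by blast
  let ?F = "free_module R q"
  interpret F: module R ?F by (rule R.free_module)
  let ?V = "{u \<in> carrier ?F. \<pi> u \<in> V}"
  have pV: "submodule ?V R ?F"
    by (rule F.lin_vimage_submodule[OF module_axioms \<pi> F.carrier_is_submodule V(1)])
  have "lin R ?V ?F M \<pi>" by (rule lin_mono[OF \<pi>]) auto
  then have "fin_gen R M (\<pi> ` ?V)"
    by (rule F.fg_image[OF module_axioms pV _ R.submodule_free_fg[OF noeth pV]])
  moreover have "\<pi> ` ?V = V" using im V(2) by auto
  ultimately show ?thesis by simp
qed

end

section \<open>Homomorphism modules and finite generation of Ext\<close>

lemma Hom_simps:
  "carrier (Hom R M N) = module_hom R M N"
  "\<zero>\<^bsub>Hom R M N\<^esub> = (\<lambda>x\<in>carrier M. \<zero>\<^bsub>N\<^esub>)"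
  "f \<oplus>\<^bsub>Hom R M N\<^esub> g = (\<lambda>x\<in>carrier M. f x \<oplus>\<^bsub>N\<^esub> g x)"
  "a \<odot>\<^bsub>Hom R M N\<^esub> f = (\<lambda>x\<in>carrier M. a \<odot>\<^bsub>N\<^esub> f x)"
  by (simp_all add: Hom_def)

lemma module_homD:
  assumes "f \<in> module_hom R M N"
  shows "lin R (carrier M) M N f" "f \<in> extensional (carrier M)"
  using assms by (auto simp: module_hom_iff)

lemma module_hom_ext:
  assumes "f \<in> module_hom R M N" "g \<in> module_hom R M L" "\<And>x. x \<in> carrier M \<Longrightarrow> f x = g x"
  shows "f = g"
  using module_homD(2)[OF assms(1)] module_homD(2)[OF assms(2)] assms(3) by (rule extensionalityI)

lemma restrict_module_hom:
  assumes "module R M" "lin R (carrier M) M N f"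
  shows "restrict f (carrier M) \<in> module_hom R M N"
proof -
  interpret module R M by fact
  show ?thesis unfolding module_hom_iff using assms(2) by (auto simp: lin_def)
qed

lemma module_hom_closed: "f \<in> module_hom R M N \<Longrightarrow> x \<in> carrier M \<Longrightarrow> f x \<in> carrier N"
  by (auto simp: module_hom_def)

text \<open>Transfers the isomorphism property in both directions of (b). Only linearity on the
  carrier is required of \<open>h\<close>, so that the inverse of duality may be inserted as it
  comes out of \<open>lin_factor\<close>.\<close>

lemma module_iso_compose:
  assumes M: "module R M" and f: "f \<in> module_iso R M N"
    and h: "lin R (carrier N) N L h" "bij_betw h (carrier N) (carrier L)"
    and g: "g \<in> extensional (carrier M)" "\<And>x. x \<in> carrier M \<Longrightarrow> g x = h (f x)"
  shows "g \<in> module_iso R M L"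
proof -
  have fl: "lin R (carrier M) M N f" and fb: "bij_betw f (carrier M) (carrier N)"
    using f by (auto simp: module_iso_def module_hom_iff)
  have "lin R (carrier M) M L (\<lambda>x. h (f x))" by (rule lin_compose[OF fl h(1) lin_closed[OF fl]])
  then have "lin R (carrier M) M L g"
    by (rule module.lin_cong[OF M module.carrier_is_submodule[OF M]]) (rule g(2))
  moreover have "bij_betw g (carrier M) (carrier L)"
    using bij_betw_trans[OF fb h(2)] g(2) by (subst bij_betw_cong[of _ _ "h \<circ> f"]) auto
  ultimately show ?thesis using g(1) by (simp add: module_iso_def module_hom_iff)
qed

context module begin

lemma lin_const_zero:
  assumes "module R N"
  shows "lin R S M N (\<lambda>x. \<zero>\<^bsub>N\<^esub>)"
proof -
  interpret N: module R N by fact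
  show ?thesis by (rule linI) auto
qed

lemma lin_plus:
  assumes "module R N" "S \<subseteq> carrier M" "lin R S M N f" "lin R S M N g"
  shows "lin R S M N (\<lambda>x. f x \<oplus>\<^bsub>N\<^esub> g x)"
proof -
  interpret N: module R N by fact
  show ?thesis
    by (rule linI)
      (use lin_closed[OF assms(3)] lin_closed[OF assms(4)] in
        \<open>auto simp: lin_add[OF assms(3)] lin_add[OF assms(4)] lin_smult[OF assms(3)]
          lin_smult[OF assms(4)] N.smult_r_distr N.a_ac\<close>)
qed

lemma lin_scale:
  assumes "module R N" "lin R S M N f" "r \<in> carrier R"
  shows "lin R S M N (\<lambda>x. r \<odot>\<^bsub>N\<^esub> f x)"
proof -
  interpret N: module R N by fact
  have "a \<odot>\<^bsub>N\<^esub> (r \<odot>\<^bsub>N\<^esub> x) = r \<odot>\<^bsub>N\<^esub> (a \<odot>\<^bsub>N\<^esub> x)" if "a \<in> carrier R" "x \<in> carrier N" for a x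
    using N.smult_assoc1[OF that(1) assms(3) that(2)] N.smult_assoc1[OF assms(3) that]
      R.m_comm[OF that(1) assms(3)] by simp
  then show ?thesis
    by (intro linI)
      (use lin_closed[OF assms(2)] assms(3) in
        \<open>auto simp: lin_add[OF assms(2)] lin_smult[OF assms(2)] N.smult_r_distr\<close>)
qed

lemma lin_mult_by:
  assumes "r \<in> carrier R"
  shows "lin R (carrier M) M M (\<lambda>x. r \<odot>\<^bsub>M\<^esub> x)"
proof (rule lin_scale[OF module_axioms _ assms])
  show "lin R (carrier M) M M (\<lambda>x. x)" by (rule linI) auto
qed

end

lemma Hom_module:
  fixes R (structure)
  assumes "module R M" "module R N"
  shows "module R (Hom R M N)"
proof -
  interpret M: module R M by fact
  interpret N: module R N by fact
  have plus: "(\<lambda>x\<in>carrier M. f x \<oplus>\<^bsub>N\<^esub> g x) \<in> module_hom R M N"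
    if "f \<in> module_hom R M N" "g \<in> module_hom R M N" for f g
    by (intro restrict_module_hom[OF M.module_axioms] M.lin_plus[OF assms(2)] module_homD(1) that) simp
  have scale: "(\<lambda>x\<in>carrier M. a \<odot>\<^bsub>N\<^esub> f x) \<in> module_hom R M N"
    if "f \<in> module_hom R M N" "a \<in> carrier R" for f a
    by (intro restrict_module_hom[OF M.module_axioms] M.lin_scale[OF assms(2)] module_homD(1) that)
  have zero: "(\<lambda>x\<in>carrier M. \<zero>\<^bsub>N\<^esub>) \<in> module_hom R M N"
    by (intro restrict_module_hom[OF M.module_axioms] M.lin_const_zero assms(2))
  have cl: "f x \<in> carrier N" if "f \<in> module_hom R M N" "x \<in> carrier M" for f x
    using module_hom_closed[OF that(1) that(2)] .
  have ex: "(\<lambda>x\<in>carrier M. f x) = f" if "f \<in> module_hom R M N" for f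
    using module_homD(2)[OF that] by (simp add: extensional_restrict)
  show ?thesis
  proof (rule moduleI)
    show "cring R" by (rule M.cring_axioms)
    show "abelian_group (Hom R M N)"
    proof (rule abelian_groupI)
      fix f assume f: "f \<in> carrier (Hom R M N)"
      show "\<exists>g\<in>carrier (Hom R M N). g \<oplus>\<^bsub>Hom R M N\<^esub> f = \<zero>\<^bsub>Hom R M N\<^esub>"
      proof (rule bexI[of _ "\<lambda>x\<in>carrier M. (\<ominus> \<one>) \<odot>\<^bsub>N\<^esub> f x"])
        show "(\<lambda>x\<in>carrier M. (\<ominus> \<one>) \<odot>\<^bsub>N\<^esub> f x) \<in> carrier (Hom R M N)"
          using scale f by (simp add: Hom_simps)
        show "(\<lambda>x\<in>carrier M. (\<ominus> \<one>) \<odot>\<^bsub>N\<^esub> f x) \<oplus>\<^bsub>Hom R M N\<^esub> f = \<zero>\<^bsub>Hom R M N\<^esub>"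
          using cl[of f] f by (auto simp: Hom_simps N.smult_l_minus N.l_neg intro!: restrict_ext)
      qed
      show "\<zero>\<^bsub>Hom R M N\<^esub> \<oplus>\<^bsub>Hom R M N\<^esub> f = f"
        using f cl[of f] ex[of f] by (simp add: Hom_simps cong: restrict_cong)
    next
      fix f g assume "f \<in> carrier (Hom R M N)" "g \<in> carrier (Hom R M N)"
      then show "f \<oplus>\<^bsub>Hom R M N\<^esub> g = g \<oplus>\<^bsub>Hom R M N\<^esub> f"
        by (auto simp: Hom_simps cl intro!: restrict_ext N.a_comm)
    qed (auto simp: Hom_simps plus zero cl N.a_assoc intro!: restrict_ext)
    fix f assume f: "f \<in> carrier (Hom R M N)"
    show "\<one> \<odot>\<^bsub>Hom R M N\<^esub> f = f"
      using f cl[of f] ex[of f] by (simp add: Hom_simps cong: restrict_cong)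
  qed (auto simp: Hom_simps scale cl N.smult_l_distr N.smult_r_distr N.smult_assoc1 intro!: restrict_ext)
qed

lemma lin_eval:
  assumes "x \<in> carrier M" "S \<subseteq> module_hom R M N"
  shows "lin R S (Hom R M N) N (\<lambda>f. f x)"
proof (rule linI)
  fix f assume "f \<in> S"
  then have "f \<in> module_hom R M N" using assms(2) by blast
  then show "f x \<in> carrier N" using module_homD(1)[of f R M N] lin_closed assms(1) by metis
qed (use assms(1) in \<open>auto simp: Hom_simps\<close>)

text \<open>The map \<open>d\<close> allows two readings: with a differential it expresses a cocycle
  condition, with the identity it expresses vanishing on \<open>A\<close>.\<close>

lemma vanishing_submodule:
  assumes M: "module R M" and N: "module R N" and L: "module R L"
    and d: "lin R (carrier N) N L d" and "A \<subseteq> carrier M"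
  shows "submodule {f \<in> module_hom R M N. \<forall>x\<in>A. d (f x) = \<zero>\<^bsub>L\<^esub>} R (Hom R M N)" (is "submodule ?S R _")
proof -
  interpret N: module R N by fact
  interpret L: module R L by fact
  interpret H: module R "Hom R M N" by (rule Hom_module[OF M N])
  have cl: "f x \<in> carrier N" if "f \<in> module_hom R M N" "x \<in> carrier M" for f x
    using module_hom_closed[OF that(1) that(2)] .
  show ?thesis
  proof (rule H.submoduleI')
    show "\<zero>\<^bsub>Hom R M N\<^esub> \<in> ?S"
      using H.zero_closed assms(5) N.lin_zero[OF L d N.carrier_is_submodule] by (auto simp: Hom_simps)
    show "f \<oplus>\<^bsub>Hom R M N\<^esub> g \<in> ?S" if "f \<in> ?S" "g \<in> ?S" for f g
      using that H.a_closed[of f g] assms(5) by (auto simp: Hom_simps lin_add[OF d] cl subset_iff)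
    show "a \<odot>\<^bsub>Hom R M N\<^esub> f \<in> ?S" if "a \<in> carrier R" "f \<in> ?S" for a f
      using that H.smult_closed[of a f] assms(5) by (auto simp: Hom_simps lin_smult[OF d] cl subset_iff)
  qed (auto simp: Hom_simps)
qed

lemma precompose_lin:
  assumes M: "module R M" and p: "lin R (carrier M) M L p"
  shows "lin R (module_hom R L N) (Hom R L N) (Hom R M N) (\<lambda>y. \<lambda>v\<in>carrier M. y (p v))"
proof (rule linI)
  fix y assume "y \<in> module_hom R L N"
  then show "(\<lambda>v\<in>carrier M. y (p v)) \<in> carrier (Hom R M N)"
    unfolding Hom_simps
    by (intro restrict_module_hom[OF M] lin_compose[OF p module_homD(1)] lin_closed[OF p])
qed (use lin_closed[OF p] in \<open>auto simp: Hom_simps intro!: restrict_ext\<close>)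

lemma postcompose_lin:
  assumes M: "module R M" and d: "lin R (carrier L) L N d"
  shows "lin R (module_hom R M L) (Hom R M L) (Hom R M N) (\<lambda>y. \<lambda>u\<in>carrier M. d (y u))"
proof (rule linI)
  fix y assume y: "y \<in> module_hom R M L"
  note cl = module_hom_closed[OF y]
  show "(\<lambda>u\<in>carrier M. d (y u)) \<in> carrier (Hom R M N)"
    unfolding Hom_simps
    by (intro restrict_module_hom[OF M] lin_compose[OF module_homD(1)[OF y] d] cl)
  show "(\<lambda>u\<in>carrier M. d ((a \<odot>\<^bsub>Hom R M L\<^esub> y) u)) = a \<odot>\<^bsub>Hom R M N\<^esub> (\<lambda>u\<in>carrier M. d (y u))"
    if "a \<in> carrier R" for a
    using that cl by (auto simp: Hom_simps lin_smult[OF d] intro!: restrict_ext)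
  fix z assume "z \<in> module_hom R M L"
  note zl = module_hom_closed[OF this]
  show "(\<lambda>u\<in>carrier M. d ((y \<oplus>\<^bsub>Hom R M L\<^esub> z) u)) =
      (\<lambda>u\<in>carrier M. d (y u)) \<oplus>\<^bsub>Hom R M N\<^esub> (\<lambda>u\<in>carrier M. d (z u))"
    using cl zl by (auto simp: Hom_simps lin_add[OF d] intro!: restrict_ext)
qed

text \<open>The inclusion of an ideal into \<open>R\<close> is one of the monomorphisms tested by
  \<open>injective_module\<close>; the value of the extension at \<open>\<one>\<close> is the
  element that Baer's criterion asks for.\<close>

lemma injective_module_baer:
  fixes R (structure)
  assumes E: "injective_module R E"
  shows "baer R E"
  unfolding baer_def
proof (intro allI impI)
  interpret E: module R E using E by (simp add: injective_module_def)
  fix I h assume I: "ideal I R" and h: "lin R I (self_module R) E h"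
  interpret S: module R "self_module R" by (rule E.R.self_module)
  let ?A = "(self_module R)\<lparr>carrier := I\<rparr>"
  have sub: "submodule I R (self_module R)" using I E.R.submodule_self_iff by blast
  have Ic: "I \<subseteq> carrier R" by (rule E.R.ideal_subset[OF I])
  have "module R ?A" by (rule submodule.submodule_is_module[OF sub S.module_axioms])
  moreover have "restrict (\<lambda>x. x) I \<in> module_hom R ?A (self_module R)"
    using Ic E.R.ideal_add[OF I] E.R.ideal_mult[OF I]
    by (auto simp: module_hom_iff lin_def self_module_def)
  moreover have "inj_on (restrict (\<lambda>x. x) I) (carrier ?A)" by (auto simp: inj_on_def)
  moreover have "restrict h I \<in> module_hom R ?A E"
    using h E.R.ideal_add[OF I] E.R.ideal_mult[OF I]
    by (auto simp: module_hom_iff lin_def self_module_def)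
  ultimately obtain g where g: "g \<in> module_hom R (self_module R) E"
    and gx: "\<And>x. x \<in> I \<Longrightarrow> g x = h x"
    using E[unfolded injective_module_def, THEN conjunct2, rule_format,
      of ?A "self_module R" "restrict (\<lambda>x. x) I" "restrict h I"] S.module_axioms by auto
  note gl = module_homD(1)[OF g]
  show "\<exists>e\<in>carrier E. \<forall>a\<in>I. h a = a \<odot>\<^bsub>E\<^esub> e"
  proof (intro bexI ballI)
    show "g \<one> \<in> carrier E" using lin_closed[OF gl] by (simp add: self_module_def)
    fix a assume a: "a \<in> I"
    have "g (a \<odot>\<^bsub>self_module R\<^esub> \<one>) = a \<odot>\<^bsub>E\<^esub> g \<one>"
      using lin_smult[OF gl, of a "\<one>"] a Ic by (auto simp: self_module_def)
    moreover have "a \<odot>\<^bsub>self_module R\<^esub> \<one> = a" using a Ic by (auto simp: self_module_def)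
    ultimately show "h a = a \<odot>\<^bsub>E\<^esub> g \<one>" using gx[OF a] by simp
  qed
qed

section \<open>Injective resolutions and the finite generation of Ext\<close>

locale inj_res = M: module R M for R (structure) and M :: "('r, 'm) module" +
  fixes J :: "('r, 'm, 'j) resolution"
  assumes res: "injective_resolution R M J"
begin

abbreviation "Jo i \<equiv> obj J i"

lemma Jm: "module R (Jo i)"
  using res by (simp add: injective_resolution_def injective_module_def)

sublocale J: module R "obj J i" for i by (rule Jm)

lemma Jb: "baer R (Jo i)"
  using res by (simp add: injective_resolution_def injective_module_baer)

lemma d_lin: "lin R (carrier (Jo i)) (Jo i) (Jo (Suc i)) (diff J i)"
  using res by (simp add: injective_resolution_def module_hom_iff)

lemmas d_closed = lin_closed[OF d_lin] and d_add = lin_add[OF d_lin] and d_smult = lin_smult[OF d_lin]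

lemma d_zero: "diff J i \<zero>\<^bsub>Jo i\<^esub> = \<zero>\<^bsub>Jo (Suc i)\<^esub>"
  by (rule J.lin_zero[OF Jm d_lin J.carrier_is_submodule])

lemma d_image: "diff J i ` carrier (Jo i) = {x \<in> carrier (Jo (Suc i)). diff J (Suc i) x = \<zero>\<^bsub>Jo (Suc (Suc i))\<^esub>}"
  using res unfolding injective_resolution_def a_kernel_def kernel_def by simp

lemma d_d: "x \<in> carrier (Jo i) \<Longrightarrow> diff J (Suc i) (diff J i x) = \<zero>\<^bsub>Jo (Suc (Suc i))\<^esub>"
  using d_image[of i] by auto

lemma d_exact: "y \<in> carrier (Jo (Suc i)) \<Longrightarrow> diff J (Suc i) y = \<zero>\<^bsub>Jo (Suc (Suc i))\<^esub> \<Longrightarrow> \<exists>x\<in>carrier (Jo i). y = diff J i x"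
  using d_image[of i] by auto

lemma aug_lin: "lin R (carrier M) M (Jo 0) (aug J)"
  using res by (simp add: injective_resolution_def module_hom_iff)

lemma aug_image: "aug J ` carrier M = {x \<in> carrier (Jo 0). diff J 0 x = \<zero>\<^bsub>Jo (Suc 0)\<^esub>}"
  using res unfolding injective_resolution_def a_kernel_def kernel_def by simp

text \<open>The quotient of the cocycles by the coboundaries is \<open>Ext\<^sup>i(F / K, M)\<close> for the free module
  \<open>F\<close> of rank \<open>q\<close>.\<close>

definition ext_cocycles :: "nat \<Rightarrow> nat \<Rightarrow> (nat \<Rightarrow> 'r) set \<Rightarrow> ((nat \<Rightarrow> 'r) \<Rightarrow> 'j) set" where
  "ext_cocycles i q K = {z \<in> module_hom R (free_module R q) (Jo i).
     (\<forall>u\<in>carrier (free_module R q). diff J i (z u) = \<zero>\<^bsub>Jo (Suc i)\<^esub>) \<and> (\<forall>v\<in>K. z v = \<zero>\<^bsub>Jo i\<^esub>)}"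

definition ext_coboundary :: "nat \<Rightarrow> nat \<Rightarrow> (nat \<Rightarrow> 'r) set \<Rightarrow> ((nat \<Rightarrow> 'r) \<Rightarrow> 'j) \<Rightarrow> bool" where
  "ext_coboundary i q K b \<longleftrightarrow> (case i of
      0 \<Rightarrow> \<forall>u\<in>carrier (free_module R q). b u = \<zero>\<^bsub>Jo i\<^esub>
    | Suc k \<Rightarrow> \<exists>y\<in>module_hom R (free_module R q) (Jo k). (\<forall>v\<in>K. y v = \<zero>\<^bsub>Jo k\<^esub>) \<and>
        (\<forall>u\<in>carrier (free_module R q). b u = diff J k (y u)))"

lemma ext_cocycles_submodule:
  assumes "K \<subseteq> carrier (free_module R q)"
  shows "submodule (ext_cocycles i q K) R (Hom R (free_module R q) (Jo i))"
proof -
  note F = M.R.free_module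
  interpret H: module R "Hom R (free_module R q) (Jo i)" by (rule Hom_module[OF F Jm])
  have "lin R (carrier (Jo i)) (Jo i) (Jo i) (\<lambda>x. x)" by (rule linI) auto
  from H.Int_submodule[OF vanishing_submodule[OF F Jm Jm d_lin order_refl]
      vanishing_submodule[OF F Jm Jm this assms]]
  show ?thesis by (rule back_subst[of "\<lambda>S. submodule S R _"]) (auto simp: ext_cocycles_def)
qed

text \<open>Evaluation at the unit vectors embeds the cocycles of degree zero, and the values are
  killed by the first differential, so they lie in the image of the finitely generated module
  \<open>M\<close>.\<close>

lemma ext_fg_0:
  assumes noeth: "noetherian_ring R" and M: "fin_gen R M (carrier M)"
    and K: "submodule K R (free_module R q)"
  shows "fin_gen R (Hom R (free_module R q) (Jo 0)) (ext_cocycles 0 q K)"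
proof -
  let ?F = "free_module R q" and ?C = "ext_cocycles 0 q K"
  interpret F: module R ?F by (rule M.R.free_module)
  interpret H: module R "Hom R ?F (Jo 0)" by (rule Hom_module[OF F.module_axioms Jm])
  have C: "submodule ?C R (Hom R ?F (Jo 0))"
    by (rule ext_cocycles_submodule[OF submodule_subset[OF K]])
  show ?thesis
  proof (rule H.fg_jointly_injective[OF Jm C, where q = q and p = "\<lambda>i z. z (unit_vec R q i)"])
    show "lin R ?C (Hom R ?F (Jo 0)) (Jo 0) (\<lambda>z. z (unit_vec R q i))" for i
      by (rule lin_eval) (auto simp: M.R.unit_vec_closed ext_cocycles_def)
    have A: "fin_gen R (Jo 0) (aug J ` carrier M)"
      by (rule M.fg_image[OF Jm M.carrier_is_submodule aug_lin M])
    have A': "submodule (aug J ` carrier M) R (Jo 0)"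
      by (rule M.lin_image_submodule[OF Jm aug_lin M.carrier_is_submodule])
    show "fin_gen R (Jo 0) V" if V: "submodule V R (Jo 0)" "V \<subseteq> (\<lambda>z. z (unit_vec R q i)) ` ?C" for i V
    proof (rule J.submodule_fg[OF noeth A' A V(1)])
      show "V \<subseteq> aug J ` carrier M"
      proof
        fix x assume "x \<in> V"
        then obtain z where z: "z \<in> ?C" "x = z (unit_vec R q i)" using V(2) by blast
        then have "lin R (carrier ?F) ?F (Jo 0) z"
          by (auto simp: ext_cocycles_def module_hom_iff)
        then show "x \<in> aug J ` carrier M"
          unfolding aug_image using z M.R.unit_vec_closed[of q i]
          by (auto simp: ext_cocycles_def lin_closed)
      qed
    qed
    fix z assume z: "z \<in> ?C" "\<And>i. i < q \<Longrightarrow> z (unit_vec R q i) = \<zero>\<^bsub>Jo 0\<^esub>"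
    have zm: "z \<in> module_hom R ?F (Jo 0)" using z by (simp add: ext_cocycles_def)
    have "z u = \<zero>\<^bsub>Jo 0\<^esub>" if "u \<in> carrier ?F" for u
      using J.free_lin_unique[OF module_homD(1)[OF zm] F.lin_const_zero[OF Jm] z(2) that] .
    then show "z = \<zero>\<^bsub>Hom R ?F (Jo 0)\<^esub>"
      using module_hom_ext[OF zm, of "\<zero>\<^bsub>Hom R ?F (Jo 0)\<^esub>"] H.zero_closed by (auto simp: Hom_simps)
  qed
qed

text \<open>The induction shifts degrees along a presentation of \<open>K\<close>: a cocycle that vanishes on \<open>K\<close>
  lifts along the differential, and the restriction of the lift to \<open>K\<close> is a cocycle of lower
  degree.\<close>

lemma ext_fg:
  assumes noeth: "noetherian_ring R" and M: "fin_gen R M (carrier M)"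
    and K: "submodule K R (free_module R q)"
  shows "\<exists>S. finite S \<and> S \<subseteq> ext_cocycles i q K \<and>
    (\<forall>z\<in>ext_cocycles i q K. \<exists>s\<in>lspan R (Hom R (free_module R q) (Jo i)) S. \<exists>b.
       ext_coboundary i q K b \<and> (\<forall>u\<in>carrier (free_module R q). z u = s u \<oplus>\<^bsub>Jo i\<^esub> b u))"
  using K
proof (induction i arbitrary: q K)
  case 0
  let ?F = "free_module R q"
  obtain S where S: "finite S" "S \<subseteq> ext_cocycles 0 q K" "ext_cocycles 0 q K \<subseteq> lspan R (Hom R ?F (Jo 0)) S"
    using ext_fg_0[OF noeth M 0] by (auto simp: fin_gen_def)
  have "\<exists>s\<in>lspan R (Hom R ?F (Jo 0)) S. \<exists>b. ext_coboundary 0 q K b \<and>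
      (\<forall>u\<in>carrier ?F. z u = s u \<oplus>\<^bsub>Jo 0\<^esub> b u)" if z: "z \<in> ext_cocycles 0 q K" for z
  proof (intro bexI[of _ z] exI[of _ "\<lambda>u. \<zero>\<^bsub>Jo 0\<^esub>"] conjI ballI)
    show "z \<in> lspan R (Hom R ?F (Jo 0)) S" using S z by blast
    show "ext_coboundary 0 q K (\<lambda>u. \<zero>\<^bsub>Jo 0\<^esub>)" by (simp add: ext_coboundary_def)
    fix u assume u: "u \<in> carrier ?F"
    have "z \<in> module_hom R ?F (Jo 0)" using z by (simp add: ext_cocycles_def)
    from module_hom_closed[OF this u] show "z u = z u \<oplus>\<^bsub>Jo 0\<^esub> \<zero>\<^bsub>Jo 0\<^esub>" by simp
  qed
  then show ?case using S(1,2) by (intro exI[of _ S]) blast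
next
  case (Suc i)
  note K = Suc.prems
  let ?F = "free_module R q"
  interpret F: module R ?F by (rule M.R.free_module)
  obtain m \<pi> where \<pi>: "lin R (carrier (free_module R m)) (free_module R m) ?F \<pi>"
    and \<pi>K: "\<pi> ` carrier (free_module R m) = K"
    using F.free_cover[OF K M.R.submodule_free_fg[OF noeth K]] by blast
  let ?G = "free_module R m"
  interpret G: module R ?G by (rule M.R.free_module)
  \<comment> \<open>Since \<open>G / K'\<close> is isomorphic to \<open>K\<close>, the induction
    hypothesis concerns \<open>Ext\<^sup>i(K, M)\<close>. It is passed on by the connecting map to
    \<open>Ext\<^sup>i\<^sup>+\<^sup>1(F / K, M)\<close>, which is surjective because
    \<open>F\<close> is free.\<close>
  define K' where "K' = {v \<in> carrier ?G. \<pi> v = \<zero>\<^bsub>?F\<^esub>}"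
  have K': "submodule K' R ?G"
    unfolding K'_def by (rule G.lin_kernel_submodule[OF F.module_axioms \<pi> G.carrier_is_submodule])
  have KF: "K \<subseteq> carrier ?F" by (rule submodule_subset[OF K])
  have \<pi>_in: "\<pi> v \<in> K" if "v \<in> carrier ?G" for v using that \<pi>K by blast
  let ?HG = "Hom R ?G (Jo i)" and ?HF = "Hom R ?F (Jo (Suc i))"
  interpret HG: module R ?HG by (rule Hom_module[OF G.module_axioms Jm])
  interpret HF: module R ?HF by (rule Hom_module[OF F.module_axioms Jm])
  interpret Hi: module R "Hom R ?F (Jo i)" by (rule Hom_module[OF F.module_axioms Jm])
  obtain S' where S': "finite S'" "S' \<subseteq> ext_cocycles i m K'"
    and gen: "\<And>w. w \<in> ext_cocycles i m K' \<Longrightarrow> \<exists>s\<in>lspan R ?HG S'. \<exists>b. ext_coboundary i m K' b \<and>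
      (\<forall>v\<in>carrier ?G. w v = s v \<oplus>\<^bsub>Jo i\<^esub> b v)"
    using Suc.IH[OF K'] by blast
  \<comment> \<open>A map on \<open>G\<close> that kills \<open>K'\<close> is a map on
    \<open>K\<close>, and it extends to \<open>F\<close> because the terms of the resolution are
    injective.\<close>
  have lift: "\<exists>y\<in>module_hom R ?F (Jo k). \<forall>v\<in>carrier ?G. y (\<pi> v) = w v"
    if w: "w \<in> module_hom R ?G (Jo k)" "\<And>v. v \<in> K' \<Longrightarrow> w v = \<zero>\<^bsub>Jo k\<^esub>" for w k
  proof -
    have "\<exists>g. lin R (carrier ?F) ?F (Jo k) g \<and> (\<forall>v\<in>carrier ?G. g (\<pi> v) = w v)"
      by (rule G.baer_lift[OF F.module_axioms Jm Jb G.carrier_is_submodule \<pi> module_homD(1)[OF w(1)]])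
        (simp add: w(2) K'_def)
    then obtain g where g: "lin R (carrier ?F) ?F (Jo k) g" "\<forall>v\<in>carrier ?G. g (\<pi> v) = w v" by blast
    then show ?thesis
      using restrict_module_hom[OF F.module_axioms g(1)] \<pi>_in KF by (intro bexI[of _ "restrict g (carrier ?F)"]) auto
  qed
  have "\<forall>w\<in>S'. \<exists>y\<in>module_hom R ?F (Jo i). \<forall>v\<in>carrier ?G. y (\<pi> v) = w v"
    using lift S'(2) by (auto simp: ext_cocycles_def)
  then obtain Y where Y: "\<And>w. w \<in> S' \<Longrightarrow> Y w \<in> module_hom R ?F (Jo i)"
    "\<And>w v. w \<in> S' \<Longrightarrow> v \<in> carrier ?G \<Longrightarrow> Y w (\<pi> v) = w v"
    by metis
  define dd where "dd y = (\<lambda>u\<in>carrier ?F. diff J i (y u))" for y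
  have ddl: "lin R (module_hom R ?F (Jo i)) (Hom R ?F (Jo i)) ?HF dd"
    using postcompose_lin[OF F.module_axioms d_lin] by (simp add: dd_def[abs_def])
  have dd: "dd y \<in> module_hom R ?F (Jo (Suc i))" if "y \<in> module_hom R ?F (Jo i)" for y
    using lin_closed[OF ddl that] by (simp add: Hom_simps)
  have ycl: "y u \<in> carrier (Jo k)" if "y \<in> module_hom R ?F (Jo k)" "u \<in> carrier ?F" for y u k
    using module_hom_closed[OF that(1) that(2)] .
  \<comment> \<open>The connecting map on cocycles: extend a generator from \<open>K\<close> to
    \<open>F\<close>, then differentiate.\<close>
  define S where "S = (\<lambda>w. dd (Y w)) ` S'"
  have SC: "S \<subseteq> ext_cocycles (Suc i) q K"
  proof
    fix s assume "s \<in> S"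
    then obtain w where w: "w \<in> S'" "s = dd (Y w)" by (auto simp: S_def)
    have "s v = \<zero>\<^bsub>Jo (Suc i)\<^esub>" if vK: "v \<in> K" for v
    proof -
      obtain v' where v': "v' \<in> carrier ?G" "v = \<pi> v'" using vK \<pi>K by blast
      have "w \<in> ext_cocycles i m K'" using w(1) S'(2) by blast
      then show ?thesis
        using v' w Y(2)[OF w(1) v'(1)] vK KF by (auto simp: dd_def ext_cocycles_def)
    qed
    then show "s \<in> ext_cocycles (Suc i) q K"
      using dd[OF Y(1)[OF w(1)]] w(2) ycl[OF Y(1)[OF w(1)]]
      by (auto simp: ext_cocycles_def dd_def d_d)
  qed
  have Sc: "S \<subseteq> carrier ?HF" using SC by (auto simp: ext_cocycles_def Hom_simps)
  \<comment> \<open>The maps on \<open>F\<close> whose differential lies in the span of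
    \<open>S\<close>. Their restrictions along \<open>\<pi>\<close> form a submodule containing
    \<open>S'\<close>, hence its span, so linear combinations need not be extended one by
    one.\<close>
  let ?T = "{y \<in> module_hom R ?F (Jo i). dd y \<in> lspan R ?HF S}"
    and ?res = "\<lambda>y. \<lambda>v\<in>carrier ?G. y (\<pi> v)"
  have "submodule (module_hom R ?F (Jo i)) R (Hom R ?F (Jo i))"
    using Hi.carrier_is_submodule by (simp add: Hom_simps)
  then have "submodule ?T R (Hom R ?F (Jo i))"
    by (rule Hi.lin_vimage_submodule[OF HF.module_axioms ddl _ HF.lspan_submodule[OF Sc]])
  then have "submodule (?res ` ?T) R ?HG"
    by (rule Hi.lin_image_submodule[OF HG.module_axioms
          lin_mono[OF precompose_lin[OF G.module_axioms \<pi>]], rotated]) auto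
  then have lift_span: "lspan R ?HG S' \<subseteq> ?res ` ?T"
  proof (rule lspan_least)
    show "S' \<subseteq> ?res ` ?T"
    proof
      fix w assume w: "w \<in> S'"
      have "w = ?res (Y w)"
        using extensionalityI[of w "carrier ?G" "?res (Y w)"] Y(2)[OF w] w S'(2) module_homD(2)[of w R ?G "Jo i"]
        by (auto simp: ext_cocycles_def)
      moreover have "dd (Y w) \<in> lspan R ?HF S" using lspan_superset[of S R ?HF] w by (auto simp: S_def)
      ultimately show "w \<in> ?res ` ?T" using Y(1)[OF w] by blast
    qed
  qed
  \<comment> \<open>A coboundary on \<open>K\<close> extends to a cocycle on \<open>F\<close>: by
    zero in degree zero, and otherwise as the differential of an extension of its primitive.\<close>
  have lift_cob: "\<exists>y\<in>module_hom R ?F (Jo i). (\<forall>v\<in>carrier ?G. y (\<pi> v) = b v) \<and>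
      (\<forall>u\<in>carrier ?F. diff J i (y u) = \<zero>\<^bsub>Jo (Suc i)\<^esub>)" if b: "ext_coboundary i m K' b" for b
  proof (cases i)
    case 0
    then show ?thesis
      using b Hi.zero_closed \<pi>_in KF d_zero
      by (auto simp: ext_coboundary_def Hom_simps subset_iff intro!: bexI[of _ "\<zero>\<^bsub>Hom R ?F (Jo i)\<^esub>"])
  next
    case (Suc k)
    then obtain w where w: "w \<in> module_hom R ?G (Jo k)" "\<And>v. v \<in> K' \<Longrightarrow> w v = \<zero>\<^bsub>Jo k\<^esub>"
      "\<And>v. v \<in> carrier ?G \<Longrightarrow> b v = diff J k (w v)"
      using b by (auto simp: ext_coboundary_def)
    obtain y where y: "y \<in> module_hom R ?F (Jo k)" "\<forall>v\<in>carrier ?G. y (\<pi> v) = w v"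
      using lift[OF w(1,2)] by blast
    have "(\<lambda>u\<in>carrier ?F. diff J k (y u)) \<in> module_hom R ?F (Jo i)"
      unfolding Suc by (intro restrict_module_hom[OF F.module_axioms] lin_compose[OF module_homD(1)[OF y(1)] d_lin]
        ycl[OF y(1)])
    then show ?thesis
      using w(3) y(2) \<pi>_in KF ycl[OF y(1)] Suc
      by (intro bexI[of _ "\<lambda>u\<in>carrier ?F. diff J k (y u)"]) (auto simp: subset_iff d_d)
  qed
  have "\<exists>s\<in>lspan R ?HF S. \<exists>b. ext_coboundary (Suc i) q K b \<and>
      (\<forall>u\<in>carrier ?F. z u = s u \<oplus>\<^bsub>Jo (Suc i)\<^esub> b u)" if z: "z \<in> ext_cocycles (Suc i) q K" for z
  proof -
    have zm: "z \<in> module_hom R ?F (Jo (Suc i))" and dz: "\<And>u. u \<in> carrier ?F \<Longrightarrow> diff J (Suc i) (z u) = \<zero>\<^bsub>Jo (Suc (Suc i))\<^esub>"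
      and zK: "\<And>v. v \<in> K \<Longrightarrow> z v = \<zero>\<^bsub>Jo (Suc i)\<^esub>"
      using z by (auto simp: ext_cocycles_def)
    \<comment> \<open>As \<open>F\<close> is free, a primitive of \<open>z\<close> may be prescribed
      on the unit vectors.\<close>
    have "\<exists>x\<in>carrier (Jo i). z (unit_vec R q j) = diff J i x" for j
      using d_exact[OF ycl[OF zm M.R.unit_vec_closed] dz[OF M.R.unit_vec_closed]] .
    then obtain x where x: "\<And>j. x j \<in> carrier (Jo i)" "\<And>j. z (unit_vec R q j) = diff J i (x j)"
      by metis
    let ?y = "lincomb (Jo i) x q"
    have yl: "lin R (carrier ?F) ?F (Jo i) ?y" by (rule J.lincomb_lin) (rule x)
    have ycl': "?y u \<in> carrier (Jo i)" if "u \<in> carrier ?F" for u by (rule lin_closed[OF yl that])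
    have "z (unit_vec R q j) = diff J i (?y (unit_vec R q j))" if "j < q" for j
      by (subst J.lincomb_unit_vec) (use x that in auto)
    then have zy: "z u = diff J i (?y u)" if u: "u \<in> carrier ?F" for u
      using J.free_lin_unique[OF module_homD(1)[OF zm] lin_compose[OF yl d_lin ycl'] _ u] by blast
    let ?w = "\<lambda>v\<in>carrier ?G. ?y (\<pi> v)"
    have "lin R (carrier ?G) ?G (Jo i) (\<lambda>v. ?y (\<pi> v))"
      by (rule lin_compose[OF \<pi> yl]) (rule lin_closed[OF \<pi>])
    then have "?w \<in> module_hom R ?G (Jo i)" by (rule restrict_module_hom[OF G.module_axioms])
    moreover have "diff J i (?w v) = \<zero>\<^bsub>Jo (Suc i)\<^esub>" if "v \<in> carrier ?G" for v
      using zy[of "\<pi> v"] zK[OF \<pi>_in[OF that]] \<pi>_in[OF that] KF that by auto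
    moreover have "?w v = \<zero>\<^bsub>Jo i\<^esub>" if "v \<in> K'" for v
      using that F.lin_zero[OF Jm yl F.carrier_is_submodule] by (auto simp: K'_def)
    ultimately have "?w \<in> ext_cocycles i m K'" by (simp add: ext_cocycles_def)
    then obtain s b where s: "s \<in> lspan R ?HG S'" and b: "ext_coboundary i m K' b"
      and sb: "\<And>v. v \<in> carrier ?G \<Longrightarrow> ?y (\<pi> v) = s v \<oplus>\<^bsub>Jo i\<^esub> b v"
      using gen[of ?w] by force
    obtain y1 where y1: "y1 \<in> module_hom R ?F (Jo i)" "\<And>v. v \<in> carrier ?G \<Longrightarrow> y1 (\<pi> v) = s v"
      "dd y1 \<in> lspan R ?HF S"
    proof -
      obtain y where "y \<in> ?T" "s = ?res y" using s lift_span by blast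
      then show thesis using that[of y] by simp
    qed
    obtain y2 where y2: "y2 \<in> module_hom R ?F (Jo i)" "\<And>v. v \<in> carrier ?G \<Longrightarrow> y2 (\<pi> v) = b v"
      "\<And>u. u \<in> carrier ?F \<Longrightarrow> diff J i (y2 u) = \<zero>\<^bsub>Jo (Suc i)\<^esub>"
      using lift_cob[OF b] by blast
    \<comment> \<open>What remains of the primitive of \<open>z\<close> vanishes on
      \<open>K\<close>, so its differential is a coboundary on \<open>F / K\<close>. The part
      \<open>y2\<close> leaves no trace because its differential is zero.\<close>
    define h where "h = (\<lambda>u\<in>carrier ?F. ?y u \<oplus>\<^bsub>Jo i\<^esub> (\<ominus> \<one>) \<odot>\<^bsub>Jo i\<^esub> (y1 u \<oplus>\<^bsub>Jo i\<^esub> y2 u))"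
    have hm: "h \<in> module_hom R ?F (Jo i)"
      unfolding h_def
      by (intro restrict_module_hom[OF F.module_axioms] F.lin_plus[OF Jm] F.lin_scale[OF Jm] yl module_homD(1) y1 y2) auto
    have hK: "h v = \<zero>\<^bsub>Jo i\<^esub>" if vK: "v \<in> K" for v
    proof -
      obtain v' where v': "v' \<in> carrier ?G" "v = \<pi> v'" using vK \<pi>K by blast
      have "v \<in> carrier ?F" using vK KF by blast
      then show ?thesis
        using sb[OF v'(1)] y1(2)[OF v'(1)] y2(2)[OF v'(1)] v'(2) ycl'[of v] ycl[OF y1(1), of v]
          ycl[OF y2(1), of v] by (simp add: h_def J.add_neg_one)
    qed
    have eq: "z u = dd y1 u \<oplus>\<^bsub>Jo (Suc i)\<^esub> diff J i (h u)" if u: "u \<in> carrier ?F" for u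
    proof -
      note c = ycl'[OF u] ycl[OF y1(1) u] ycl[OF y2(1) u]
      have "?y u = h u \<oplus>\<^bsub>Jo i\<^esub> (y1 u \<oplus>\<^bsub>Jo i\<^esub> y2 u)"
        using c u J.split_diff_one[of "?y u" i "y1 u \<oplus>\<^bsub>Jo i\<^esub> y2 u"] by (simp add: h_def)
      then have "z u = diff J i (h u) \<oplus>\<^bsub>Jo (Suc i)\<^esub> diff J i (y1 u)"
        using c y2(3)[OF u] ycl[OF hm u] zy[OF u] by (simp add: d_add d_closed)
      then show ?thesis
        using c u ycl[OF hm u] by (simp add: dd_def J.a_comm d_closed)
    qed
    have "ext_coboundary (Suc i) q K (\<lambda>u. diff J i (h u))"
      using hm hK by (auto simp: ext_coboundary_def intro!: bexI[of _ h])
    then show ?thesis using y1(3) eq by (intro bexI[of _ "dd y1"] exI[of _ "\<lambda>u. diff J i (h u)"]) auto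
  qed
  moreover have "finite S" using S'(1) by (simp add: S_def)
  ultimately show ?case using SC by (intro exI[of _ S] conjI ballI)
qed

end

section \<open>Local cohomology\<close>

text \<open>The kernel splits off, hence the image is a direct summand of \<open>X\<close>.\<close>

lemma baer_image:
  fixes R (structure)
  assumes X: "module R X" and Y: "module R Y" and B: "baer R X"
    and d: "lin R (carrier X) X Y d"
    and K: "baer R (X\<lparr>carrier := {x \<in> carrier X. d x = \<zero>\<^bsub>Y\<^esub>}\<rparr>)"
  shows "baer R (Y\<lparr>carrier := d ` carrier X\<rparr>)"
  unfolding baer_def
proof (intro allI impI)
  interpret X: module R X by fact
  interpret Y: module R Y by fact
  let ?K = "{x \<in> carrier X. d x = \<zero>\<^bsub>Y\<^esub>}"
  have Ks: "submodule ?K R X" by (rule X.lin_kernel_submodule[OF Y d X.carrier_is_submodule])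
  have Km: "module R (X\<lparr>carrier := ?K\<rparr>)" by (rule submodule.submodule_is_module[OF Ks X])
  have "lin R ?K X (X\<lparr>carrier := ?K\<rparr>) (\<lambda>x. x)" by (rule linI) auto
  then have "\<exists>g. lin R (carrier X) X (X\<lparr>carrier := ?K\<rparr>) g \<and> (\<forall>x\<in>?K. g x = x)"
    by (rule X.baer_extend[OF Km K Ks])
  then obtain \<rho> where \<rho>': "lin R (carrier X) X (X\<lparr>carrier := ?K\<rparr>) \<rho>" and \<rho>K: "\<forall>x\<in>?K. \<rho> x = x"
    by (elim exE conjE)
  have \<rho>: "lin R (carrier X) X X \<rho>" using \<rho>' by (auto simp: lin_def)
  have d\<rho>: "d (\<rho> x) = \<zero>\<^bsub>Y\<^esub>" "\<rho> x \<in> carrier X" if "x \<in> carrier X" for x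
    using lin_closed[OF \<rho>' that] by auto
  \<comment> \<open>The complement of the retraction \<open>\<rho>\<close> kills the kernel of
    \<open>d\<close>, so it factors through \<open>d\<close> and gives a section \<open>g\<close> of
    \<open>d\<close> over its image.\<close>
  let ?f = "\<lambda>x. x \<oplus>\<^bsub>X\<^esub> (\<ominus> \<one>) \<odot>\<^bsub>X\<^esub> \<rho> x"
  have "lin R (carrier X) X X (\<lambda>x. x)" by (rule linI) auto
  then have f: "lin R (carrier X) X X ?f"
    by (intro X.lin_plus[OF X] X.lin_scale[OF X] \<rho>) auto
  have "\<exists>g. lin R (d ` carrier X) Y X g \<and> (\<forall>x\<in>carrier X. g (d x) = ?f x)"
    by (rule X.lin_factor[OF Y X X.carrier_is_submodule d f])
      (use \<rho>K X.add_neg_one d\<rho> in auto)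
  then obtain g where g: "lin R (d ` carrier X) Y X g" and gd: "\<forall>x\<in>carrier X. g (d x) = ?f x"
    by (elim exE conjE)
  have dg: "d (g y) = y" if y: "y \<in> d ` carrier X" for y
  proof -
    obtain x where x: "x \<in> carrier X" "y = d x" using y by blast
    have "d (?f x) = d x \<oplus>\<^bsub>Y\<^esub> (\<ominus> \<one>) \<odot>\<^bsub>Y\<^esub> d (\<rho> x)"
      using x(1) d\<rho>[OF x(1)] by (simp add: lin_add[OF d] lin_smult[OF d])
    then show ?thesis using x gd d\<rho>[OF x(1)] lin_closed[OF d x(1)] by simp
  qed
  fix I h assume I: "ideal I R" and h: "lin R I (self_module R) (Y\<lparr>carrier := d ` carrier X\<rparr>) h"
  have hI: "h a \<in> d ` carrier X" if "a \<in> I" for a using lin_closed[OF h that] by simp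
  have "lin R I (self_module R) Y h" using h lin_closed[OF d] by (auto simp: lin_def)
  then have "lin R I (self_module R) X (\<lambda>a. g (h a))" using g hI by (rule lin_compose)
  then obtain e where e: "e \<in> carrier X" "\<And>a. a \<in> I \<Longrightarrow> g (h a) = a \<odot>\<^bsub>X\<^esub> e"
    using B[unfolded baer_def, rule_format, OF I] by blast
  have "h a = a \<odot>\<^bsub>Y\<^esub> d e" if a: "a \<in> I" for a
  proof -
    have "h a = d (g (h a))" using dg hI a by simp
    also have "\<dots> = a \<odot>\<^bsub>Y\<^esub> d e"
      using e a X.R.ideal_subset[OF I] by (auto simp: lin_smult[OF d] subset_iff)
    finally show ?thesis .
  qed
  then show "\<exists>e\<in>carrier (Y\<lparr>carrier := d ` carrier X\<rparr>). \<forall>a\<in>I. h a = a \<odot>\<^bsub>Y\<lparr>carrier := d ` carrier X\<rparr>\<^esub> e"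
    using e(1) by auto
qed

section \<open>Cocycles, coboundaries and cohomology of the torsion complex\<close>

locale inj_res_ideal = inj_res +
  fixes I
  assumes I: "ideal I R" and noeth: "noetherian_ring R"
begin

abbreviation "G i \<equiv> torsion_set R I (Jo i)"
abbreviation "B i \<equiv> coboundaries R I J i"
abbreviation "H i \<equiv> local_cohomology R I J i"

definition "Z i = {x \<in> G i. diff J i x = \<zero>\<^bsub>Jo (Suc i)\<^esub>}"
definition "pr i x = B i +>\<^bsub>cocycles R I J i\<^esub> x"

lemma cocycles_eq: "cocycles R I J i = (Jo i)\<lparr>carrier := Z i\<rparr>"
  by (simp add: cocycles_def Z_def torsion_eq a_kernel_def kernel_def)

lemma B_0: "B 0 = {\<zero>\<^bsub>Jo 0\<^esub>}" and B_Suc: "B (Suc k) = diff J k ` G k"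
  by (simp_all add: coboundaries_def torsion_eq)

lemma G_submodule: "submodule (G i) R (Jo i)"
  by (rule J.torsion_set_submodule[OF I])

lemmas GD = submoduleD[OF G_submodule]

lemma power_closed: "a \<in> ideal_power R I k \<Longrightarrow> a \<in> carrier R"
  using M.R.ideal_subset[OF M.R.ideal_power_ideal[OF I]] by blast

lemma lin_torsion_set:
  assumes f: "lin R (carrier (Jo i)) (Jo i) (Jo k) f" and x: "x \<in> G i"
  shows "f x \<in> G k"
proof -
  have xc: "x \<in> carrier (Jo i)" using x by (simp add: torsion_set_def)
  obtain l where l: "\<forall>a\<in>ideal_power R I l. a \<odot>\<^bsub>Jo i\<^esub> x = \<zero>\<^bsub>Jo i\<^esub>" using x by (auto simp: torsion_set_def)
  have "a \<odot>\<^bsub>Jo k\<^esub> f x = \<zero>\<^bsub>Jo k\<^esub>" if "a \<in> ideal_power R I l" for a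
    using l that xc power_closed[OF that] lin_smult[OF f, of a x]
      J.lin_zero[OF Jm f J.carrier_is_submodule] by simp
  then show ?thesis using lin_closed[OF f xc] by (auto simp: torsion_set_def)
qed

lemma Z_submodule: "submodule (Z i) R (Jo i)"
  unfolding Z_def by (rule J.lin_kernel_submodule[OF Jm lin_mono[OF d_lin GD(1)] G_submodule])

lemmas ZD = submoduleD[OF Z_submodule]

lemma B_submodule: "submodule (B i) R (Jo i)"
proof (cases i)
  case 0
  then show ?thesis by (simp add: B_0 J.zero_submodule)
next
  case (Suc k)
  then show ?thesis
    using J.lin_image_submodule[OF Jm lin_mono[OF d_lin GD(1)] G_submodule, of k] by (simp add: B_Suc)
qed

lemmas BD = submoduleD[OF B_submodule]

lemma B_subset_Z: "B i \<subseteq> Z i"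
proof (cases i)
  case 0
  then show ?thesis using ZD(2) by (simp add: B_0)
next
  case (Suc k)
  then show ?thesis using lin_torsion_set[OF d_lin] GD(1) d_d by (auto simp: B_Suc Z_def subset_iff)
qed

lemma Z_module: "module R (cocycles R I J i)"
  unfolding cocycles_eq by (rule submodule.submodule_is_module[OF Z_submodule Jm])

lemma B_submodule_Z: "submodule (B i) R (cocycles R I J i)"
  by (rule module.submoduleI'[OF Z_module]) (use B_subset_Z BD in \<open>auto simp: cocycles_eq\<close>)

lemma H_module: "module R (H i)"
  unfolding local_cohomology_def by (rule quotient_module_module[OF Z_module B_submodule_Z])

sublocale H: module R "local_cohomology R I J i" for i by (rule H_module)

lemma H_carrier: "carrier (H i) = pr i ` Z i"
  unfolding local_cohomology_def pr_def
  using quotient_module_carrier[OF Z_module B_submodule_Z, of i] by (simp add: cocycles_eq)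

lemma pr_lin: "lin R (Z i) (Jo i) (H i) (pr i)"
  using quotient_module_lin[OF Z_module B_submodule_Z, of i]
  unfolding local_cohomology_def pr_def by (simp add: cocycles_eq lin_def)

lemma pr_zero: "x \<in> Z i \<Longrightarrow> pr i x = \<zero>\<^bsub>H i\<^esub> \<longleftrightarrow> x \<in> B i"
  unfolding local_cohomology_def pr_def
  using quotient_module_zero[OF Z_module B_submodule_Z, of x i] by (simp add: cocycles_eq)

lemma pr_add_B: "x \<in> Z i \<Longrightarrow> b \<in> B i \<Longrightarrow> pr i (x \<oplus>\<^bsub>Jo i\<^esub> b) = pr i x"
  using lin_add[OF pr_lin, of x i b] lin_closed[OF pr_lin, of x i] pr_zero[of b i] B_subset_Z by auto

lemma coset_B:
  assumes "x \<in> Z i" "y \<in> pr i x"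
  shows "\<exists>b\<in>B i. y = x \<oplus>\<^bsub>Jo i\<^esub> b"
proof -
  obtain b where b: "b \<in> B i" "y = b \<oplus>\<^bsub>Jo i\<^esub> x"
    using assms(2) by (auto simp: pr_def a_r_coset_def' cocycles_eq)
  have "b \<in> carrier (Jo i)" "x \<in> carrier (Jo i)" using b(1) assms(1) BD(1) ZD(1) by auto
  then show ?thesis using b J.a_comm by blast
qed

lemma coset_self: "x \<in> Z i \<Longrightarrow> x \<in> pr i x"
  using ZD(1)[of i] BD(2)[of i] by (force simp: pr_def a_r_coset_def' cocycles_eq)

lemma H_annihilated_power:
  assumes "x \<in> carrier (H i)"
  shows "\<exists>k. x \<in> annihilated (H i) (ideal_power R I k)"
proof -
  obtain z where z: "z \<in> Z i" "x = pr i z" using assms H_carrier by auto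
  then obtain k where k: "\<forall>a\<in>ideal_power R I k. a \<odot>\<^bsub>Jo i\<^esub> z = \<zero>\<^bsub>Jo i\<^esub>"
    by (auto simp: Z_def torsion_set_def)
  have "a \<odot>\<^bsub>H i\<^esub> x = \<zero>\<^bsub>H i\<^esub>" if "a \<in> ideal_power R I k" for a
    using lin_smult[OF pr_lin power_closed[OF that] z(1)] k that z(2)
      pr_zero[OF ZD(2)] BD(2) by simp
  then show ?thesis using assms by (auto simp: annihilated_def)
qed

text \<open>Vanishing of \<open>H i\<close> makes the injective module \<open>B i\<close> the kernel
  of the differential on the torsion part \<open>G i\<close>. The kernel splits off, so
  \<open>B (Suc i)\<close> is isomorphic to a direct summand of the injective module
  \<open>G i\<close>. The induction reaches \<open>c\<close> itself, because each step uses
  cohomology one degree lower.\<close>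

lemma B_baer:
  assumes vanish: "\<And>i. i < c \<Longrightarrow> carrier (H i) = {\<zero>\<^bsub>H i\<^esub>}" and "i \<le> c"
  shows "baer R ((Jo i)\<lparr>carrier := B i\<rparr>)"
  using assms(2)
proof (induction i)
  case 0
  show ?case
    unfolding baer_def
  proof (intro allI impI)
    fix A h assume A: "ideal A R" and h: "lin R A (self_module R) ((Jo 0)\<lparr>carrier := B 0\<rparr>) h"
    have "h a = a \<odot>\<^bsub>Jo 0\<^esub> \<zero>\<^bsub>Jo 0\<^esub>" if "a \<in> A" for a
      using lin_closed[OF h that] that M.R.ideal_subset[OF A] by (auto simp: B_0)
    then show "\<exists>e\<in>carrier ((Jo 0)\<lparr>carrier := B 0\<rparr>). \<forall>a\<in>A. h a = a \<odot>\<^bsub>(Jo 0)\<lparr>carrier := B 0\<rparr>\<^esub> e"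
      by (auto simp: B_0)
  qed
next
  case (Suc i)
  then have "carrier (H i) = {\<zero>\<^bsub>H i\<^esub>}" using vanish by simp
  then have "pr i x = \<zero>\<^bsub>H i\<^esub>" if "x \<in> Z i" for x using that H_carrier[of i] by blast
  then have "Z i \<subseteq> B i" using pr_zero[of _ i] by blast
  then have "Z i = B i" using B_subset_Z by blast
  then have IH: "baer R ((Jo i)\<lparr>carrier := Z i\<rparr>)" using Suc by simp
  let ?X = "(Jo i)\<lparr>carrier := G i\<rparr>"
  have "baer R ((Jo (Suc i))\<lparr>carrier := diff J i ` carrier ?X\<rparr>)"
  proof (rule baer_image[OF _ Jm])
    show "module R ?X" by (rule submodule.submodule_is_module[OF G_submodule Jm])
    show "baer R ?X" by (rule J.torsion_set_baer[OF noeth I Jb])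
    show "lin R (carrier ?X) ?X (Jo (Suc i)) (diff J i)"
      using lin_mono[OF d_lin GD(1)[of i]] by (simp add: lin_def)
    show "baer R (?X\<lparr>carrier := {x \<in> carrier ?X. diff J i x = \<zero>\<^bsub>Jo (Suc i)\<^esub>}\<rparr>)"
      using IH by (simp add: Z_def)
  qed
  then show ?case by (simp add: B_Suc)
qed

text \<open>This is where the vanishing below degree \<open>c\<close> pays off. For any
  representative \<open>z\<close>, the map \<open>a \<mapsto> a z\<close> sends \<open>A\<close>
  into the injective module \<open>B c\<close>; it is therefore multiplication by some
  \<open>b \<in> B c\<close>, and \<open>z - b\<close> represents the same class and is annihilated
  by \<open>A\<close>.\<close>

lemma annihilated_lift:
  assumes vanish: "\<And>i. i < c \<Longrightarrow> carrier (H i) = {\<zero>\<^bsub>H i\<^esub>}"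
    and A: "ideal A R" and x: "x \<in> annihilated (H c) A"
  shows "\<exists>z\<in>Z c. pr c z = x \<and> (\<forall>a\<in>A. a \<odot>\<^bsub>Jo c\<^esub> z = \<zero>\<^bsub>Jo c\<^esub>)"
proof -
  note Ac = M.R.ideal_subset[OF A]
  obtain z where z: "z \<in> Z c" "x = pr c z" using x H_carrier by (auto simp: annihilated_def)
  have zc: "z \<in> carrier (Jo c)" using z(1) ZD(1) by blast
  have "a \<odot>\<^bsub>Jo c\<^esub> z \<in> B c" if "a \<in> A" for a
  proof -
    have "pr c (a \<odot>\<^bsub>Jo c\<^esub> z) = \<zero>\<^bsub>H c\<^esub>"
      using lin_smult[OF pr_lin, of a z c] z that Ac x by (auto simp: annihilated_def)
    then show ?thesis using pr_zero ZD(4)[OF _ z(1)] that Ac by auto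
  qed
  then have "lin R A (self_module R) ((Jo c)\<lparr>carrier := B c\<rparr>) (\<lambda>a. a \<odot>\<^bsub>Jo c\<^esub> z)"
    using lin_mono[OF J.lin_orbit[OF zc] Ac] by (simp add: lin_def)
  then have "\<exists>e\<in>carrier ((Jo c)\<lparr>carrier := B c\<rparr>). \<forall>a\<in>A. a \<odot>\<^bsub>Jo c\<^esub> z = a \<odot>\<^bsub>(Jo c)\<lparr>carrier := B c\<rparr>\<^esub> e"
    using B_baer[OF vanish order_refl] A unfolding baer_def by simp
  then obtain b where b: "b \<in> B c" "\<And>a. a \<in> A \<Longrightarrow> a \<odot>\<^bsub>Jo c\<^esub> z = a \<odot>\<^bsub>Jo c\<^esub> b"
    by auto
  have bc: "b \<in> carrier (Jo c)" using b(1) BD(1) by blast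
  let ?z = "z \<oplus>\<^bsub>Jo c\<^esub> (\<ominus> \<one>) \<odot>\<^bsub>Jo c\<^esub> b"
  have "a \<odot>\<^bsub>Jo c\<^esub> ?z = \<zero>\<^bsub>Jo c\<^esub>" if "a \<in> A" for a
  proof -
    have a: "a \<in> carrier R" using that Ac by blast
    have "a \<odot>\<^bsub>Jo c\<^esub> ?z = a \<odot>\<^bsub>Jo c\<^esub> z \<oplus>\<^bsub>Jo c\<^esub> (\<ominus> \<one>) \<odot>\<^bsub>Jo c\<^esub> (a \<odot>\<^bsub>Jo c\<^esub> b)"
      using a zc bc by (simp add: J.smult_r_distr J.smult_l_minus J.smult_r_minus)
    then show ?thesis using b(2)[OF that] J.add_neg_one a bc zc by simp
  qed
  moreover have "pr c ?z = x" using pr_add_B[OF z(1) BD(4)[OF _ b(1), of "\<ominus> \<one>"]] z(2) by simp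
  moreover have "?z \<in> Z c" using J.submodule_diff[OF Z_submodule z(1), of b \<one>] b(1) B_subset_Z by auto
  ultimately show ?thesis by blast
qed

text \<open>Evaluation at the unit vector sends cocycles for
  \<open>Ext\<^sup>c(R / I\<^sup>k, M)\<close> to cohomology classes and coboundaries to zero. By
  \<open>annihilated_lift\<close> the span of the finitely many representatives from
  \<open>ext_fg\<close> covers the annihilated classes, and submodules of finitely generated modules
  are finitely generated.\<close>

lemma annihilated_fg:
  assumes vanish: "\<And>i. i < c \<Longrightarrow> carrier (H i) = {\<zero>\<^bsub>H i\<^esub>}" and M: "fin_gen R M (carrier M)"
  shows "fin_gen R (H c) (annihilated (H c) (ideal_power R I k))"
proof -
  let ?A = "ideal_power R I k"
  note A = M.R.ideal_power_ideal[OF I, of k]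
  let ?F = "free_module R 1" and ?e = "unit_vec R 1 0"
  interpret F: module R ?F by (rule M.R.free_module)
  \<comment> \<open>The ideal \<open>I\<^sup>k\<close> inside the free module of rank one, so that
    \<open>F / K\<close> is \<open>R / I\<^sup>k\<close>.\<close>
  define K where "K = {u \<in> carrier ?F. u 0 \<in> ?A}"
  have K: "submodule K R ?F"
    unfolding K_def
    by (rule F.lin_vimage_submodule[OF M.R.self_module M.R.free_coord_lin F.carrier_is_submodule])
      (use A M.R.submodule_self_iff in auto)
  have eF: "?e \<in> carrier ?F" by (rule M.R.unit_vec_closed)
  have aeK: "a \<odot>\<^bsub>?F\<^esub> ?e \<in> K" if "a \<in> ?A" for a
    using that power_closed[OF that] F.smult_closed[OF power_closed[OF that] eF]
    by (auto simp: K_def free_module_def unit_vec_def)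
  let ?C = "ext_cocycles c 1 K" and ?HF = "Hom R ?F (Jo c)"
  interpret HF: module R ?HF by (rule Hom_module[OF F.module_axioms Jm])
  obtain S where S: "finite S" "S \<subseteq> ?C"
    and gen: "\<And>z. z \<in> ?C \<Longrightarrow> \<exists>s\<in>lspan R ?HF S. \<exists>b. ext_coboundary c 1 K b \<and>
       (\<forall>u\<in>carrier ?F. z u = s u \<oplus>\<^bsub>Jo c\<^esub> b u)"
    using ext_fg[OF noeth M K, of c] by blast
  have Cs: "submodule ?C R ?HF" by (rule ext_cocycles_submodule[OF submodule_subset[OF K]])
  have SC: "lspan R ?HF S \<subseteq> ?C" by (rule lspan_least[OF Cs S(2)])
  have Sc: "S \<subseteq> carrier ?HF" using S(2) submodule_subset[OF Cs] by blast
  \<comment> \<open>A cochain on \<open>R / I\<^sup>k\<close> has its value at the generator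
    annihilated by \<open>I\<^sup>k\<close>. Evaluation therefore lands in the torsion complex, and
    primitives of coboundaries become torsion elements.\<close>
  have annG: "y ?e \<in> G i" if y: "y \<in> module_hom R ?F (Jo i)" "\<And>v. v \<in> K \<Longrightarrow> y v = \<zero>\<^bsub>Jo i\<^esub>" for y i
  proof -
    note yl = module_homD(1)[OF y(1)]
    have "a \<odot>\<^bsub>Jo i\<^esub> y ?e = \<zero>\<^bsub>Jo i\<^esub>" if "a \<in> ?A" for a
      using lin_smult[OF yl power_closed[OF that] eF] y(2)[OF aeK[OF that]] by simp
    then show ?thesis using lin_closed[OF yl eF] by (auto simp: torsion_set_def)
  qed
  have CZ: "z ?e \<in> Z c" if "z \<in> ?C" for z
    using that annG[of z c] eF by (auto simp: Z_def ext_cocycles_def)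
  have "lin R (lspan R ?HF S) ?HF (Jo c) (\<lambda>z. z ?e)"
    using eF SC by (rule_tac lin_eval) (auto simp: ext_cocycles_def)
  then have "lin R (lspan R ?HF S) ?HF (H c) (\<lambda>z. pr c (z ?e))"
    by (rule lin_compose[OF _ pr_lin]) (use SC CZ in blast)
  note \<Phi> = this
  have SS: "submodule (lspan R ?HF S) R ?HF" by (rule HF.lspan_submodule[OF Sc])
  have "fin_gen R ?HF (lspan R ?HF S)"
    unfolding fin_gen_def using S(1) lspan_superset[of S R ?HF] by blast
  then have im: "fin_gen R (H c) ((\<lambda>z. pr c (z ?e)) ` lspan R ?HF S)"
    by (rule HF.fg_image[OF H_module SS \<Phi>])
  have ims: "submodule ((\<lambda>z. pr c (z ?e)) ` lspan R ?HF S) R (H c)"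
    by (rule HF.lin_image_submodule[OF H_module \<Phi> SS])
  show ?thesis
  proof (rule H.submodule_fg[OF noeth ims im])
    show "submodule (annihilated (H c) ?A) R (H c)"
      by (rule H.annihilated_submodule) (use power_closed in blast)
    show "annihilated (H c) ?A \<subseteq> (\<lambda>z. pr c (z ?e)) ` lspan R ?HF S"
    proof
      fix x assume "x \<in> annihilated (H c) ?A"
      then obtain z where z: "z \<in> Z c" "pr c z = x" and z0: "\<And>a. a \<in> ?A \<Longrightarrow> a \<odot>\<^bsub>Jo c\<^esub> z = \<zero>\<^bsub>Jo c\<^esub>"
        using annihilated_lift[OF vanish A] by blast
      have zc: "z \<in> carrier (Jo c)" using z(1) ZD(1) by blast
      \<comment> \<open>The cochain with value \<open>z\<close> at the generator; it vanishes on
        \<open>K\<close> because \<open>z\<close> is annihilated by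
        \<open>I\<^sup>k\<close>.\<close>
      define \<zeta> where "\<zeta> = (\<lambda>u\<in>carrier ?F. u 0 \<odot>\<^bsub>Jo c\<^esub> z)"
      have c0: "u 0 \<in> carrier R" if "u \<in> carrier ?F" for u
        using M.R.free_coord_closed[OF that] by simp
      have "lin R (carrier ?F) ?F (Jo c) (\<lambda>u. u 0 \<odot>\<^bsub>Jo c\<^esub> z)"
        by (rule lin_compose[OF M.R.free_coord_lin J.lin_orbit[OF zc]]) (use c0 in auto)
      then have \<zeta>m: "\<zeta> \<in> module_hom R ?F (Jo c)"
        unfolding \<zeta>_def by (rule restrict_module_hom[OF F.module_axioms])
      have "\<zeta> \<in> ?C"
        using \<zeta>m z(1) z0 c0 zc by (auto simp: ext_cocycles_def \<zeta>_def K_def d_smult Z_def)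
      then obtain s b where s: "s \<in> lspan R ?HF S" and b: "ext_coboundary c 1 K b"
        and eq: "\<zeta> ?e = s ?e \<oplus>\<^bsub>Jo c\<^esub> b ?e"
        using gen eF by blast
      have "\<zeta> ?e = z" using eF zc by (simp add: \<zeta>_def unit_vec_def)
      moreover have "b ?e \<in> B c"
      proof (cases c)
        case 0
        then show ?thesis using b eF by (auto simp: ext_coboundary_def B_0)
      next
        case (Suc i)
        then obtain y where "y \<in> module_hom R ?F (Jo i)" "\<forall>v\<in>K. y v = \<zero>\<^bsub>Jo i\<^esub>" "b ?e = diff J i (y ?e)"
          using b eF by (auto simp: ext_coboundary_def)
        then show ?thesis using annG[of y i] Suc by (auto simp: B_Suc)
      qed
      ultimately have "x = pr c (s ?e)"
        using pr_add_B[of "s ?e" c "b ?e"] CZ[of s] s SC z(2) eq by auto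
      then show "x \<in> (\<lambda>z. pr c (z ?e)) ` lspan R ?HF S" using s by blast
    qed
  qed
qed

text \<open>The comparison theorem for endomorphisms of \<open>M\<close>: exactness and injectivity
  determine the lift degree by degree through dependent choice.\<close>

lemma chain_lift_exists:
  assumes f: "f \<in> module_hom R M M"
  shows "\<exists>\<phi>. chain_lift R M J J f \<phi>"
proof -
  note fl = module_homD(1)[OF f]
  \<comment> \<open>The clause on the kernel of the differential is carried along because the next
    degree is obtained by factoring through that differential.\<close>
  define P where "P i \<phi> \<longleftrightarrow> \<phi> \<in> module_hom R (Jo i) (Jo i) \<and>
      (\<forall>x\<in>carrier (Jo i). diff J i x = \<zero>\<^bsub>Jo (Suc i)\<^esub> \<longrightarrow> diff J i (\<phi> x) = \<zero>\<^bsub>Jo (Suc i)\<^esub>) \<and>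
      (i = 0 \<longrightarrow> (\<forall>x\<in>carrier M. \<phi> (aug J x) = aug J (f x)))" for i \<phi>
  define Q where "Q i \<phi> \<psi> \<longleftrightarrow> (\<forall>x\<in>carrier (Jo i). \<psi> (diff J i x) = diff J i (\<phi> x))" for i \<phi> \<psi>
  have "\<exists>\<Phi>. \<forall>i. P i (\<Phi> i) \<and> Q i (\<Phi> i) (\<Phi> (Suc i))"
  proof (rule dependent_nat_choice[of P Q])
    have aug_inj: "x = \<zero>\<^bsub>M\<^esub>" if "x \<in> carrier M" "aug J x = \<zero>\<^bsub>Jo 0\<^esub>" for x
    proof -
      have "inj_on (aug J) (carrier M)" using res by (simp add: injective_resolution_def)
      moreover have "aug J \<zero>\<^bsub>M\<^esub> = \<zero>\<^bsub>Jo 0\<^esub>" by (rule M.lin_zero[OF Jm aug_lin M.carrier_is_submodule])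
      ultimately show ?thesis using that inj_onD by fastforce
    qed
    have af: "lin R (carrier M) M (Jo 0) (\<lambda>x. aug J (f x))"
      by (rule lin_compose[OF fl aug_lin lin_closed[OF fl]])
    have "\<exists>g. lin R (carrier (Jo 0)) (Jo 0) (Jo 0) g \<and> (\<forall>x\<in>carrier M. g (aug J x) = aug J (f x))"
      by (rule M.baer_lift[OF Jm Jm Jb M.carrier_is_submodule aug_lin af])
        (use aug_inj M.lin_zero[OF Jm af M.carrier_is_submodule] in blast)
    then obtain g where g: "lin R (carrier (Jo 0)) (Jo 0) (Jo 0) g"
      and ga: "\<forall>x\<in>carrier M. g (aug J x) = aug J (f x)" by (elim exE conjE)
    have "diff J 0 (g x) = \<zero>\<^bsub>Jo (Suc 0)\<^esub>" if x: "x \<in> carrier (Jo 0)" "diff J 0 x = \<zero>\<^bsub>Jo (Suc 0)\<^esub>" for x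
    proof -
      have "x \<in> aug J ` carrier M" unfolding aug_image using x by simp
      then obtain m where m: "m \<in> carrier M" "x = aug J m" by blast
      have "aug J (f m) \<in> aug J ` carrier M" using lin_closed[OF fl m(1)] by blast
      then show ?thesis unfolding aug_image using ga m by simp
    qed
    then have "P 0 (restrict g (carrier (Jo 0)))"
      using restrict_module_hom[OF Jm g] ga lin_closed[OF aug_lin] by (auto simp: P_def)
    then show "\<exists>\<phi>. P 0 \<phi>" by (rule exI[of _ "restrict g (carrier (Jo 0))"])
    fix \<phi> i assume "P i \<phi>"
    then have \<phi>: "\<phi> \<in> module_hom R (Jo i) (Jo i)"
      and \<phi>k: "\<And>x. x \<in> carrier (Jo i) \<Longrightarrow> diff J i x = \<zero>\<^bsub>Jo (Suc i)\<^esub> \<Longrightarrow> diff J i (\<phi> x) = \<zero>\<^bsub>Jo (Suc i)\<^esub>"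
      by (auto simp: P_def)
    note \<phi>l = module_homD(1)[OF \<phi>]
    have "\<exists>g. lin R (carrier (Jo (Suc i))) (Jo (Suc i)) (Jo (Suc i)) g \<and>
        (\<forall>x\<in>carrier (Jo i). g (diff J i x) = diff J i (\<phi> x))"
      by (rule J.baer_lift[OF Jm Jm Jb J.carrier_is_submodule d_lin
            lin_compose[OF \<phi>l d_lin lin_closed[OF \<phi>l]] \<phi>k])
    then obtain g where g: "lin R (carrier (Jo (Suc i))) (Jo (Suc i)) (Jo (Suc i)) g"
      and gd: "\<forall>x\<in>carrier (Jo i). g (diff J i x) = diff J i (\<phi> x)" by (elim exE conjE)
    have "diff J (Suc i) (g x) = \<zero>\<^bsub>Jo (Suc (Suc i))\<^esub>"
      if x: "x \<in> carrier (Jo (Suc i))" "diff J (Suc i) x = \<zero>\<^bsub>Jo (Suc (Suc i))\<^esub>" for x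
    proof -
      obtain y where y: "y \<in> carrier (Jo i)" "x = diff J i y" using d_exact[OF x] by blast
      then show ?thesis using gd d_d[OF lin_closed[OF \<phi>l y(1)]] by simp
    qed
    then have "P (Suc i) (restrict g (carrier (Jo (Suc i))))"
      using restrict_module_hom[OF Jm g] by (auto simp: P_def)
    moreover have "Q i \<phi> (restrict g (carrier (Jo (Suc i))))"
      using gd d_closed by (auto simp: Q_def)
    ultimately show "\<exists>\<psi>. P (Suc i) \<psi> \<and> Q i \<phi> \<psi>" by blast
  qed
  then obtain \<Phi> where "\<And>i. P i (\<Phi> i)" "\<And>i. Q i (\<Phi> i) (\<Phi> (Suc i))" by blast
  then have "chain_lift R M J J f \<Phi>" unfolding chain_lift_def P_def Q_def by blast
  then show ?thesis by (rule exI[of _ \<Phi>])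
qed

text \<open>Every chain lift preserves torsion, hence cocycles and coboundaries, so the union in the
  definition runs over a constant family. The argument applies to whichever lift \<open>SOME\<close>
  selects.\<close>

lemma local_cohomology_map_hom:
  assumes f: "f \<in> module_hom R M M"
  shows "local_cohomology_map R I M J J i f \<in> module_hom R (H i) (H i)"
proof -
  define \<phi> where "\<phi> = (SOME \<phi>. chain_lift R M J J f \<phi>)"
  have cl: "chain_lift R M J J f \<phi>"
    unfolding \<phi>_def using chain_lift_exists[OF f] by (rule someI_ex)
  have \<phi>l: "lin R (carrier (Jo k)) (Jo k) (Jo k) (\<phi> k)" for k
    using cl by (simp add: chain_lift_def module_hom_iff)
  have \<phi>d: "\<phi> (Suc k) (diff J k x) = diff J k (\<phi> k x)" if "x \<in> carrier (Jo k)" for k x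
    using cl that by (simp add: chain_lift_def)
  have \<phi>B: "\<phi> i b \<in> B i" if b: "b \<in> B i" for b
  proof (cases i)
    case 0
    then show ?thesis using b J.lin_zero[OF Jm \<phi>l J.carrier_is_submodule, of 0] by (simp add: B_0)
  next
    case (Suc k)
    then obtain w where w: "w \<in> G k" "b = diff J k w" using b by (auto simp: B_Suc)
    then have "\<phi> (Suc k) b = diff J k (\<phi> k w)" using \<phi>d GD(1) by blast
    then show ?thesis using lin_torsion_set[OF \<phi>l w(1)] Suc by (auto simp: B_Suc)
  qed
  have \<phi>Z: "\<phi> i x \<in> Z i" if "x \<in> Z i" for x
    using that lin_torsion_set[OF \<phi>l, of x i] \<phi>d[of x i, symmetric] GD(1)[of i]
      J.lin_zero[OF Jm \<phi>l J.carrier_is_submodule, of "Suc i"] by (auto simp: Z_def)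
  define g where "g = local_cohomology_map R I M J J i f"
  have "lin R (Z i) (Jo i) (H i) (\<lambda>x. pr i (\<phi> i x))"
    by (rule lin_compose[OF lin_mono[OF \<phi>l ZD(1)] pr_lin \<phi>Z])
  moreover have "pr i (\<phi> i x) = \<zero>\<^bsub>H i\<^esub>" if "x \<in> Z i" "pr i x = \<zero>\<^bsub>H i\<^esub>" for x
    using that pr_zero \<phi>Z \<phi>B by blast
  ultimately have "\<exists>g'. lin R (pr i ` Z i) (H i) (H i) g' \<and> (\<forall>x\<in>Z i. g' (pr i x) = pr i (\<phi> i x))"
    by (rule J.lin_factor[OF H_module H_module Z_submodule pr_lin])
  then obtain g' where g': "lin R (pr i ` Z i) (H i) (H i) g'"
    and g'_pr: "\<forall>x\<in>Z i. g' (pr i x) = pr i (\<phi> i x)" by (elim exE conjE)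
  have g: "g (pr i x) = pr i (\<phi> i x)" if x: "x \<in> Z i" for x
  proof -
    have "pr i (\<phi> i y) = pr i (\<phi> i x)" if y: "y \<in> pr i x" for y
    proof -
      obtain b where b: "b \<in> B i" "y = x \<oplus>\<^bsub>Jo i\<^esub> b" using coset_B[OF x y] by blast
      then have "y \<in> Z i" using ZD(3)[OF x] B_subset_Z by blast
      then show ?thesis using g'_pr pr_add_B[OF x b(1)] b(2) x by metis
    qed
    then have "(\<Union>y\<in>pr i x. pr i (\<phi> i y)) = pr i (\<phi> i x)"
      using coset_self[OF x] by blast
    moreover have "pr i x \<in> carrier (H i)" using x H_carrier by blast
    ultimately show ?thesis
      unfolding g_def local_cohomology_map_def \<phi>_def[symmetric] pr_def[symmetric] Let_def by simp
  qed
  have "lin R (carrier (H i)) (H i) (H i) g"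
    unfolding H_carrier
    by (rule H.lin_cong[OF H.carrier_is_submodule, unfolded H_carrier, OF g']) (use g g'_pr in auto)
  moreover have "g \<in> extensional (carrier (H i))"
    by (simp add: g_def local_cohomology_map_def Let_def)
  ultimately show ?thesis by (simp add: g_def module_hom_iff)
qed

end

section \<open>Matlis duality\<close>

lemma injective_hull_socle:
  fixes R (structure)
  assumes local: "local_ring R \<mm>" and E: "injective_hull R (residue_module R \<mm>) E"
  shows "\<exists>e\<in>carrier E. e \<noteq> \<zero>\<^bsub>E\<^esub> \<and> (\<forall>i\<in>\<mm>. i \<odot>\<^bsub>E\<^esub> e = \<zero>\<^bsub>E\<^esub>) \<and>
    (\<forall>S. submodule S R E \<longrightarrow> S \<noteq> {\<zero>\<^bsub>E\<^esub>} \<longrightarrow> (\<exists>r\<in>carrier R. r \<odot>\<^bsub>E\<^esub> e \<in> S \<and> r \<odot>\<^bsub>E\<^esub> e \<noteq> \<zero>\<^bsub>E\<^esub>))"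
proof -
  interpret cring R using local by (simp add: local_ring_def)
  interpret E: module R E using E by (simp add: injective_hull_def injective_module_def)
  have m: "ideal \<mm> R" using local by (auto simp: local_ring_def dest: maximalideal.axioms(1))
  note self = self_module
  have sub: "submodule \<mm> R (self_module R)" using m submodule_self_iff by blast
  have sc: "carrier (self_module R) = carrier R" by (simp add: self_module_def)
  define c where "c r = \<mm> +>\<^bsub>self_module R\<^esub> r" for r
  have car: "carrier (residue_module R \<mm>) = c ` carrier R"
    and cl: "lin R (carrier R) (self_module R) (residue_module R \<mm>) c"
    and c0: "\<And>r. r \<in> carrier R \<Longrightarrow> c r = \<zero>\<^bsub>residue_module R \<mm>\<^esub> \<longleftrightarrow> r \<in> \<mm>"
    and mod: "module R (residue_module R \<mm>)"
    using quotient_module_carrier[OF self sub] quotient_module_lin[OF self sub]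
      quotient_module_zero[OF self sub] quotient_module_module[OF self sub]
    by (simp_all add: residue_module_def c_def[abs_def] sc)
  interpret k: module R "residue_module R \<mm>" by (rule mod)
  obtain j where j: "j \<in> module_hom R (residue_module R \<mm>) E"
    and inj: "inj_on j (carrier (residue_module R \<mm>))"
    and ess: "\<And>S. submodule S R E \<Longrightarrow> S \<noteq> {\<zero>\<^bsub>E\<^esub>} \<Longrightarrow> S \<inter> j ` carrier (residue_module R \<mm>) \<noteq> {\<zero>\<^bsub>E\<^esub>}"
    using E unfolding injective_hull_def by blast
  note jl = module_homD(1)[OF j]
  have j0: "j \<zero>\<^bsub>residue_module R \<mm>\<^esub> = \<zero>\<^bsub>E\<^esub>"
    by (rule k.lin_zero[OF E.module_axioms jl k.carrier_is_submodule])
  have cc: "c r \<in> carrier (residue_module R \<mm>)" if "r \<in> carrier R" for r using that car by blast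
  have jc: "j (c r) = r \<odot>\<^bsub>E\<^esub> j (c \<one>)" if r: "r \<in> carrier R" for r
  proof -
    have "c r = r \<odot>\<^bsub>residue_module R \<mm>\<^esub> c \<one>"
      using lin_smult[OF cl r one_closed] r by (simp add: self_module_def)
    then show ?thesis using lin_smult[OF jl r cc[OF one_closed]] by simp
  qed
  have jz: "j (c r) = \<zero>\<^bsub>E\<^esub> \<longleftrightarrow> r \<in> \<mm>" if "r \<in> carrier R" for r
    using inj_on_eq_iff[OF inj cc[OF that] k.zero_closed] j0 c0[OF that] by simp
  show ?thesis
  proof (intro bexI[of _ "j (c \<one>)"] conjI ballI allI impI)
    show "j (c \<one>) \<in> carrier E" using lin_closed[OF jl cc[OF one_closed]] .
    show "j (c \<one>) \<noteq> \<zero>\<^bsub>E\<^esub>" using jz[OF one_closed] local_ring_one_notin[OF local] by simp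
    show "i \<odot>\<^bsub>E\<^esub> j (c \<one>) = \<zero>\<^bsub>E\<^esub>" if "i \<in> \<mm>" for i
    proof -
      have i: "i \<in> carrier R" using that ideal_subset[OF m] by blast
      show ?thesis using jz[OF i] jc[OF i] that by simp
    qed
    fix S assume S: "submodule S R E" "S \<noteq> {\<zero>\<^bsub>E\<^esub>}"
    define X where "X = S \<inter> j ` carrier (residue_module R \<mm>)"
    have "\<zero>\<^bsub>E\<^esub> \<in> X"
      using submodule_zero[OF S(1)] j0 k.zero_closed unfolding X_def by (metis IntI imageI)
    moreover have "X \<noteq> {\<zero>\<^bsub>E\<^esub>}" using ess[OF S] by (simp add: X_def)
    ultimately obtain y where "y \<in> X" and y0: "y \<noteq> \<zero>\<^bsub>E\<^esub>" by blast
    then have y: "y \<in> S" "y \<in> j ` c ` carrier R" by (auto simp: X_def car)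
    from y(2) obtain r where r: "r \<in> carrier R" "y = j (c r)" by blast
    then show "\<exists>r\<in>carrier R. r \<odot>\<^bsub>E\<^esub> j (c \<one>) \<in> S \<and> r \<odot>\<^bsub>E\<^esub> j (c \<one>) \<noteq> \<zero>\<^bsub>E\<^esub>"
      using y(1) y0 jc[OF r(1)] r by (intro bexI[of _ r]) simp_all
  qed
qed

text \<open>The hull enters only through Baer's criterion and the element \<open>e\<close>, the
  image of \<open>\<one>\<close> under the embedding of the residue field. The last two assumptions
  say that \<open>e\<close> spans an essential copy of that field.\<close>

locale matlis = E: module R E for R (structure) and E :: "('r, 'e) module" +
  fixes \<mm> and e
  assumes local: "local_ring R \<mm>" and noeth: "noetherian_ring R" and baer: "baer R E"
    and e: "e \<in> carrier E" "e \<noteq> \<zero>\<^bsub>E\<^esub>" "\<And>i. i \<in> \<mm> \<Longrightarrow> i \<odot>\<^bsub>E\<^esub> e = \<zero>\<^bsub>E\<^esub>"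
    and ess: "\<And>S. submodule S R E \<Longrightarrow> S \<noteq> {\<zero>\<^bsub>E\<^esub>} \<Longrightarrow> \<exists>r\<in>carrier R. r \<odot>\<^bsub>E\<^esub> e \<in> S \<and> r \<odot>\<^bsub>E\<^esub> e \<noteq> \<zero>\<^bsub>E\<^esub>"
begin

abbreviation zero_E ("\<zero>\<^sub>E") where "\<zero>\<^sub>E \<equiv> \<zero>\<^bsub>E\<^esub>"
abbreviation add_E (infixl "\<oplus>\<^sub>E" 65) where "x \<oplus>\<^sub>E y \<equiv> x \<oplus>\<^bsub>E\<^esub> y"
abbreviation smult_E (infixl "\<odot>\<^sub>E" 70) where "a \<odot>\<^sub>E x \<equiv> a \<odot>\<^bsub>E\<^esub> x"
abbreviation "D N \<equiv> Hom R N E"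
abbreviation "dual N \<equiv> module_hom R N E"

lemma m_ideal: "ideal \<mm> R"
  using local by (auto simp: local_ring_def dest: maximalideal.axioms(1))

lemma m_closed: "i \<in> \<mm> \<Longrightarrow> i \<in> carrier R"
  using E.R.ideal_subset[OF m_ideal] by blast

lemma annihilator_ideal:
  assumes "module R N" "x \<in> carrier N"
  shows "ideal {r \<in> carrier R. r \<odot>\<^bsub>N\<^esub> x = \<zero>\<^bsub>N\<^esub>} R"
proof -
  interpret N: module R N by fact
  show ?thesis
    by (rule E.R.idealI') (use assms(2) in \<open>auto simp: N.smult_l_distr N.smult_assoc1\<close>)
qed

text \<open>Modulo \<open>\<mm>\<close> the scalar \<open>r\<close> is invertible, and the error
  term in \<open>\<mm>\<close> kills \<open>x\<close>.\<close>

lemma unit_multiple: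
  assumes "module R N" "x \<in> carrier N" "\<And>i. i \<in> \<mm> \<Longrightarrow> i \<odot>\<^bsub>N\<^esub> x = \<zero>\<^bsub>N\<^esub>" "r \<in> carrier R" "r \<notin> \<mm>"
  shows "\<exists>s\<in>carrier R. s \<odot>\<^bsub>N\<^esub> (r \<odot>\<^bsub>N\<^esub> x) = x"
proof -
  interpret N: module R N by fact
  obtain i s where 1: "i \<in> \<mm>" "s \<in> carrier R" "\<one> = i \<oplus> s \<otimes> r"
    using local_ring_unit_mod[OF local assms(4,5)] by blast
  have "x = (i \<oplus> s \<otimes> r) \<odot>\<^bsub>N\<^esub> x" using assms(2) by (simp flip: 1(3))
  also have "\<dots> = s \<odot>\<^bsub>N\<^esub> (r \<odot>\<^bsub>N\<^esub> x)"
    using 1(1,2) assms m_closed[OF 1(1)] by (simp add: N.smult_l_distr N.smult_assoc1)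
  finally show ?thesis using 1(2) by force
qed

lemma essential_multiple:
  assumes "x \<in> carrier E" "x \<noteq> \<zero>\<^sub>E"
  shows "\<exists>r\<in>carrier R. \<exists>s\<in>carrier R. r \<odot>\<^sub>E e = s \<odot>\<^sub>E x \<and> r \<odot>\<^sub>E e \<noteq> \<zero>\<^sub>E"
proof -
  interpret S: module R "self_module R" by (rule E.R.self_module)
  have "submodule ((\<lambda>r. r \<odot>\<^sub>E x) ` carrier R) R E"
    by (rule S.lin_image_submodule[OF E.module_axioms E.lin_orbit[OF assms(1)]])
      (use S.carrier_is_submodule in \<open>simp add: self_module_def\<close>)
  moreover have "\<one> \<odot>\<^sub>E x \<in> (\<lambda>r. r \<odot>\<^sub>E x) ` carrier R" by blast
  then have "(\<lambda>r. r \<odot>\<^sub>E x) ` carrier R \<noteq> {\<zero>\<^sub>E}" using assms by auto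
  ultimately show ?thesis using ess by blast
qed

text \<open>The socle of \<open>E\<close> is one-dimensional over the residue field: essentiality
  joins \<open>x\<close> and \<open>y\<close> to nonzero multiples of \<open>e\<close>, and the
  scalars involved can be inverted on elements killed by \<open>\<mm>\<close>.\<close>

lemma socle_multiple:
  assumes x: "x \<in> carrier E" "\<And>i. i \<in> \<mm> \<Longrightarrow> i \<odot>\<^sub>E x = \<zero>\<^sub>E" "x \<noteq> \<zero>\<^sub>E"
    and y: "y \<in> carrier E" "\<And>i. i \<in> \<mm> \<Longrightarrow> i \<odot>\<^sub>E y = \<zero>\<^sub>E"
  shows "\<exists>r\<in>carrier R. y = r \<odot>\<^sub>E x"
proof (cases "y = \<zero>\<^sub>E")
  case True
  then show ?thesis using x(1) by (intro bexI[of _ \<zero>]) auto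
next
  case False
  obtain r s where 1: "r \<in> carrier R" "s \<in> carrier R" "r \<odot>\<^sub>E e = s \<odot>\<^sub>E x" "r \<odot>\<^sub>E e \<noteq> \<zero>\<^sub>E"
    using essential_multiple[OF x(1,3)] by blast
  obtain t u where 2: "t \<in> carrier R" "u \<in> carrier R" "t \<odot>\<^sub>E e = u \<odot>\<^sub>E y" "t \<odot>\<^sub>E e \<noteq> \<zero>\<^sub>E"
    using essential_multiple[OF y(1) False] by blast
  have "r \<notin> \<mm>" using 1(4) e(3) by blast
  then obtain v where v: "v \<in> carrier R" "v \<odot>\<^sub>E (r \<odot>\<^sub>E e) = e"
    using unit_multiple[OF E.module_axioms e(1,3) 1(1)] by blast
  have "u \<notin> \<mm>" using 2(3,4) y(2) by auto
  then obtain w where w: "w \<in> carrier R" "w \<odot>\<^sub>E (u \<odot>\<^sub>E y) = y"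
    using unit_multiple[OF E.module_axioms y(1,2) 2(2)] by blast
  have "y = w \<odot>\<^sub>E (t \<odot>\<^sub>E (v \<odot>\<^sub>E (s \<odot>\<^sub>E x)))" using w(2) v(2) 1(3) 2(3) by simp
  also have "\<dots> = (w \<otimes> (t \<otimes> (v \<otimes> s))) \<odot>\<^sub>E x"
    using 1 2 v w x(1) by (simp add: E.smult_assoc1)
  finally show ?thesis using 1 2 v w by blast
qed

lemma power_closed: "a \<in> ideal_power R \<mm> k \<Longrightarrow> a \<in> carrier R"
  using E.R.ideal_subset[OF E.R.ideal_power_ideal[OF m_ideal]] by blast

text \<open>The cyclic module generated by \<open>x\<close> is \<open>R\<close> modulo the
  annihilator of \<open>x\<close>. Essentiality of the socle gives each of its nonzero elements a
  nonzero multiple killed by \<open>\<mm>\<close>, so a power of \<open>\<mm>\<close> lies in the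
  annihilator.\<close>

lemma E_torsion:
  assumes x: "x \<in> carrier E"
  shows "\<exists>k. \<forall>a\<in>ideal_power R \<mm> k. a \<odot>\<^sub>E x = \<zero>\<^sub>E"
proof -
  define A where "A = {r \<in> carrier R. r \<odot>\<^sub>E x = \<zero>\<^sub>E}"
  have A: "ideal A R" unfolding A_def by (rule annihilator_ideal[OF E.module_axioms x])
  have "\<exists>s. ideal_power R \<mm> s \<subseteq> A"
  proof (rule E.R.ideal_power_subset_if_essential[OF noeth A m_ideal])
    fix r assume r: "r \<in> carrier R" "r \<notin> A"
    then have "r \<odot>\<^sub>E x \<noteq> \<zero>\<^sub>E" by (simp add: A_def)
    then obtain t u where tu: "t \<in> carrier R" "u \<in> carrier R"
      "t \<odot>\<^sub>E e = u \<odot>\<^sub>E (r \<odot>\<^sub>E x)" "t \<odot>\<^sub>E e \<noteq> \<zero>\<^sub>E"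
      using essential_multiple[of "r \<odot>\<^sub>E x"] r x by auto
    show "\<exists>u\<in>carrier R. u \<otimes> r \<notin> A \<and> (\<forall>i\<in>\<mm>. i \<otimes> (u \<otimes> r) \<in> A)"
    proof (intro bexI[of _ u] conjI ballI)
      show "u \<otimes> r \<notin> A" using tu r x by (simp add: A_def E.smult_assoc1)
      fix i assume i: "i \<in> \<mm>"
      have "(i \<otimes> (u \<otimes> r)) \<odot>\<^sub>E x = (t \<otimes> i) \<odot>\<^sub>E e"
        using tu r x m_closed[OF i] e(1) by (simp add: E.smult_assoc1 E.R.m_comm[of t i])
      also have "\<dots> = \<zero>\<^sub>E" using tu m_closed[OF i] e(1) e(3)[OF i] by (simp add: E.smult_assoc1)
      finally show "i \<otimes> (u \<otimes> r) \<in> A" using tu r m_closed[OF i] by (simp add: A_def)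
    qed (use tu in simp)
  qed
  then show ?thesis by (auto simp: A_def)
qed

text \<open>The annihilator of a nonzero \<open>x\<close> lies in \<open>\<mm>\<close>, so
  \<open>r x \<mapsto> r e\<close> is well defined, and it extends to \<open>N\<close> by
  injectivity of \<open>E\<close>.\<close>

lemma cogenerator:
  assumes N: "module R N" and x: "x \<in> carrier N" "x \<noteq> \<zero>\<^bsub>N\<^esub>"
  shows "\<exists>\<psi>\<in>dual N. \<psi> x \<noteq> \<zero>\<^sub>E"
proof -
  interpret N: module R N by fact
  interpret S: module R "self_module R" by (rule E.R.self_module)
  define A where "A = {r \<in> carrier R. r \<odot>\<^bsub>N\<^esub> x = \<zero>\<^bsub>N\<^esub>}"
  have A: "ideal A R" unfolding A_def by (rule annihilator_ideal[OF N x(1)])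
  have "\<one> \<notin> A" using x by (simp add: A_def)
  then have "A \<noteq> carrier R" by blast
  then have Am: "A \<subseteq> \<mm>" by (rule local_ring_proper_ideal[OF local noeth A])
  have "\<exists>g. lin R (carrier N) N E g \<and> (\<forall>r\<in>carrier R. g (r \<odot>\<^bsub>N\<^esub> x) = r \<odot>\<^sub>E e)"
    by (rule S.baer_lift[OF N E.module_axioms baer _ N.lin_orbit[OF x(1)] E.lin_orbit[OF e(1)]])
      (use S.carrier_is_submodule Am e(3) in \<open>auto simp: self_module_def A_def\<close>)
  then obtain g where g: "lin R (carrier N) N E g" "\<forall>r\<in>carrier R. g (r \<odot>\<^bsub>N\<^esub> x) = r \<odot>\<^sub>E e"
    by (elim exE conjE)
  have "g x = e" using g(2)[rule_format, of \<one>] x e(1) by simp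
  then show ?thesis
    using restrict_module_hom[OF N g(1)] x(1) e(2) by (intro bexI[of _ "restrict g (carrier N)"]) auto
qed

lemma separated:
  assumes N: "module R N" and "x \<in> carrier N" "y \<in> carrier N"
    and eq: "\<And>\<psi>. \<psi> \<in> dual N \<Longrightarrow> \<psi> x = \<psi> y"
  shows "x = y"
proof (rule ccontr)
  interpret N: module R N by fact
  let ?z = "x \<oplus>\<^bsub>N\<^esub> (\<ominus> \<one>) \<odot>\<^bsub>N\<^esub> y"
  assume "x \<noteq> y"
  then have "?z \<noteq> \<zero>\<^bsub>N\<^esub>" using N.add_neg_one assms(2,3) by blast
  then obtain \<psi> where \<psi>: "\<psi> \<in> dual N" "\<psi> ?z \<noteq> \<zero>\<^sub>E"
    using cogenerator[OF N, of ?z] assms(2,3) by auto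
  note l = module_homD(1)[OF \<psi>(1)]
  have "\<psi> ?z = \<psi> x \<oplus>\<^sub>E (\<ominus> \<one>) \<odot>\<^sub>E \<psi> y"
    using assms(2,3) by (simp add: lin_add[OF l] lin_smult[OF l])
  then show False using \<psi>(2) eq[OF \<psi>(1)] E.add_neg_one lin_closed[OF l] assms(2,3) by simp
qed

text \<open>On \<open>P\<close> the evaluation at \<open>s\<close> takes values in the
  one-dimensional socle of \<open>E\<close>. The discrepancy between \<open>\<theta>\<close> and the
  evaluation at \<open>x\<close> vanishes where the evaluation at \<open>s\<close> does, so it is a
  scalar multiple of it.\<close>

lemma extend_evaluation:
  assumes N: "module R N" and P: "submodule P R (D N)" and \<theta>: "lin R P (D N) E \<theta>"
    and s: "s \<in> carrier N" "\<And>\<psi> i. \<psi> \<in> P \<Longrightarrow> i \<in> \<mm> \<Longrightarrow> \<psi> (i \<odot>\<^bsub>N\<^esub> s) = \<zero>\<^sub>E"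
    and x: "x \<in> carrier N" "\<And>\<psi>. \<psi> \<in> P \<Longrightarrow> \<psi> s = \<zero>\<^sub>E \<Longrightarrow> \<theta> \<psi> = \<psi> x"
  shows "\<exists>r\<in>carrier R. \<forall>\<psi>\<in>P. \<theta> \<psi> = \<psi> (x \<oplus>\<^bsub>N\<^esub> r \<odot>\<^bsub>N\<^esub> s)"
proof (cases "\<exists>\<psi>\<in>P. \<psi> s \<noteq> \<zero>\<^sub>E")
  case False
  then show ?thesis using s(1) x by (intro bexI[of _ \<zero>]) (auto simp: module.smult_l_null[OF N]
    abelian_group.axioms(1)[OF module.axioms(2)[OF N]] abelian_monoid.r_zero)
next
  case True
  \<comment> \<open>The value of \<open>\<psi>0\<close> at \<open>s\<close> spans the socle, so the
    scalar can be read off at this one functional.\<close>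
  then obtain \<psi>0 where \<psi>0: "\<psi>0 \<in> P" "\<psi>0 s \<noteq> \<zero>\<^sub>E" by blast
  interpret N: module R N by fact
  interpret D: module R "D N" by (rule Hom_module[OF N E.module_axioms])
  have Pm: "\<psi> \<in> dual N" if "\<psi> \<in> P" for \<psi>
    using submodule_subset[OF P] that by (auto simp: Hom_simps)
  note l = module_homD(1)[OF Pm]
  have cl: "\<psi> y \<in> carrier E" if "\<psi> \<in> P" "y \<in> carrier N" for \<psi> y using lin_closed[OF l[OF that(1)] that(2)] .
  have soc: "i \<odot>\<^sub>E \<psi> s = \<zero>\<^sub>E" if "\<psi> \<in> P" "i \<in> \<mm>" for \<psi> i
    using lin_smult[OF l[OF that(1)] m_closed[OF that(2)] s(1)] s(2)[OF that] by simp
  \<comment> \<open>The discrepancy at \<open>\<psi>0\<close>. It lies in the socle: multiplying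
    \<open>\<psi>0\<close> by an element of \<open>\<mm>\<close> makes it vanish at
    \<open>s\<close>, where there is no discrepancy.\<close>
  let ?t = "\<theta> \<psi>0 \<oplus>\<^sub>E (\<ominus> \<one>) \<odot>\<^sub>E \<psi>0 x"
  have tc: "?t \<in> carrier E" using lin_closed[OF \<theta> \<psi>0(1)] cl[OF \<psi>0(1) x(1)] by simp
  have "i \<odot>\<^sub>E ?t = \<zero>\<^sub>E" if i: "i \<in> \<mm>" for i
  proof -
    note ic = m_closed[OF i]
    let ?\<chi> = "i \<odot>\<^bsub>D N\<^esub> \<psi>0"
    have \<chi>: "?\<chi> \<in> P" by (rule submodule_smult[OF P ic \<psi>0(1)])
    have "?\<chi> s = \<zero>\<^sub>E" using soc[OF \<psi>0(1) i] s(1) by (simp add: Hom_simps)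
    then have "\<theta> ?\<chi> = ?\<chi> x" by (rule x(2)[OF \<chi>])
    then have "i \<odot>\<^sub>E \<theta> \<psi>0 = i \<odot>\<^sub>E \<psi>0 x"
      using lin_smult[OF \<theta> ic \<psi>0(1)] x(1) by (simp add: Hom_simps)
    moreover have "i \<odot>\<^sub>E ?t = i \<odot>\<^sub>E \<theta> \<psi>0 \<oplus>\<^sub>E (\<ominus> \<one>) \<odot>\<^sub>E (i \<odot>\<^sub>E \<psi>0 x)"
      using ic lin_closed[OF \<theta> \<psi>0(1)] cl[OF \<psi>0(1) x(1)]
      by (simp add: E.smult_r_distr E.smult_l_minus E.smult_r_minus)
    ultimately show ?thesis
      using E.add_neg_one[of "i \<odot>\<^sub>E \<theta> \<psi>0" "i \<odot>\<^sub>E \<psi>0 x"] ic lin_closed[OF \<theta> \<psi>0(1)] cl[OF \<psi>0(1) x(1)]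
      by simp
  qed
  then obtain r where r: "r \<in> carrier R" "?t = r \<odot>\<^sub>E \<psi>0 s"
    using socle_multiple[OF cl[OF \<psi>0(1) s(1)] soc[OF \<psi>0(1)] \<psi>0(2) tc] by blast
  have "\<theta> \<psi> = \<psi> (x \<oplus>\<^bsub>N\<^esub> r \<odot>\<^bsub>N\<^esub> s)" if \<psi>: "\<psi> \<in> P" for \<psi>
  proof -
    obtain a where a: "a \<in> carrier R" "\<psi> s = a \<odot>\<^sub>E \<psi>0 s"
      using socle_multiple[OF cl[OF \<psi>0(1) s(1)] soc[OF \<psi>0(1)] \<psi>0(2) cl[OF \<psi> s(1)] soc[OF \<psi>]] by blast
    \<comment> \<open>Subtracting a multiple of \<open>\<psi>0\<close> makes the functional vanish
      at \<open>s\<close>, where the hypothesis on \<open>x\<close> applies.\<close>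
    let ?\<chi> = "\<psi> \<oplus>\<^bsub>D N\<^esub> (\<ominus> a) \<odot>\<^bsub>D N\<^esub> \<psi>0"
    have \<chi>: "?\<chi> \<in> P" by (rule D.submodule_diff[OF P \<psi> \<psi>0(1) a(1)])
    have \<chi>v: "?\<chi> y = \<psi> y \<oplus>\<^sub>E (\<ominus> a) \<odot>\<^sub>E \<psi>0 y" if "y \<in> carrier N" for y
      using that by (simp add: Hom_simps)
    have "?\<chi> s = \<zero>\<^sub>E"
      using \<chi>v[OF s(1)] a E.add_neg_smult[of "\<psi> s" "\<psi>0 s" a] cl[OF \<psi> s(1)] cl[OF \<psi>0(1) s(1)] by simp
    then have "\<theta> ?\<chi> = ?\<chi> x" by (rule x(2)[OF \<chi>])
    then have eq: "\<theta> \<psi> \<oplus>\<^sub>E (\<ominus> a) \<odot>\<^sub>E \<theta> \<psi>0 = \<psi> x \<oplus>\<^sub>E (\<ominus> a) \<odot>\<^sub>E \<psi>0 x"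
      using D.lin_diff[OF E.module_axioms \<theta> P \<psi> \<psi>0(1) a(1)] \<chi>v[OF x(1)] by simp
    note c = lin_closed[OF \<theta> \<psi>] lin_closed[OF \<theta> \<psi>0(1)] cl[OF \<psi> x(1)] cl[OF \<psi>0(1) x(1)]
      cl[OF \<psi> s(1)] cl[OF \<psi>0(1) s(1)]
    have "\<theta> \<psi> = (\<theta> \<psi> \<oplus>\<^sub>E (\<ominus> a) \<odot>\<^sub>E \<theta> \<psi>0) \<oplus>\<^sub>E a \<odot>\<^sub>E \<theta> \<psi>0"
      using E.split_diff c a(1) by simp
    also have "\<dots> = (\<psi> x \<oplus>\<^sub>E (\<ominus> a) \<odot>\<^sub>E \<psi>0 x) \<oplus>\<^sub>E a \<odot>\<^sub>E \<theta> \<psi>0" using eq by simp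
    also have "\<dots> = \<psi> x \<oplus>\<^sub>E a \<odot>\<^sub>E ?t"
      using c a(1) by (simp add: E.smult_r_distr E.smult_l_minus E.smult_r_minus E.a_ac)
    also have "a \<odot>\<^sub>E ?t = r \<odot>\<^sub>E \<psi> s"
      using r a c E.R.m_comm[of a r] by (simp add: E.smult_assoc1[symmetric])
    also have "\<psi> x \<oplus>\<^sub>E r \<odot>\<^sub>E \<psi> s = \<psi> (x \<oplus>\<^bsub>N\<^esub> r \<odot>\<^bsub>N\<^esub> s)"
      using lin_add[OF l[OF \<psi>]] lin_smult[OF l[OF \<psi>]] r(1) s(1) x(1) by simp
    finally show ?thesis .
  qed
  then show ?thesis using r(1) by blast
qed

text \<open>Generators are absorbed one at a time: the induction hypothesis handles the functionals
  that vanish at \<open>s\<close>, and one application of \<open>extend_evaluation\<close> then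
  corrects the point by a multiple of \<open>s\<close>.\<close>

lemma extend_evaluation_finite:
  assumes N: "module R N" and "finite S" "S \<subseteq> carrier N"
    and "submodule P R (D N)" "lin R P (D N) E \<theta>"
    and "\<And>\<psi> i s. \<psi> \<in> P \<Longrightarrow> s \<in> S \<Longrightarrow> i \<in> \<mm> \<Longrightarrow> \<psi> (i \<odot>\<^bsub>N\<^esub> s) = \<zero>\<^sub>E"
    and x: "x \<in> carrier N" and "\<And>\<psi>. \<psi> \<in> P \<Longrightarrow> (\<And>s. s \<in> S \<Longrightarrow> \<psi> s = \<zero>\<^sub>E) \<Longrightarrow> \<theta> \<psi> = \<psi> x"
  shows "\<exists>y\<in>lspan R N S. \<forall>\<psi>\<in>P. \<theta> \<psi> = \<psi> (x \<oplus>\<^bsub>N\<^esub> y)"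
  using assms(2-6,8)
proof (induction S arbitrary: P rule: finite_induct)
  case empty
  interpret N: module R N by fact
  have "\<zero>\<^bsub>N\<^esub> \<in> lspan R N {}" by (auto simp: lspan_def submodule_zero)
  then show ?case using empty x by (intro bexI[of _ "\<zero>\<^bsub>N\<^esub>"]) auto
next
  case (insert s S)
  interpret N: module R N by fact
  interpret D: module R "D N" by (rule Hom_module[OF N E.module_axioms])
  note P = insert.prems(2)
  have Pm: "P \<subseteq> dual N" using submodule_subset[OF P] by (simp add: Hom_simps)
  let ?P = "{\<psi> \<in> P. \<psi> s = \<zero>\<^sub>E}"
  have s: "s \<in> carrier N" using insert.prems(1) by simp
  have P': "submodule ?P R (D N)"
    by (rule D.lin_kernel_submodule[OF E.module_axioms lin_eval[OF s Pm] P])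
  have "\<exists>y\<in>lspan R N S. \<forall>\<psi>\<in>?P. \<theta> \<psi> = \<psi> (x \<oplus>\<^bsub>N\<^esub> y)"
  proof (rule insert.IH[OF _ P'])
    show "lin R ?P (D N) E \<theta>" by (rule lin_mono[OF insert.prems(3)]) auto
    show "\<theta> \<psi> = \<psi> x" if "\<psi> \<in> ?P" "\<And>t. t \<in> S \<Longrightarrow> \<psi> t = \<zero>\<^sub>E" for \<psi>
      using insert.prems(5)[of \<psi>] that by auto
  qed (use insert.prems in auto)
  then obtain y where y: "y \<in> lspan R N S" "\<And>\<psi>. \<psi> \<in> P \<Longrightarrow> \<psi> s = \<zero>\<^sub>E \<Longrightarrow> \<theta> \<psi> = \<psi> (x \<oplus>\<^bsub>N\<^esub> y)" by blast
  have sp: "submodule (lspan R N (insert s S)) R N" by (rule N.lspan_submodule) (use insert.prems in auto)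
  have yi: "y \<in> lspan R N (insert s S)"
    using y(1) lspan_least[OF sp, of S] lspan_superset[of "insert s S" R N] by blast
  then have yc: "y \<in> carrier N" using submodule_subset[OF sp] by blast
  then obtain r where r: "r \<in> carrier R" "\<forall>\<psi>\<in>P. \<theta> \<psi> = \<psi> ((x \<oplus>\<^bsub>N\<^esub> y) \<oplus>\<^bsub>N\<^esub> r \<odot>\<^bsub>N\<^esub> s)"
    using extend_evaluation[OF N P insert.prems(3) s, of "x \<oplus>\<^bsub>N\<^esub> y"] insert.prems(4) y(2) x by auto
  show ?case
  proof (intro bexI[of _ "y \<oplus>\<^bsub>N\<^esub> r \<odot>\<^bsub>N\<^esub> s"] ballI)
    show "y \<oplus>\<^bsub>N\<^esub> r \<odot>\<^bsub>N\<^esub> s \<in> lspan R N (insert s S)"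
      using yi lspan_superset[of "insert s S" R N] by (intro submodule_add[OF sp] submodule_smult[OF sp] r) auto
    show "\<theta> \<psi> = \<psi> (x \<oplus>\<^bsub>N\<^esub> (y \<oplus>\<^bsub>N\<^esub> r \<odot>\<^bsub>N\<^esub> s))" if "\<psi> \<in> P" for \<psi>
      using r that x yc s by (simp add: N.a_assoc)
  qed
qed

section \<open>Completeness and reflexivity of finitely generated modules\<close>

lemma limit_exists:
  assumes complete: "adically_complete R \<mm>"
    and b: "\<And>k. b k \<in> carrier R" "\<And>k. \<exists>u\<in>ideal_power R \<mm> k. b (Suc k) = b k \<oplus> u"
  shows "\<exists>l\<in>carrier R. \<forall>k. \<exists>v\<in>ideal_power R \<mm> k. l = b k \<oplus> v"
proof -
  let ?P = "ideal_power R \<mm>"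
  note P = E.R.ideal_power_ideal[OF m_ideal]
  note PD = E.R.idealD[OF P]
  \<comment> \<open>Successive corrections from the powers of \<open>\<mm>\<close> make these cosets
    decrease, so they form an element of the inverse limit.\<close>
  define s where "s k = ?P k +> b k" for k
  have "s k \<in> carrier (R Quot (?P k))" for k
    using b(1) by (auto simp: s_def FactRing_def A_RCOSETS_def')
  moreover have "s (Suc k) \<subseteq> s k" for k
  proof
    fix y assume "y \<in> s (Suc k)"
    then obtain v where v: "v \<in> ?P (Suc k)" "y = v \<oplus> b (Suc k)" by (auto simp: s_def a_r_coset_def')
    obtain u where u: "u \<in> ?P k" "b (Suc k) = b k \<oplus> u" using b(2) by blast
    have vk: "v \<in> ?P k" using v(1) E.R.ideal_power_antimono[OF m_ideal, of k "Suc k"] by auto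
    have "y = (v \<oplus> u) \<oplus> b k"
      using v u vk b(1) PD(1) power_closed by (simp add: E.R.a_ac)
    then show "y \<in> s k" using PD(3)[OF vk u(1)] by (auto simp: s_def a_r_coset_def')
  qed
  ultimately have "s \<in> (\<lambda>r k. ?P k +> r) ` carrier R"
    using bij_betw_imp_surj_on[OF complete[unfolded adically_complete_def]] by blast
  then obtain l where l: "l \<in> carrier R" "s = (\<lambda>k. ?P k +> l)" by blast
  have "\<exists>v\<in>?P k. l = b k \<oplus> v" for k
  proof -
    have "\<zero> \<oplus> l \<in> ?P k +> l" using PD(2) unfolding a_r_coset_def' by blast
    then have "l \<in> ?P k +> b k" using l(1) fun_cong[OF l(2), of k] unfolding s_def by simp
    then obtain v where v: "v \<in> ?P k" "l = v \<oplus> b k" by (auto simp: a_r_coset_def')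
    then show ?thesis using b(1) power_closed E.R.a_comm by blast
  qed
  then show ?thesis using l(1) by blast
qed

text \<open>On the functionals that kill \<open>\<mm>\<^sup>k N\<close>, \<open>\<theta>\<close> is
  evaluation at a point, and passing from \<open>k\<close> to \<open>k + 1\<close> changes the point
  by an element of \<open>\<mm>\<^sup>k N\<close>. Every functional kills some
  \<open>\<mm>\<^sup>k N\<close>, because \<open>N\<close> has finitely many generators and
  \<open>E\<close> is \<open>\<mm>\<close>-power torsion; so evaluation at the limit of the points
  is \<open>\<theta>\<close>.\<close>

lemma reflexive:
  assumes complete: "adically_complete R \<mm>"
    and N: "module R N" and fgN: "fin_gen R N (carrier N)"
    and \<theta>: "lin R (dual N) (D N) E \<theta>"
  shows "\<exists>x\<in>carrier N. \<forall>\<psi>\<in>dual N. \<theta> \<psi> = \<psi> x"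
proof -
  interpret N: module R N by fact
  interpret D: module R "D N" by (rule Hom_module[OF N E.module_axioms])
  have D: "submodule (dual N) R (D N)"
    using D.carrier_is_submodule by (simp add: Hom_simps)
  obtain p \<pi> where \<pi>: "lin R (carrier (free_module R p)) (free_module R p) N \<pi>"
    and \<pi>N: "\<pi> ` carrier (free_module R p) = carrier N"
    using N.free_cover[OF N.carrier_is_submodule fgN] by blast
  let ?F = "free_module R p" and ?P = "ideal_power R \<mm>"
  interpret F: module R ?F by (rule E.R.free_module)
  note PI = E.R.idealD[OF E.R.ideal_power_ideal[OF m_ideal]]
  \<comment> \<open>This is \<open>\<mm>\<^sup>k F\<close>, written in coordinates; its image
    \<open>U k\<close> below is \<open>\<mm>\<^sup>k N\<close>.\<close>
  define V where "V k = {u \<in> carrier ?F. \<forall>j<p. u j \<in> ?P k}" for k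
  have V: "submodule (V k) R ?F" for k
  proof (rule F.submoduleI')
    show "\<zero>\<^bsub>?F\<^esub> \<in> V k" using F.zero_closed PI(2) by (simp add: V_def free_module_def)
    show "u \<oplus>\<^bsub>?F\<^esub> v \<in> V k" if "u \<in> V k" "v \<in> V k" for u v
      using that F.a_closed[of u v] PI(3) by (simp add: V_def free_module_def)
    show "a \<odot>\<^bsub>?F\<^esub> u \<in> V k" if "a \<in> carrier R" "u \<in> V k" for a u
      using that F.smult_closed[of a u] PI(4) by (simp add: V_def free_module_def)
  qed (auto simp: V_def)
  have VF: "u \<in> carrier ?F" if "u \<in> V k" for u k using that by (simp add: V_def)
  have mV: "i \<odot>\<^bsub>?F\<^esub> u \<in> V (Suc k)" if "i \<in> \<mm>" "u \<in> V k" for i u k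
  proof -
    have "i \<otimes> u j \<in> ?P (Suc k)" if "j < p" for j
    proof -
      have "u j \<in> ?P k" using \<open>u \<in> V k\<close> that by (simp add: V_def)
      then show ?thesis
        using E.R.ideal_power_mult[of "u j" \<mm> k i] \<open>i \<in> \<mm>\<close> E.R.m_comm[of i "u j"] m_closed power_closed by (simp del: nat_pow_Suc)
    qed
    then show ?thesis
      using F.smult_closed[OF m_closed VF] that by (simp add: V_def free_module_def del: nat_pow_Suc)
  qed
  define U where "U k = \<pi> ` V k" for k
  have \<pi>V: "lin R (V k) ?F N \<pi>" for k by (rule lin_mono[OF \<pi>]) (use VF in blast)
  have U: "submodule (U k) R N" for k
    unfolding U_def by (rule F.lin_image_submodule[OF N \<pi>V V])
  note Uc = submodule_subset[OF U]
  define Pp where "Pp k = {\<psi> \<in> dual N. \<forall>x\<in>U k. \<psi> x = \<zero>\<^sub>E}" for k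
  have Pm: "Pp k \<subseteq> dual N" for k by (auto simp: Pp_def)
  have Pp: "submodule (Pp k) R (D N)" for k
    unfolding Pp_def
    by (rule vanishing_submodule[OF N E.module_axioms E.module_axioms _ Uc]) (simp add: lin_def)
  \<comment> \<open>The approximations are chosen in the free cover rather than in \<open>N\<close>,
    because completeness is a property of \<open>R\<close> and can be applied to each
    coordinate.\<close>
  have "\<exists>w. \<forall>k. (w k \<in> carrier ?F \<and> (\<forall>\<psi>\<in>Pp k. \<theta> \<psi> = \<psi> (\<pi> (w k)))) \<and> (\<exists>u\<in>V k. w (Suc k) = w k \<oplus>\<^bsub>?F\<^esub> u)"
  proof (rule dependent_nat_choice[of "\<lambda>k w. w \<in> carrier ?F \<and> (\<forall>\<psi>\<in>Pp k. \<theta> \<psi> = \<psi> (\<pi> w))"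
        "\<lambda>k w w'. \<exists>u\<in>V k. w' = w \<oplus>\<^bsub>?F\<^esub> u"])
    \<comment> \<open>The zeroth power is the whole ring, so \<open>Pp 0\<close> contains only the
      zero functional and any starting point works.\<close>
    have "V 0 = carrier ?F"
      unfolding V_def E.R.ideal_power_0 using E.R.free_coord_closed by blast
    then have "U 0 = carrier N" using \<pi>N by (simp add: U_def)
    have "\<theta> \<psi> = \<psi> (\<pi> \<zero>\<^bsub>?F\<^esub>)" if \<psi>: "\<psi> \<in> Pp 0" for \<psi>
    proof -
      have z: "\<psi> x = \<zero>\<^sub>E" if "x \<in> carrier N" for x
        using \<psi> that \<open>U 0 = carrier N\<close> by (simp add: Pp_def)
      have "\<psi> = \<zero>\<^bsub>D N\<^esub>"
        using module_hom_ext[of \<psi> R N E "\<zero>\<^bsub>D N\<^esub>"] \<psi> Pm z D.zero_closed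
        by (auto simp: Hom_simps)
      then have "\<theta> \<psi> = \<zero>\<^sub>E" using D.lin_zero[OF E.module_axioms \<theta> D] by simp
      then show ?thesis using z lin_closed[OF \<pi> F.zero_closed] by simp
    qed
    then show "\<exists>w. w \<in> carrier ?F \<and> (\<forall>\<psi>\<in>Pp 0. \<theta> \<psi> = \<psi> (\<pi> w))" using F.zero_closed by blast
    fix w k assume w: "w \<in> carrier ?F \<and> (\<forall>\<psi>\<in>Pp k. \<theta> \<psi> = \<psi> (\<pi> w))"
    have "fin_gen R N (U k)" by (rule N.submodule_fg[OF noeth N.carrier_is_submodule fgN U Uc])
    then obtain S where S: "finite S" "S \<subseteq> U k" "U k \<subseteq> lspan R N S" by (auto simp: fin_gen_def)
    have "\<exists>y\<in>lspan R N S. \<forall>\<psi>\<in>Pp (Suc k). \<theta> \<psi> = \<psi> (\<pi> w \<oplus>\<^bsub>N\<^esub> y)"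
    proof (rule extend_evaluation_finite[OF N S(1) _ Pp])
      show "S \<subseteq> carrier N" using S(2) Uc by blast
      show "lin R (Pp (Suc k)) (D N) E \<theta>" by (rule lin_mono[OF \<theta> Pm])
      show "\<psi> (i \<odot>\<^bsub>N\<^esub> s) = \<zero>\<^sub>E" if "\<psi> \<in> Pp (Suc k)" "s \<in> S" "i \<in> \<mm>" for \<psi> i s
      proof -
        obtain u where u: "u \<in> V k" "s = \<pi> u" using \<open>s \<in> S\<close> S(2) by (auto simp: U_def)
        have "i \<odot>\<^bsub>N\<^esub> s = \<pi> (i \<odot>\<^bsub>?F\<^esub> u)"
          using lin_smult[OF \<pi> m_closed VF] u \<open>i \<in> \<mm>\<close> by simp
        then have "i \<odot>\<^bsub>N\<^esub> s \<in> U (Suc k)" using mV[OF \<open>i \<in> \<mm>\<close> u(1)] by (auto simp: U_def)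
        then show ?thesis using \<open>\<psi> \<in> Pp (Suc k)\<close> by (simp add: Pp_def)
      qed
      show "\<pi> w \<in> carrier N" using lin_closed[OF \<pi>] w by blast
      show "\<theta> \<psi> = \<psi> (\<pi> w)" if \<psi>: "\<psi> \<in> Pp (Suc k)" "\<And>s. s \<in> S \<Longrightarrow> \<psi> s = \<zero>\<^sub>E" for \<psi>
      proof -
        have \<psi>m: "\<psi> \<in> dual N" using \<psi>(1) Pm by blast
        have "submodule {x \<in> carrier N. \<psi> x = \<zero>\<^sub>E} R N"
          by (rule N.lin_kernel_submodule[OF E.module_axioms module_homD(1)[OF \<psi>m] N.carrier_is_submodule])
        then have "lspan R N S \<subseteq> {x \<in> carrier N. \<psi> x = \<zero>\<^sub>E}"
          by (rule lspan_least) (use \<psi>(2) S(2) Uc in blast)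
        then have "\<psi> \<in> Pp k" using \<psi>m S(3) by (auto simp: Pp_def)
        then show ?thesis using w by blast
      qed
    qed
    then obtain y where y: "y \<in> lspan R N S" "\<forall>\<psi>\<in>Pp (Suc k). \<theta> \<psi> = \<psi> (\<pi> w \<oplus>\<^bsub>N\<^esub> y)" by blast
    have "y \<in> U k" using y(1) lspan_least[OF U S(2)] by blast
    then obtain u where u: "u \<in> V k" "y = \<pi> u" by (auto simp: U_def)
    have "\<pi> (w \<oplus>\<^bsub>?F\<^esub> u) = \<pi> w \<oplus>\<^bsub>N\<^esub> y" using lin_add[OF \<pi> _ VF[OF u(1)]] w u(2) by simp
    then show "\<exists>w'. (w' \<in> carrier ?F \<and> (\<forall>\<psi>\<in>Pp (Suc k). \<theta> \<psi> = \<psi> (\<pi> w'))) \<and> (\<exists>u\<in>V k. w' = w \<oplus>\<^bsub>?F\<^esub> u)"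
      using y(2) u(1) w VF[OF u(1)] by (intro exI[of _ "w \<oplus>\<^bsub>?F\<^esub> u"]) auto
  qed
  then obtain w where w: "\<And>k. w k \<in> carrier ?F" "\<And>k \<psi>. \<psi> \<in> Pp k \<Longrightarrow> \<theta> \<psi> = \<psi> (\<pi> (w k))"
    "\<And>k. \<exists>u\<in>V k. w (Suc k) = w k \<oplus>\<^bsub>?F\<^esub> u" by blast
  have "\<exists>l\<in>carrier R. \<forall>k. \<exists>v\<in>?P k. l = w k j \<oplus> v" if j: "j < p" for j
  proof (rule limit_exists[OF complete])
    show "w k j \<in> carrier R" for k by (rule E.R.free_coord_closed[OF w(1) j])
    fix k
    obtain u where u: "u \<in> V k" "w (Suc k) = w k \<oplus>\<^bsub>?F\<^esub> u" using w(3) by blast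
    have "w (Suc k) j = w k j \<oplus> u j" using u(2) j by (simp add: free_module_def)
    then show "\<exists>u\<in>?P k. w (Suc k) j = w k j \<oplus> u" using u(1) j by (auto simp: V_def)
  qed
  then obtain l where l: "\<And>j. j < p \<Longrightarrow> l j \<in> carrier R"
    "\<And>j k. j < p \<Longrightarrow> \<exists>v\<in>?P k. l j = w k j \<oplus> v" by metis
  define W where "W = (\<lambda>j\<in>{..<p}. l j)"
  have WF: "W \<in> carrier ?F" using l(1) by (auto simp: W_def free_module_def)
  have Wk: "\<exists>v\<in>V k. W = w k \<oplus>\<^bsub>?F\<^esub> v" for k
  proof -
    have "\<forall>j\<in>{..<p}. \<exists>v. v \<in> ?P k \<and> l j = w k j \<oplus> v" using l(2) by blast
    then have "\<exists>v. \<forall>j\<in>{..<p}. v j \<in> ?P k \<and> l j = w k j \<oplus> v j" by (rule bchoice)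
    then obtain v where v: "\<And>j. j < p \<Longrightarrow> v j \<in> ?P k" "\<And>j. j < p \<Longrightarrow> l j = w k j \<oplus> v j" by auto
    have "(\<lambda>j\<in>{..<p}. v j) \<in> V k" using v(1) power_closed by (auto simp: V_def free_module_def)
    moreover have "W = w k \<oplus>\<^bsub>?F\<^esub> (\<lambda>j\<in>{..<p}. v j)"
      using v(2) by (auto simp: W_def free_module_def)
    ultimately show ?thesis by blast
  qed
  \<comment> \<open>The finitely many values of \<open>\<psi>\<close> at the generators are killed
    by a common power of \<open>\<mm>\<close>, and these values determine \<open>\<psi>\<close> on
    the image of \<open>V k\<close>.\<close>
  have "\<exists>k. \<psi> \<in> Pp k" if \<psi>: "\<psi> \<in> dual N" for \<psi>
  proof -
    note \<psi>l = module_homD(1)[OF \<psi>]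
    let ?x = "\<lambda>j. \<psi> (\<pi> (unit_vec R p j))"
    have xc: "?x j \<in> carrier E" for j
      by (rule lin_closed[OF \<psi>l lin_closed[OF \<pi> E.R.unit_vec_closed]])
    obtain \<kappa> where \<kappa>: "\<And>j. \<forall>a\<in>?P (\<kappa> j). a \<odot>\<^sub>E ?x j = \<zero>\<^sub>E" using E_torsion[OF xc] by metis
    define k where "k = Max (insert 0 (\<kappa> ` {..<p}))"
    have kill: "a \<odot>\<^sub>E ?x j = \<zero>\<^sub>E" if "a \<in> ?P k" "j < p" for a j
    proof -
      have "\<kappa> j \<le> k" using that(2) by (simp add: k_def)
      then show ?thesis using \<kappa> that(1) E.R.ideal_power_antimono[OF m_ideal] by blast
    qed
    have "\<psi> (\<pi> u) = \<zero>\<^sub>E" if u: "u \<in> V k" for u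
    proof -
      have "\<psi> (\<pi> u) = lincomb E ?x p u"
      proof (rule E.free_lin_unique[OF _ E.lincomb_lin[OF xc] _ VF[OF u]])
        show "lin R (carrier ?F) ?F E (\<lambda>u. \<psi> (\<pi> u))"
          by (rule lin_compose[OF \<pi> \<psi>l lin_closed[OF \<pi>]])
        show "\<psi> (\<pi> (unit_vec R p i)) = lincomb E ?x p (unit_vec R p i)" if "i < p" for i
          by (subst E.lincomb_unit_vec) (use xc that in auto)
      qed
      moreover have "lincomb E ?x n u = \<zero>\<^sub>E" if "n \<le> p" for n
        using that
      proof (induction n)
        case (Suc n)
        then have "u n \<odot>\<^sub>E ?x n = \<zero>\<^sub>E" using kill u by (simp add: V_def)
        then show ?case using Suc by simp
      qed simp
      ultimately show ?thesis by simp
    qed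
    then have "\<psi> \<in> Pp k" using \<psi> by (auto simp: Pp_def U_def)
    then show ?thesis ..
  qed
  then have "\<theta> \<psi> = \<psi> (\<pi> W)" if \<psi>: "\<psi> \<in> dual N" for \<psi>
  proof -
    obtain k where k: "\<psi> \<in> Pp k" using \<open>\<And>\<psi>. \<psi> \<in> dual N \<Longrightarrow> \<exists>k. \<psi> \<in> Pp k\<close> \<psi> by blast
    obtain v where v: "v \<in> V k" "W = w k \<oplus>\<^bsub>?F\<^esub> v" using Wk by blast
    have "\<pi> W = \<pi> (w k) \<oplus>\<^bsub>N\<^esub> \<pi> v" using lin_add[OF \<pi> w(1) VF[OF v(1)]] v(2) by simp
    moreover have "\<psi> (\<pi> v) = \<zero>\<^sub>E" using k v(1) by (simp add: Pp_def U_def)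
    moreover have "\<psi> (\<pi> (w k) \<oplus>\<^bsub>N\<^esub> \<pi> v) = \<psi> (\<pi> (w k)) \<oplus>\<^sub>E \<psi> (\<pi> v)"
      by (rule lin_add[OF module_homD(1)[OF \<psi>] lin_closed[OF \<pi> w(1)] lin_closed[OF \<pi> VF[OF v(1)]]])
    ultimately show ?thesis
      using w(2)[OF k] lin_closed[OF module_homD(1)[OF \<psi>] lin_closed[OF \<pi> w(1)]] by simp
  qed
  then show ?thesis using lin_closed[OF \<pi> WF] by blast
qed

end

section \<open>Functionals on the dual that are killed by an ideal\<close>

context matlis begin

text \<open>By injectivity of \<open>E\<close>, the homomorphisms that vanish on the elements annihilated by
  \<open>T\<close> are the sums of multiples of homomorphisms by elements of \<open>T\<close>.\<close>

lemma vanishes_if_killed: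
  assumes H: "module R H" and \<theta>: "lin R (dual H) (D H) E \<theta>"
    and "finite T" "T \<subseteq> carrier R"
    and "\<And>a \<psi>. a \<in> T \<Longrightarrow> \<psi> \<in> dual H \<Longrightarrow> \<theta> (a \<odot>\<^bsub>D H\<^esub> \<psi>) = \<zero>\<^sub>E"
    and "\<psi> \<in> dual H" "\<And>x. x \<in> annihilated H T \<Longrightarrow> \<psi> x = \<zero>\<^sub>E"
  shows "\<theta> \<psi> = \<zero>\<^sub>E"
  using assms(3-)
proof (induction T arbitrary: \<psi> rule: finite_induct)
  interpret H: module R H by fact
  interpret D: module R "D H" by (rule Hom_module[OF H E.module_axioms])
  have D: "submodule (dual H) R (D H)"
    using D.carrier_is_submodule by (simp add: Hom_simps)
  {
    case empty
    then have "\<psi> = \<zero>\<^bsub>D H\<^esub>"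
      using module_hom_ext[of \<psi> R H E "\<zero>\<^bsub>D H\<^esub>"] D.zero_closed
      by (auto simp: Hom_simps annihilated_def)
    then show ?case using D.lin_zero[OF E.module_axioms \<theta> D] by simp
  next
    case (insert a T)
    have a: "a \<in> carrier R" and T: "T \<subseteq> carrier R" using insert.prems(1) by auto
    let ?K = "annihilated H T"
    have K: "submodule ?K R H" by (rule H.annihilated_submodule[OF T])
    note \<psi>l = module_homD(1)[OF insert.prems(3)]
    \<comment> \<open>On \<open>(0 : T)\<close> the kernel of multiplication by \<open>a\<close>
      consists of the elements killed by \<open>insert a T\<close>, where \<open>\<psi>\<close>
      vanishes. Hence \<open>\<psi>\<close> factors through multiplication by \<open>a\<close>
      there, and subtracting \<open>a\<close> times an extension leaves a functional that vanishes
      on \<open>(0 : T)\<close>.\<close>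
    have "\<exists>g. lin R (carrier H) H E g \<and> (\<forall>x\<in>?K. g (a \<odot>\<^bsub>H\<^esub> x) = \<psi> x)"
    proof (rule H.baer_lift[OF H E.module_axioms baer K])
      show "lin R ?K H H (\<lambda>x. a \<odot>\<^bsub>H\<^esub> x)"
        by (rule lin_mono[OF H.lin_mult_by[OF a] submodule_subset[OF K]])
      show "lin R ?K H E \<psi>" by (rule lin_mono[OF \<psi>l submodule_subset[OF K]])
      show "\<psi> x = \<zero>\<^sub>E" if "x \<in> ?K" "a \<odot>\<^bsub>H\<^esub> x = \<zero>\<^bsub>H\<^esub>" for x
        using insert.prems(4)[of x] that by (auto simp: annihilated_def)
    qed
    then obtain g where g: "lin R (carrier H) H E g" and ga: "\<forall>x\<in>?K. g (a \<odot>\<^bsub>H\<^esub> x) = \<psi> x"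
      by (elim exE conjE)
    define \<chi> where "\<chi> = restrict g (carrier H)"
    have \<chi>: "\<chi> \<in> dual H" unfolding \<chi>_def by (rule restrict_module_hom[OF H g])
    let ?\<delta> = "\<psi> \<oplus>\<^bsub>D H\<^esub> (\<ominus> \<one>) \<odot>\<^bsub>D H\<^esub> (a \<odot>\<^bsub>D H\<^esub> \<chi>)"
    have a\<chi>: "a \<odot>\<^bsub>D H\<^esub> \<chi> \<in> dual H" by (rule submodule_smult[OF D a \<chi>])
    have \<delta>: "?\<delta> \<in> dual H"
      using D.submodule_diff[OF D insert.prems(3) a\<chi>, of \<one>] by simp
    have "\<theta> ?\<delta> = \<zero>\<^sub>E"
    proof (rule insert.IH[OF T _ \<delta>])
      show "\<theta> (b \<odot>\<^bsub>D H\<^esub> \<phi>) = \<zero>\<^sub>E" if "b \<in> T" "\<phi> \<in> dual H" for b \<phi>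
        using insert.prems(2) that by simp
      fix x assume x: "x \<in> ?K"
      have xc: "x \<in> carrier H" using x submodule_subset[OF K] by blast
      have "a \<odot>\<^sub>E \<chi> x = \<psi> x"
        using lin_smult[OF module_homD(1)[OF \<chi>] a xc] ga x xc a by (simp add: \<chi>_def)
      then show "?\<delta> x = \<zero>\<^sub>E"
        using xc E.add_neg_one[of "\<psi> x" "\<psi> x"] lin_closed[OF \<psi>l xc] by (simp add: Hom_simps)
    qed
    moreover have "\<theta> ?\<delta> = \<theta> \<psi> \<oplus>\<^sub>E (\<ominus> \<one>) \<odot>\<^sub>E \<theta> (a \<odot>\<^bsub>D H\<^esub> \<chi>)"
      using D.lin_diff[OF E.module_axioms \<theta> D insert.prems(3) a\<chi>, of \<one>] by simp
    moreover have "\<theta> (a \<odot>\<^bsub>D H\<^esub> \<chi>) = \<zero>\<^sub>E" using insert.prems(2)[OF _ \<chi>] by simp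
    ultimately show ?case using lin_closed[OF \<theta> insert.prems(3)] by simp
  }
qed

text \<open>The annihilator of an element is an ideal, so the induction over a finite set of
  generators settles the whole ideal.\<close>

lemma annihilated_genideal:
  assumes "module R H" "T \<subseteq> carrier R" "x \<in> annihilated H T"
  shows "x \<in> annihilated H (genideal R T)"
proof -
  have x: "x \<in> carrier H" using assms(3) by (simp add: annihilated_def)
  note annihilator_ideal[OF assms(1) x]
  then have "genideal R T \<subseteq> {r \<in> carrier R. r \<odot>\<^bsub>H\<^esub> x = \<zero>\<^bsub>H\<^esub>}"
    by (rule E.R.genideal_minimal) (use assms in \<open>auto simp: annihilated_def\<close>)
  then show ?thesis using x by (auto simp: annihilated_def)
qed

text \<open>A functional that kills \<open>A D(H)\<close> depends only on restrictions to
  \<open>N = (0 : A)\<close>, by \<open>vanishes_if_killed\<close>. Reflexivity of the finitely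
  generated module \<open>N\<close> then turns it into an evaluation.\<close>

lemma evaluation_if_killed:
  assumes complete: "adically_complete R \<mm>"
    and H: "module R H" and A: "ideal A R" and fgA: "fin_gen R H (annihilated H A)"
    and \<theta>: "lin R (dual H) (D H) E \<theta>"
    and kill: "\<And>a \<psi>. a \<in> A \<Longrightarrow> \<psi> \<in> dual H \<Longrightarrow> \<theta> (a \<odot>\<^bsub>D H\<^esub> \<psi>) = \<zero>\<^sub>E"
  shows "\<exists>x\<in>carrier H. \<forall>\<psi>\<in>dual H. \<theta> \<psi> = \<psi> x"
proof -
  interpret H: module R H by fact
  interpret D: module R "D H" by (rule Hom_module[OF H E.module_axioms])
  have D: "submodule (dual H) R (D H)"
    using D.carrier_is_submodule by (simp add: Hom_simps)
  obtain T where T: "T \<subseteq> carrier R" "finite T" "A = genideal R T"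
    using noetherian_ring.finetely_gen[OF noeth A] by blast
  have TA: "T \<subseteq> A" using E.R.genideal_self[OF T(1)] T(3) by simp
  let ?K = "annihilated H A"
  have K: "submodule ?K R H" by (rule H.annihilated_submodule[OF E.R.ideal_subset[OF A]])
  define N where "N = H\<lparr>carrier := ?K\<rparr>"
  have N: "module R N" unfolding N_def by (rule submodule.submodule_is_module[OF K H])
  interpret N: module R N by (rule N)
  have Ns: "carrier N = ?K" by (simp add: N_def)
  have Kc: "?K \<subseteq> carrier H" by (rule submodule_subset[OF K])
  have linN: "lin R ?K N E f \<longleftrightarrow> lin R ?K H E f" for f by (simp add: lin_def N_def)
  define \<rho> where "\<rho> \<psi> = restrict \<psi> ?K" for \<psi> :: "_ \<Rightarrow> 'e"
  have \<rho>: "\<rho> \<psi> \<in> dual N" if "\<psi> \<in> dual H" for \<psi>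
    unfolding \<rho>_def Ns[symmetric]
    by (rule restrict_module_hom[OF N]) (use lin_mono[OF module_homD(1)[OF that] Kc] linN Ns in simp)
  have \<rho>l: "lin R (dual H) (D H) (D N) \<rho>"
    by (rule linI) (use \<rho> inf_absorb2[OF Kc] in \<open>auto simp: Hom_simps \<rho>_def Ns intro!: restrict_ext\<close>)
  have "\<exists>g. lin R (\<rho> ` dual H) (D N) E g \<and> (\<forall>\<psi>\<in>dual H. g (\<rho> \<psi>) = \<theta> \<psi>)"
  proof (rule D.lin_factor[OF Hom_module[OF N E.module_axioms] E.module_axioms D \<rho>l \<theta>])
    fix \<psi> assume \<psi>: "\<psi> \<in> dual H" "\<rho> \<psi> = \<zero>\<^bsub>D N\<^esub>"
    show "\<theta> \<psi> = \<zero>\<^sub>E"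
    proof (rule vanishes_if_killed[OF H \<theta> T(2,1) kill \<psi>(1)])
      fix x assume "x \<in> annihilated H T"
      then have "x \<in> ?K" using annihilated_genideal[OF H T(1)] T(3) by simp
      then show "\<psi> x = \<zero>\<^sub>E" using fun_cong[OF \<psi>(2), of x] by (simp add: \<rho>_def Hom_simps Ns)
    qed (use TA in auto)
  qed
  then obtain g where g: "lin R (\<rho> ` dual H) (D N) E g"
    and g\<rho>: "\<forall>\<psi>\<in>dual H. g (\<rho> \<psi>) = \<theta> \<psi>" by (elim exE conjE)
  \<comment> \<open>Restriction of functionals to \<open>N\<close> is onto because \<open>E\<close>
    is injective; hence \<open>g\<close> is defined on the whole dual of \<open>N\<close>.\<close>
  have "\<phi> \<in> \<rho> ` dual H" if \<phi>: "\<phi> \<in> dual N" for \<phi>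
  proof -
    have "lin R ?K H E \<phi>" using module_homD(1)[OF \<phi>] linN Ns by simp
    then have "\<exists>\<psi>. lin R (carrier H) H E \<psi> \<and> (\<forall>x\<in>?K. \<psi> x = \<phi> x)"
      by (rule H.baer_extend[OF E.module_axioms baer K])
    then obtain \<psi> where \<psi>: "lin R (carrier H) H E \<psi>" "\<forall>x\<in>?K. \<psi> x = \<phi> x" by (elim exE conjE)
    have m: "restrict \<psi> (carrier H) \<in> dual H" by (rule restrict_module_hom[OF H \<psi>(1)])
    have "\<phi> = \<rho> (restrict \<psi> (carrier H))"
      by (rule module_hom_ext[OF \<phi> \<rho>[OF m]]) (use \<psi>(2) Kc in \<open>auto simp: Ns \<rho>_def\<close>)
    then show ?thesis using m by blast
  qed
  then have "dual N \<subseteq> \<rho> ` dual H" by blast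
  then have gN: "lin R (dual N) (D N) E g" by (rule lin_mono[OF g])
  obtain S where S: "finite S" "S \<subseteq> ?K" "?K \<subseteq> lspan R H S" using fgA by (auto simp: fin_gen_def)
  \<comment> \<open>Generation is given inside \<open>H\<close> but needed inside \<open>N\<close>;
    a submodule of \<open>N\<close> is also one of \<open>H\<close>.\<close>
  have "lspan R N S \<supseteq> ?K"
  proof -
    have sN: "submodule (lspan R N S) R N" by (rule N.lspan_submodule) (use S(2) Ns in simp)
    have "submodule (lspan R N S) R H"
      by (rule H.submoduleI') (use submoduleD[OF sN] Kc in \<open>auto simp: N_def\<close>)
    then show ?thesis using S(3) lspan_least[OF _ lspan_superset] by blast
  qed
  then have "fin_gen R N (carrier N)" unfolding fin_gen_def Ns using S(1,2) by blast
  then have "\<exists>x\<in>carrier N. \<forall>\<psi>\<in>dual N. g \<psi> = \<psi> x"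
    by (rule reflexive[OF complete N _ gN])
  then obtain x where x: "x \<in> ?K" "\<forall>\<psi>\<in>dual N. g \<psi> = \<psi> x" unfolding Ns by blast
  have "\<theta> \<psi> = \<psi> x" if "\<psi> \<in> dual H" for \<psi>
  proof -
    have "g (\<rho> \<psi>) = \<rho> \<psi> x" using x(2) \<rho>[OF that] by blast
    moreover have "g (\<rho> \<psi>) = \<theta> \<psi>" using g\<rho> that by blast
    ultimately show ?thesis using x(1) by (simp add: \<rho>_def)
  qed
  then show ?thesis using x(1) Kc by blast
qed

section \<open>The natural map from \<open>Hom(X, Y)\<close> to \<open>Hom(D Y, D X)\<close>\<close>

lemma dual_map_eq: "dual_map R E X Y g = (\<lambda>\<phi>\<in>dual Y. \<lambda>x\<in>carrier X. \<phi> (g x))"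
  by (auto simp: dual_map_def Hom_simps compose_def intro!: restrict_ext)

lemma dual_map_apply:
  "\<phi> \<in> dual Y \<Longrightarrow> x \<in> carrier X \<Longrightarrow> dual_map R E X Y g \<phi> x = \<phi> (g x)"
  by (simp add: dual_map_eq)

lemma dual_map_hom:
  assumes X: "module R X" and Y: "module R Y" and g: "g \<in> module_hom R X Y"
  shows "dual_map R E X Y g \<in> module_hom R (D Y) (D X)"
  using restrict_module_hom[OF Hom_module[OF Y E.module_axioms], of "D X"]
    precompose_lin[OF X module_homD(1)[OF g], of E]
  by (simp add: dual_map_eq Hom_simps)

lemma dual_map_inj:
  assumes X: "module R X" and Y: "module R Y"
    and g: "g \<in> module_hom R X Y" "h \<in> module_hom R X Y"
    and eq: "dual_map R E X Y g = dual_map R E X Y h"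
  shows "g = h"
proof (rule module_hom_ext[OF g])
  fix x assume x: "x \<in> carrier X"
  show "g x = h x"
  proof (rule separated[OF Y])
    show "g x \<in> carrier Y" "h x \<in> carrier Y"
      using module_hom_closed[OF g(1) x] module_hom_closed[OF g(2) x] by auto
    show "\<psi> (g x) = \<psi> (h x)" if "\<psi> \<in> dual Y" for \<psi>
      using dual_map_apply[OF that x, of g] dual_map_apply[OF that x, of h] eq by simp
  qed
qed

lemma dual_map_lin:
  assumes X: "module R X" and Y: "module R Y"
  shows "lin R (module_hom R X Y) (Hom R X Y) (Hom R (D Y) (D X)) (dual_map R E X Y)"
proof (rule linI)
  note add = lin_add[OF module_homD(1)[of _ R Y E]] and smult = lin_smult[OF module_homD(1)[of _ R Y E]]
  fix g assume g: "g \<in> module_hom R X Y"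
  note gl = module_hom_closed[OF g]
  show "dual_map R E X Y g \<in> carrier (Hom R (D Y) (D X))"
    using dual_map_hom[OF X Y g] by (simp add: Hom_simps)
  show "dual_map R E X Y (a \<odot>\<^bsub>Hom R X Y\<^esub> g) = a \<odot>\<^bsub>Hom R (D Y) (D X)\<^esub> dual_map R E X Y g"
    if "a \<in> carrier R" for a
    using that by (auto simp: dual_map_eq Hom_simps smult gl intro!: restrict_ext)
  fix h assume "h \<in> module_hom R X Y"
  note hl = module_hom_closed[OF this]
  show "dual_map R E X Y (g \<oplus>\<^bsub>Hom R X Y\<^esub> h) =
      dual_map R E X Y g \<oplus>\<^bsub>Hom R (D Y) (D X)\<^esub> dual_map R E X Y h"
    by (auto simp: dual_map_eq Hom_simps add gl hl intro!: restrict_ext)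
qed

text \<open>The two modules contribute different finiteness: torsion in \<open>X\<close> makes the
  functional \<open>\<psi> \<mapsto> \<Phi> \<psi> x\<close> killed by a power of \<open>I\<close>,
  and finite generation in \<open>Y\<close> represents such a functional by a point.\<close>

lemma dual_map_surj:
  assumes complete: "adically_complete R \<mm>" and X: "module R X" and Y: "module R Y"
    and I: "ideal I R"
    and torsion: "\<And>x. x \<in> carrier X \<Longrightarrow> \<exists>k. x \<in> annihilated X (ideal_power R I k)"
    and fg: "\<And>k. fin_gen R Y (annihilated Y (ideal_power R I k))"
    and \<Phi>: "\<Phi> \<in> module_hom R (D Y) (D X)"
  shows "\<exists>g\<in>module_hom R X Y. dual_map R E X Y g = \<Phi>"
proof -
  interpret X: module R X by fact
  interpret Y: module R Y by fact
  note \<Phi>l = module_homD(1)[OF \<Phi>, unfolded Hom_simps(1)]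
  have \<Phi>m: "\<Phi> \<psi> \<in> dual X" if "\<psi> \<in> dual Y" for \<psi>
    using lin_closed[OF \<Phi>l that] by (simp add: Hom_simps)
  note \<Phi>ml = module_homD(1)[OF \<Phi>m]
  have "\<exists>y\<in>carrier Y. \<forall>\<psi>\<in>dual Y. \<Phi> \<psi> x = \<psi> y" if x: "x \<in> carrier X" for x
  proof -
    obtain k where k: "x \<in> annihilated X (ideal_power R I k)" using torsion[OF x] by blast
    have "lin R (dual X) (D X) E (\<lambda>\<psi>. \<psi> x)" by (rule lin_eval[OF x]) simp
    then have \<theta>: "lin R (dual Y) (D Y) E (\<lambda>\<psi>. \<Phi> \<psi> x)"
      using \<Phi>m by (rule lin_compose[OF \<Phi>l])
    show ?thesis
    proof (rule evaluation_if_killed[OF complete Y E.R.ideal_power_ideal[OF I] fg \<theta>])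
      fix a \<psi> assume a: "a \<in> ideal_power R I k" and \<psi>: "\<psi> \<in> dual Y"
      have ac: "a \<in> carrier R" using a E.R.ideal_subset[OF E.R.ideal_power_ideal[OF I]] by blast
      have "\<Phi> (a \<odot>\<^bsub>D Y\<^esub> \<psi>) x = a \<odot>\<^sub>E \<Phi> \<psi> x"
        using lin_smult[OF \<Phi>l ac \<psi>] x by (simp add: Hom_simps)
      also have "\<dots> = \<Phi> \<psi> (a \<odot>\<^bsub>X\<^esub> x)" using lin_smult[OF \<Phi>ml[OF \<psi>] ac x] by simp
      also have "a \<odot>\<^bsub>X\<^esub> x = \<zero>\<^bsub>X\<^esub>" using k a by (simp add: annihilated_def)
      also have "\<Phi> \<psi> \<zero>\<^bsub>X\<^esub> = \<zero>\<^sub>E"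
        by (rule X.lin_zero[OF E.module_axioms \<Phi>ml[OF \<psi>] X.carrier_is_submodule])
      finally show "\<Phi> (a \<odot>\<^bsub>D Y\<^esub> \<psi>) x = \<zero>\<^sub>E" .
    qed
  qed
  then have "\<exists>g. \<forall>x\<in>carrier X. g x \<in> carrier Y \<and> (\<forall>\<psi>\<in>dual Y. \<Phi> \<psi> x = \<psi> (g x))"
    by (intro bchoice) blast
  then obtain g where g: "\<And>x. x \<in> carrier X \<Longrightarrow> g x \<in> carrier Y"
    and g\<Phi>: "\<And>x \<psi>. x \<in> carrier X \<Longrightarrow> \<psi> \<in> dual Y \<Longrightarrow> \<Phi> \<psi> x = \<psi> (g x)" by blast
  \<comment> \<open>The chosen points are unique because functionals separate the elements of
    \<open>Y\<close>, so linearity of \<open>g\<close> can be tested after applying every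
    \<open>\<psi>\<close>.\<close>
  have "lin R (carrier X) X Y g"
  proof (rule linI)
    fix x y assume x: "x \<in> carrier X" and y: "y \<in> carrier X"
    show "g (x \<oplus>\<^bsub>X\<^esub> y) = g x \<oplus>\<^bsub>Y\<^esub> g y"
    proof (rule separated[OF Y])
      fix \<psi> assume \<psi>: "\<psi> \<in> dual Y"
      show "\<psi> (g (x \<oplus>\<^bsub>X\<^esub> y)) = \<psi> (g x \<oplus>\<^bsub>Y\<^esub> g y)"
        using lin_add[OF \<Phi>ml[OF \<psi>] x y] lin_add[OF module_homD(1)[OF \<psi>] g[OF x] g[OF y]]
          g\<Phi>[OF _ \<psi>] x y by simp
    qed (use g x y in auto)
  next
    fix a x assume a: "a \<in> carrier R" and x: "x \<in> carrier X"
    show "g (a \<odot>\<^bsub>X\<^esub> x) = a \<odot>\<^bsub>Y\<^esub> g x"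
    proof (rule separated[OF Y])
      fix \<psi> assume \<psi>: "\<psi> \<in> dual Y"
      show "\<psi> (g (a \<odot>\<^bsub>X\<^esub> x)) = \<psi> (a \<odot>\<^bsub>Y\<^esub> g x)"
        using lin_smult[OF \<Phi>ml[OF \<psi>] a x] lin_smult[OF module_homD(1)[OF \<psi>] a g[OF x]]
          g\<Phi>[OF _ \<psi>] x a by simp
    qed (use g x a in auto)
  qed (use g in simp)
  then have g': "restrict g (carrier X) \<in> module_hom R X Y" by (rule restrict_module_hom[OF X])
  have "dual_map R E X Y (restrict g (carrier X)) = \<Phi>"
  proof (rule module_hom_ext[OF dual_map_hom[OF X Y g'] \<Phi>])
    fix \<psi> assume "\<psi> \<in> carrier (D Y)"
    then have \<psi>: "\<psi> \<in> dual Y" by (simp add: Hom_simps)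
    show "dual_map R E X Y (restrict g (carrier X)) \<psi> = \<Phi> \<psi>"
      using \<psi> g\<Phi>[OF _ \<psi>] module_homD(2)[OF \<Phi>m[OF \<psi>]]
      by (intro extensionalityI[of _ "carrier X"]) (auto simp: dual_map_eq)
  qed
  with g' show ?thesis by blast
qed

end

theorem lemma3p5:
  fixes R :: "'r ring"
    and \<mm> I :: "'r set"
    and M :: "('r, 'm) module"
    and E :: "('r, 'e) module"
    and J :: "('r, 'm, 'j) resolution"
    and n c :: nat
  assumes local: "local_ring R \<mm>"
    and noetherian: "noetherian_ring R"
    and complete: "adically_complete R \<mm>"
    and dim: "krull_dim R = enat n"
    and I: "ideal I R"
    and M: "module R M" "finitely_generated R M"
    and E: "injective_hull R (residue_module R \<mm>) E"
    and J: "injective_resolution R M J"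
    and grade: "grade R I J = enat c"
  shows
    "let H = local_cohomology R I J c;
         DH = Hom R H E;
         \<alpha> = (\<lambda>f\<in>carrier (Hom R M M). local_cohomology_map R I M J J c f);
         \<beta> = (\<lambda>f\<in>carrier (Hom R M M). dual_map R E H H (\<alpha> f))
     in module_iso R (Hom R H H) (Hom R DH DH) \<noteq> {} \<and>
        (\<alpha> \<in> module_iso R (Hom R M M) (Hom R H H) \<longleftrightarrow>
         \<beta> \<in> module_iso R (Hom R M M) (Hom R DH DH))"
proof -
  interpret M: module R M by fact
  interpret C: inj_res_ideal R M J I
    by (intro inj_res_ideal.intro inj_res.intro inj_res_axioms.intro inj_res_ideal_axioms.intro
        M(1) J I noetherian)
  have Em: "module R E" and Eb: "baer R E"
    using E by (auto simp: injective_hull_def injective_module_def intro: injective_module_baer)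
  obtain e where e: "e \<in> carrier E" "e \<noteq> \<zero>\<^bsub>E\<^esub>" "\<forall>i\<in>\<mm>. i \<odot>\<^bsub>E\<^esub> e = \<zero>\<^bsub>E\<^esub>"
    "\<forall>S. submodule S R E \<longrightarrow> S \<noteq> {\<zero>\<^bsub>E\<^esub>} \<longrightarrow> (\<exists>r\<in>carrier R. r \<odot>\<^bsub>E\<^esub> e \<in> S \<and> r \<odot>\<^bsub>E\<^esub> e \<noteq> \<zero>\<^bsub>E\<^esub>)"
    using injective_hull_socle[OF local E] by (elim bexE conjE)
  interpret matlis R E \<mm> e
    by (intro matlis.intro matlis_axioms.intro Em local noetherian Eb) (use e in auto)
  define H where "H = local_cohomology R I J c"
  define DH where "DH = Hom R H E"
  define \<alpha> where "\<alpha> = (\<lambda>f\<in>carrier (Hom R M M). local_cohomology_map R I M J J c f)"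
  define \<beta> where "\<beta> = (\<lambda>f\<in>carrier (Hom R M M). dual_map R E H H (\<alpha> f))"
  have Hm: "module R H" unfolding H_def by (rule C.H_module)
  have vanish: "carrier (local_cohomology R I J i) = {\<zero>\<^bsub>local_cohomology R I J i\<^esub>}" if i: "i < c" for i
  proof (rule ccontr)
    assume "\<not> ?thesis"
    then have "enat c \<le> enat i"
      unfolding grade[symmetric] grade_def by (intro Inf_lower) blast
    then show False using i by simp
  qed
  obtain S where S: "S \<subseteq> carrier M" "finite S" "lspan R M S = carrier M"
    using M(2) unfolding finitely_generated_def lspan_def by (elim exE conjE)
  then have "fin_gen R M (carrier M)" unfolding fin_gen_def by (intro exI[of _ S]) simp
  then have fgH: "fin_gen R H (annihilated H (ideal_power R I k))" for k
    unfolding H_def using vanish by (intro C.annihilated_fg)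
  have torH: "\<exists>k. x \<in> annihilated H (ideal_power R I k)" if "x \<in> carrier H" for x
    using that unfolding H_def by (rule C.H_annihilated_power)
  let ?HH = "module_hom R H H" and ?DD = "module_hom R DH DH" and ?D = "dual_map R E H H"
  have DHm: "module R DH" unfolding DH_def by (rule Hom_module[OF Hm Em])
  interpret HH: module R "Hom R H H" by (rule Hom_module[OF Hm Hm])
  interpret DD: module R "Hom R DH DH" by (rule Hom_module[OF DHm DHm])
  have MM: "module R (Hom R M M)" by (rule Hom_module[OF M(1) M(1)])
  note [simp] = Hom_simps(1)
  have Dl: "lin R ?HH (Hom R H H) (Hom R DH DH) ?D"
    unfolding DH_def by (rule dual_map_lin[OF Hm Hm])
  have Dinj: "g = h" if "g \<in> ?HH" "h \<in> ?HH" "?D g = ?D h" for g h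
    using dual_map_inj[OF Hm Hm that] .
  have Dim: "?D ` ?HH = ?DD"
    using dual_map_surj[OF complete Hm Hm I torH fgH] dual_map_hom[OF Hm Hm]
    unfolding DH_def by blast
  have HHs: "submodule ?HH R (Hom R H H)" using HH.carrier_is_submodule by simp
  \<comment> \<open>A linear inverse of duality, obtained by factoring the identity through
    \<open>?D\<close>; the backward direction of (b) composes with it.\<close>
  have "\<exists>K. lin R (?D ` ?HH) (Hom R DH DH) (Hom R H H) K \<and> (\<forall>g\<in>?HH. K (?D g) = g)"
  proof (rule HH.lin_factor[OF DD.module_axioms HH.module_axioms HHs Dl])
    show "lin R ?HH (Hom R H H) (Hom R H H) (\<lambda>g. g)" by (simp add: lin_def)
    show "g = \<zero>\<^bsub>Hom R H H\<^esub>" if "g \<in> ?HH" "?D g = \<zero>\<^bsub>Hom R DH DH\<^esub>" for g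
      using Dinj[OF that(1), of "\<zero>\<^bsub>Hom R H H\<^esub>"] that(2) HH.lin_zero[OF DD.module_axioms Dl HHs]
        submodule_zero[OF HHs] by simp
  qed
  then obtain K where K: "lin R ?DD (Hom R DH DH) (Hom R H H) K" and KD: "\<forall>g\<in>?HH. K (?D g) = g"
    unfolding Dim by (elim exE conjE)
  have Dbij: "bij_betw ?D ?HH ?DD"
    using Dinj Dim by (intro bij_betw_imageI inj_onI)
  have Kbij: "bij_betw K ?DD ?HH"
    unfolding Dim[symmetric] by (rule bij_betw_byWitness[of _ ?D]) (use KD in auto)
  \<comment> \<open>In the backward direction \<open>\<alpha>\<close> is not yet known to be a
    homomorphism into \<open>?HH\<close>; this membership is what allows \<open>K\<close> to recover
    \<open>\<alpha> f\<close> from \<open>\<beta> f\<close>.\<close>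
  have \<alpha>H: "\<alpha> f \<in> ?HH" if "f \<in> module_hom R M M" for f
    using C.local_cohomology_map_hom[OF that, of c] that by (simp add: \<alpha>_def H_def)
  have \<alpha>e: "\<alpha> \<in> extensional (module_hom R M M)" and \<beta>e: "\<beta> \<in> extensional (module_hom R M M)"
    by (simp_all add: \<alpha>_def \<beta>_def)
  have \<beta>\<alpha>: "\<beta> f = ?D (\<alpha> f)" if "f \<in> module_hom R M M" for f
    using that by (simp add: \<beta>_def)
  have iso: "restrict ?D ?HH \<in> module_iso R (Hom R H H) (Hom R DH DH)"
    unfolding module_iso_def
    using Dbij restrict_module_hom[OF HH.module_axioms, of "Hom R DH DH" ?D] Dl by simp
  have "\<beta> \<in> module_iso R (Hom R M M) (Hom R DH DH)" if "\<alpha> \<in> module_iso R (Hom R M M) (Hom R H H)"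
    by (rule module_iso_compose[OF MM that, of _ ?D]) (use Dl Dbij \<beta>e \<beta>\<alpha> in simp_all)
  moreover have "\<alpha> \<in> module_iso R (Hom R M M) (Hom R H H)" if "\<beta> \<in> module_iso R (Hom R M M) (Hom R DH DH)"
    by (rule module_iso_compose[OF MM that, of _ K]) (use K Kbij \<alpha>e \<alpha>H \<beta>\<alpha> KD in simp_all)
  ultimately show ?thesis
    using iso unfolding Let_def H_def[symmetric] DH_def[symmetric] \<alpha>_def[symmetric] \<beta>_def[symmetric]
    by blast
qed

end
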